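(* Let $A,B,C,L\subset\mathbb R^2$ be convex bodies with the origin in their interiors, and suppose that $A,L\in C_+^2$. Let $\phi:[0,\infty)\to[0,\infty)$ be nondecreasing, nonconstant, and convex, with $\phi\in C^2((0,\infty))$. Assume that the measure $\mu$ on $\mathbb R^2$ with density $e^{-\phi(\|x\|_L)}$ is a probability measure. Suppose that \[ \lim_{t\to\infty}\frac{\ln\phi'(t)}{\phi(t)}=0 \] (here $\phi'(t)>0$ for all sufficiently large $t$, so the logarithm is well defined on a tail interval). Then \[ \lim_{t\to\infty}\frac{\ln[-\mu(tA;B,C)]}{\phi(r(A,L)t)}=-1. \]
   Context: A convex body is a compact convex subset of $\mathbb R^2$ with nonempty interior. A convex body is in the class $C_+^2$ if its boundary is of class $C^2$ and has strictly positive (Gauss) curvature. For a convex body $L$ with $0\in\operatorname{int}L$, the gauge is $\|x\|_L=\inf\{\lambda\ge0:x\in\lambda L\}$. For convex bodies $A,L$ containing the origin in their interiors, $r(A,L)=\max\{R>0:RL\subset A\}$. The three-body mixed measure is the mixed right derivative (whenever it exists) \[ \mu(A;B,C)=\left.\frac{\partial^2}{\partial s\,\partial t}\mu(A+sB+tC)\right|_{s=t=0^+}, \] where $+$ denotes Minkowski addition and $\alpha A=\{\alpha x:x\in A\}$. *)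

theory Defs
  imports "HOL-Probability.Probability" "HOL-Library.Set_Algebras"
begin

definition convex_body :: "(real^2) set \<Rightarrow> bool" where
  "convex_body K \<longleftrightarrow> compact K \<and> convex K \<and> interior K \<noteq> {}"

definition cross2 :: "real^2 \<Rightarrow> real^2 \<Rightarrow> real" where
  "cross2 u v = u $ 1 * v $ 2 - u $ 2 * v $ 1"

text \<open>Signed curvature of a regular plane curve, in terms of its first and second derivative.\<close>

definition plane_curvature :: "real^2 \<Rightarrow> real^2 \<Rightarrow> real" where
  "plane_curvature v a = cross2 v a / norm v ^ 3"

text \<open>
  The boundary is an embedded one-dimensional submanifold of class \<open>C\<^sup>2\<close>, given by regular
  local parametrizations \<open>\<gamma>\<close>.  Parametrizations are oriented so that \<open>K\<close> lies on the left of
  each tangent line; then the signed curvature is the curvature with respect to the inner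
  normal, which is the one required to be positive.
\<close>

definition C2_plus :: "(real^2) set \<Rightarrow> bool" where
  "C2_plus K \<longleftrightarrow> convex_body K \<and>
    (\<forall>p\<in>frontier K. \<exists>U \<gamma> \<gamma>' \<gamma>'' \<delta> \<epsilon>. open U \<and> p \<in> U \<and> 0 < \<epsilon> \<and>
       homeomorphism {-\<epsilon><..<\<epsilon>} (frontier K \<inter> U) \<gamma> \<delta> \<and>
       continuous_on {-\<epsilon><..<\<epsilon>} \<gamma>'' \<and>
       (\<forall>s\<in>{-\<epsilon><..<\<epsilon>}.
          (\<gamma> has_vector_derivative \<gamma>' s) (at s) \<and>
          (\<gamma>' has_vector_derivative \<gamma>'' s) (at s) \<and>
          \<gamma>' s \<noteq> 0 \<and>
          (\<forall>x\<in>K. 0 \<le> cross2 (\<gamma>' s) (x - \<gamma> s)) \<and>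
          0 < plane_curvature (\<gamma>' s) (\<gamma>'' s)))"

definition gauge :: "(real^2) set \<Rightarrow> real^2 \<Rightarrow> real" where
  "gauge L x = Inf {l. 0 \<le> l \<and> x \<in> (*\<^sub>R) l ` L}"

definition inner_ratio :: "(real^2) set \<Rightarrow> (real^2) set \<Rightarrow> real" where
  "inner_ratio A L = (GREATEST R. 0 < R \<and> (*\<^sub>R) R ` L \<subseteq> A)"

definition gauge_measure :: "(real \<Rightarrow> real) \<Rightarrow> (real^2) set \<Rightarrow> (real^2) measure" where
  "gauge_measure \<phi> L = density lborel (\<lambda>x. ennreal (exp (- \<phi> (gauge L x))))"

text \<open>
  The mixed right derivative \<open>\<partial>\<^sup>2/\<partial>s\<partial>t\<close> at \<open>s = t = 0\<^sup>+\<close> as an iterated one: \<open>g s\<close> is the right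
  derivative in \<open>t\<close> at \<open>0\<close>, for all small \<open>s \<ge> 0\<close>, and \<open>m\<close> is the right derivative of \<open>g\<close> at \<open>0\<close>.
  The sum of sets is the Minkowski sum.
\<close>

definition has_mixed_measure ::
    "(real^2) measure \<Rightarrow> (real^2) set \<Rightarrow> (real^2) set \<Rightarrow> (real^2) set \<Rightarrow> real \<Rightarrow> bool" where
  "has_mixed_measure M A B C m \<longleftrightarrow>
    (\<exists>g e. 0 < e \<and>
       (\<forall>s\<in>{0..<e}. ((\<lambda>t. measure M (A + (*\<^sub>R) s ` B + (*\<^sub>R) t ` C))
                        has_real_derivative g s) (at_right 0)) \<and>
       (g has_real_derivative m) (at_right 0))"

definition mixed_measure ::
    "(real^2) measure \<Rightarrow> (real^2) set \<Rightarrow> (real^2) set \<Rightarrow> (real^2) set \<Rightarrow> real" where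
  "mixed_measure M A B C = (THE m. has_mixed_measure M A B C m)"

lemma has_real_derivative_at_right_unique:
  assumes "(f has_real_derivative a) (at_right x)" "(f has_real_derivative b) (at_right x)"
  shows "a = b"
  using assms unfolding has_field_derivative_iff
  by (rule tendsto_unique[OF trivial_limit_at_right_real])

lemma has_mixed_measure_unique:
  assumes "has_mixed_measure M A B C m" "has_mixed_measure M A B C n"
  shows "m = n"
proof -
  let ?F = "\<lambda>s t. measure M (A + (*\<^sub>R) s ` B + (*\<^sub>R) t ` C)"
  obtain g e where g: "0 < e" "(g has_real_derivative m) (at_right 0)"
    "\<And>s. s \<in> {0..<e} \<Longrightarrow> (?F s has_real_derivative g s) (at_right 0)"
    using assms(1) unfolding has_mixed_measure_def by blast
  obtain h d where h: "0 < d" "(h has_real_derivative n) (at_right 0)"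
    "\<And>s. s \<in> {0..<d} \<Longrightarrow> (?F s has_real_derivative h s) (at_right 0)"
    using assms(2) unfolding has_mixed_measure_def by blast
  have eq: "h s = g s" if "s \<in> {0..<min d e}" for s
    using that by (intro has_real_derivative_at_right_unique[OF h(3) g(3)]) auto
  have "(g has_real_derivative n) (at_right 0)"
  proof -
    have "((\<lambda>s. (h s - h 0) / (s - 0)) \<longlongrightarrow> n) (at_right 0)"
      using h(2) by (simp add: has_field_derivative_iff)
    moreover have "\<forall>\<^sub>F s in at_right 0. (h s - h 0) / (s - 0) = (g s - g 0) / (s - 0)"
      using eventually_at_right_less[of 0] eventually_at_right_real[of 0 "min d e"] g(1) h(1)
      by (auto elim!: eventually_mono simp: eq)
    ultimately show ?thesis
      by (auto simp: has_field_derivative_iff elim: Lim_transform_eventually)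
  qed
  with g(2) show ?thesis
    by (rule has_real_derivative_at_right_unique)
qed

lemma mixed_measure_eq: "has_mixed_measure M A B C m \<Longrightarrow> mixed_measure M A B C = m"
  unfolding mixed_measure_def by (blast intro: has_mixed_measure_unique)

end

theory Submission
  imports Defs
begin

text \<open>
  In polar coordinates \<open>\<mu>(K)\<close> is the integral over directions \<open>e\<close> of \<open>G\<^sub>e(R)\<close>, where \<open>G\<^sub>e\<close> is a
  primitive of \<open>l exp (- \<phi>(l \<parallel>e\<parallel>\<^sub>L))\<close> and \<open>R\<close> is the radial function of \<open>K\<close> at \<open>e\<close>.  For
  \<open>K = t A + s B + u C\<close> the latter is the minimum over \<open>\<tau>\<close> of \<open>t a(\<tau>) + s b(\<tau>) + u c(\<tau>)\<close>, where
  \<open>a, b, c\<close> are the support functions on the line of vectors \<open>n\<close> with \<open>n \<bullet> e = 1\<close>.  Since the curvature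
  of \<open>A\<close> is positive and finite, the minimum of \<open>a\<close> is nondegenerate, so by the envelope theorem \<open>R\<close> has
  first variations \<open>b\<close>, \<open>c\<close> and mixed second variation \<open>- b' c' / (t a'')\<close> wherever \<open>b\<close> and \<open>c\<close> are
  differentiable at the minimizer, that is, for all but countably many \<open>e\<close>.  If \<open>x\<close> is the boundary point
  of \<open>A\<close> in direction \<open>e\<close> and \<open>y = t \<parallel>x\<parallel>\<^sub>L\<close>, then the integrand of \<open>\<mu>(t A; B, C)\<close> is
  \<open>exp (- \<phi>(y)) ((1 - y \<phi>'(y)) b c + O(1))\<close>; it is negative for large \<open>t\<close>, and the integral is dominated
  by the directions where \<open>\<parallel>x\<parallel>\<^sub>L\<close> is close to its minimum \<open>r(A, L)\<close>.
\<close>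

section \<open>Polar coordinates\<close>

text \<open>Nothing is known about \<open>B\<close> and \<open>C\<close> beyond convexity, so their
  support functions may have kinks. The radial function is a minimum of functions affine in
  \<open>u\<close>, hence concave in \<open>u\<close>: its right derivative in \<open>u\<close>
  exists for every \<open>s\<close> and every direction, without information on the minimizers. Only
  the second derivative, at \<open>s = 0\<close>, forces directions to be discarded. Both
  derivatives pass under the integral by dominated convergence, which needs difference quotients
  bounded uniformly in the direction. For the second one the bound comes from a quadratic growth
  constant of the support function of \<open>A\<close>, uniform by compactness of the boundary; the
  pointwise second-order coefficient serves only to show that the limit exists.

  In the asymptotics, the hypothesis on ln \<phi>' says that \<phi>' \<le> exp(\<epsilon> \<phi>)
  eventually. This costs a factor exp(\<epsilon> \<phi>) in the upper bound and, by shrinking the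
  usable neighbourhood of the optimal direction, a factor exp(-2 \<epsilon> \<phi>) in the lower
  one. Powers of t are harmless because \<phi> grows at least linearly.\<close>

lemma measurable_vector_pair:
  "(\<lambda>p. vector [fst p, snd p] :: real^2) \<in> borel_measurable borel"
proof (rule borel_measurable_continuous_onI)
  have "(\<lambda>p. vector [fst p, snd p] :: real^2) = (\<lambda>p. fst p *\<^sub>R axis 1 1 + snd p *\<^sub>R axis 2 1)"
    by (auto simp: fun_eq_iff vec_eq_iff forall_2 axis_def)
  thus "continuous_on UNIV (\<lambda>p. vector [fst p, snd p] :: real^2)"
    by (simp only:) (intro continuous_intros)
qed

section \<open>Polar integration in the plane, with directions given by their slope\<close>

lemma lborel_vec2:
  "(lborel :: (real^2) measure) = distr (lborel :: (real \<times> real) measure) borel (\<lambda>p. vector [fst p, snd p])"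
proof (rule lborel_eqI)
  fix l u :: "real^2"
  assume le: "\<And>b. b \<in> Basis \<Longrightarrow> l \<bullet> b \<le> u \<bullet> b"
  have le': "l $ i \<le> u $ i" for i
    using le[of "axis i 1"] by (auto simp: inner_axis)
  have meas: "(\<lambda>p. vector [fst p, snd p] :: real^2) \<in> borel_measurable borel"
    by (rule measurable_vector_pair)
  have "(\<lambda>p. vector [fst p, snd p]) -` box l u = box (l$1, l$2) (u$1, u$2)"
    by (auto simp: box_def Basis_vec_def inner_axis Basis_prod_def forall_2)
  hence "emeasure (distr lborel borel (\<lambda>p. vector [fst p, snd p])) (box l u)
      = emeasure lborel (box (l$1, l$2) (u$1, u$2))"
    using meas by (subst emeasure_distr) auto
  also have "\<dots> = ennreal (\<Prod>b\<in>Basis. ((u$1, u$2) - (l$1, l$2)) \<bullet> b)"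
    using le' by (subst emeasure_lborel_box) (auto simp: Basis_prod_def)
  also have "(\<Prod>b\<in>Basis. ((u$1, u$2) - (l$1, l$2)) \<bullet> b) = (u$1 - l$1) * (u$2 - l$2)"
    by (simp add: Basis_prod_def)
  also have "\<dots> = (\<Prod>b\<in>Basis. (u - l) \<bullet> b)"
  proof -
    have inj: "inj (\<lambda>i::2. axis i (1::real))" 
      by (auto simp: inj_def axis_eq_axis)
    have "(Basis :: (real^2) set) = range (\<lambda>i. axis i 1)" by (auto simp: Basis_vec_def)
    hence "(\<Prod>b\<in>Basis. (u - l) \<bullet> b) = (\<Prod>i\<in>UNIV. (u - l) \<bullet> axis i 1)"
      using prod.reindex[OF inj] by (simp add: o_def)
    thus ?thesis by (simp add: inner_axis UNIV_2)
  qed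
  finally show "emeasure (distr lborel borel (\<lambda>p. vector [fst p, snd p])) (box l u)
      = ennreal (\<Prod>b\<in>Basis. (u - l) \<bullet> b)" .
qed simp

text \<open>Directions of the right half circle are parametrized by slope instead of angle, so that
  polar integration reduces to affine substitutions on lines and one exchange of integrals. The
  vertical directions are missed, which is harmless since the line x = 0 is null.\<close>

definition polar_dir :: "real \<Rightarrow> real^2" where
  "polar_dir \<sigma> = (1 / sqrt (1 + \<sigma>\<^sup>2)) *\<^sub>R vector [1, \<sigma>]"

lemma norm_polar_dir [simp]: "norm (polar_dir \<sigma>) = 1"
proof -
  have "norm (vector [1, \<sigma>] :: real^2) = sqrt (1 + \<sigma>\<^sup>2)"
    by (simp add: norm_eq_sqrt_inner inner_vec_def UNIV_2 power2_eq_square)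
  moreover have "sqrt (1 + \<sigma>\<^sup>2) > 0" by (simp add: add_pos_nonneg)
  ultimately show ?thesis by (simp add: polar_dir_def)
qed

lemma measurable_vector2 [measurable (raw)]:
  fixes f g :: "'a \<Rightarrow> real"
  assumes [measurable]: "f \<in> borel_measurable M" "g \<in> borel_measurable M"
  shows "(\<lambda>x. vector [f x, g x] :: real^2) \<in> borel_measurable M"
proof -
  have "(\<lambda>p. vector [fst p, snd p] :: real^2) \<in> borel_measurable borel"
    by (rule measurable_vector_pair)
  moreover have "(\<lambda>x. (f x, g x)) \<in> M \<rightarrow>\<^sub>M borel"
    using borel_measurable_Pair[OF assms] by simp
  ultimately show ?thesis
    using measurable_compose[of "\<lambda>x. (f x, g x)" M borel "\<lambda>p. vector [fst p, snd p]" borel] by simp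
qed

lemma measurable_polar_dir [measurable]: "polar_dir \<in> borel_measurable borel"
  unfolding polar_dir_def[abs_def] by measurable

lemma nn_integral_polar_dir:
  fixes f :: "real^2 \<Rightarrow> ennreal"
  assumes [measurable]: "f \<in> borel_measurable borel"
  shows "(\<integral>\<^sup>+x. f x \<partial>lborel) =
    (\<integral>\<^sup>+\<sigma>. ennreal (1 / (1 + \<sigma>\<^sup>2)) * (\<Sum>\<epsilon>\<in>{1,-1}. \<integral>\<^sup>+l. ennreal l * indicator {0<..} l * f (l *\<^sub>R \<epsilon> *\<^sub>R polar_dir \<sigma>) \<partial>lborel) \<partial>lborel)"
proof -
  have [measurable]: "(\<lambda>p. f (vector [fst p, snd p])) \<in> borel_measurable borel"
    by (rule measurable_compose[OF measurable_vector_pair assms])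
  have "(\<integral>\<^sup>+x. f x \<partial>lborel) = (\<integral>\<^sup>+p. f (vector [fst p, snd p]) \<partial>(lborel :: (real\<times>real) measure))"
    by (subst lborel_vec2, subst nn_integral_distr) (use measurable_vector_pair in auto)
  also have "\<dots> = (\<integral>\<^sup>+x. \<integral>\<^sup>+y. f (vector [x, y]) \<partial>lborel \<partial>lborel)"
    by (subst lborel_prod[symmetric], subst lborel.nn_integral_fst[symmetric])
       (auto simp: lborel_prod)
  \<comment> \<open>The substitution y = x \<sigma> on each vertical line x \<noteq> 0. After the
    exchange of integrals, x = l / q with q = sqrt(1 + \<sigma>^2) makes l the signed distance from
    the origin, and the two resulting factors 1 / q form the arc element.\<close>
  also have "\<dots> = (\<integral>\<^sup>+x. \<integral>\<^sup>+\<sigma>. ennreal \<bar>x\<bar> * f (vector [x, x * \<sigma>]) \<partial>lborel \<partial>lborel)"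
  proof (rule nn_integral_cong_AE)
    have "AE x in lborel. x \<noteq> (0::real)" by (rule AE_lborel_singleton)
    thus "AE x in lborel. (\<integral>\<^sup>+y. f (vector [x, y]) \<partial>lborel) = (\<integral>\<^sup>+\<sigma>. ennreal \<bar>x\<bar> * f (vector [x, x * \<sigma>]) \<partial>lborel)"
    proof eventually_elim
      case (elim x)
      show ?case
        by (subst nn_integral_real_affine[of _ x 0]) (use elim in \<open>auto simp: nn_integral_cmult\<close>)
    qed
  qed
  also have "\<dots> = (\<integral>\<^sup>+\<sigma>. \<integral>\<^sup>+x. ennreal \<bar>x\<bar> * f (vector [x, x * \<sigma>]) \<partial>lborel \<partial>lborel)"
    by (rule lborel_pair.Fubini') measurable
  also have "\<dots> = (\<integral>\<^sup>+\<sigma>. ennreal (1 / (1 + \<sigma>\<^sup>2)) * (\<Sum>\<epsilon>\<in>{1,-1}. \<integral>\<^sup>+l. ennreal l * indicator {0<..} l * f (l *\<^sub>R \<epsilon> *\<^sub>R polar_dir \<sigma>) \<partial>lborel) \<partial>lborel)"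
  proof (rule nn_integral_cong)
    fix \<sigma> :: real
    define q where "q = sqrt (1 + \<sigma>\<^sup>2)"
    have q: "q > 0" "q * q = 1 + \<sigma>\<^sup>2" unfolding q_def by (auto simp: add_pos_nonneg)
    have dir: "vector [l / q, l / q * \<sigma>] = l *\<^sub>R polar_dir \<sigma>" for l
      by (simp add: vec_eq_iff forall_2 polar_dir_def q_def)
    have "(\<integral>\<^sup>+x. ennreal \<bar>x\<bar> * f (vector [x, x * \<sigma>]) \<partial>lborel)
        = ennreal (1/q) * (\<integral>\<^sup>+l. ennreal \<bar>l / q\<bar> * f (l *\<^sub>R polar_dir \<sigma>) \<partial>lborel)"
      by (subst nn_integral_real_affine[of _ "1/q" 0]) (use q in \<open>auto simp flip: dir\<close>)
    also have "\<dots> = ennreal (1/q) * (\<integral>\<^sup>+l. ennreal (1/q) * (ennreal \<bar>l\<bar> * f (l *\<^sub>R polar_dir \<sigma>)) \<partial>lborel)"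
      using q by (simp add: ennreal_mult[symmetric] mult.assoc[symmetric] abs_mult)
    also have "\<dots> = ennreal (1/q) * ennreal (1/q) * (\<integral>\<^sup>+l. ennreal \<bar>l\<bar> * f (l *\<^sub>R polar_dir \<sigma>) \<partial>lborel)"
      by (subst nn_integral_cmult) (auto simp: mult.assoc)
    also have "ennreal (1/q) * ennreal (1/q) = ennreal (1 / (1 + \<sigma>\<^sup>2))"
      using q by (simp add: ennreal_mult[symmetric])
    \<comment> \<open>Negative l run through the opposite ray; the reflection of l below turns them
      into the summand \<epsilon> = -1.\<close>
    also have "(\<integral>\<^sup>+l. ennreal \<bar>l\<bar> * f (l *\<^sub>R polar_dir \<sigma>) \<partial>lborel) =
       (\<integral>\<^sup>+l. ennreal l * indicator {0<..} l * f (l *\<^sub>R polar_dir \<sigma>) + ennreal (- l) * indicator {..<0} l * f (l *\<^sub>R polar_dir \<sigma>) \<partial>lborel)"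
      by (rule nn_integral_cong) (auto simp: indicator_def abs_if)
    also have "\<dots> = (\<integral>\<^sup>+l. ennreal l * indicator {0<..} l * f (l *\<^sub>R polar_dir \<sigma>) \<partial>lborel)
        + (\<integral>\<^sup>+l. ennreal (- l) * indicator {..<0} l * f (l *\<^sub>R polar_dir \<sigma>) \<partial>lborel)"
      by (rule nn_integral_add) measurable
    also have "(\<integral>\<^sup>+l. ennreal (- l) * indicator {..<0} l * f (l *\<^sub>R polar_dir \<sigma>) \<partial>lborel)
       = (\<integral>\<^sup>+l. ennreal l * indicator {0<..} l * f (l *\<^sub>R (-1) *\<^sub>R polar_dir \<sigma>) \<partial>lborel)"
      by (subst nn_integral_real_affine[of _ "-1" 0]) (auto simp: indicator_def intro!: nn_integral_cong)
    finally show "(\<integral>\<^sup>+x. ennreal \<bar>x\<bar> * f (vector [x, x * \<sigma>]) \<partial>lborel) = ennreal (1 / (1 + \<sigma>\<^sup>2)) * (\<Sum>\<epsilon>\<in>{1,-1}. \<integral>\<^sup>+l. ennreal l * indicator {0<..} l * f (l *\<^sub>R \<epsilon> *\<^sub>R polar_dir \<sigma>) \<partial>lborel)"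
      by simp
  qed
  finally show ?thesis .
qed

text \<open>Arc length on the unit circle: for the slope \<open>\<sigma>\<close> of the direction, the angle element is
  \<open>d\<sigma> / (1 + \<sigma>\<^sup>2)\<close>, and \<open>\<epsilon>\<close> selects the half circle.\<close>

definition arc_measure :: "(real^2) measure" where
  "arc_measure = distr (density lborel (\<lambda>\<sigma>. ennreal (1 / (1 + \<sigma>\<^sup>2))) \<Otimes>\<^sub>M count_space {1, -1})
     borel (\<lambda>(\<sigma>, \<epsilon>). \<epsilon> *\<^sub>R polar_dir \<sigma>)"

lemma sets_arc_measure [measurable_cong, simp]: "sets arc_measure = sets borel"
  by (simp add: arc_measure_def)

lemma space_arc_measure [simp]: "space arc_measure = UNIV"
  by (simp add: arc_measure_def)

lemma measurable_signed_dir [measurable]: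
  "(\<lambda>(\<sigma>, \<epsilon>::real). \<epsilon> *\<^sub>R polar_dir \<sigma>) \<in> borel_measurable
     (density lborel (\<lambda>\<sigma>. ennreal (1 / (1 + \<sigma>\<^sup>2))) \<Otimes>\<^sub>M count_space {1, -1})"
proof -
  have [measurable]: "(\<lambda>x::real. x) \<in> borel_measurable (count_space {1,-1})"
    by simp
  show ?thesis unfolding split_beta' by measurable
qed

lemma nn_integral_arc_measure:
  assumes [measurable]: "g \<in> borel_measurable borel"
  shows "(\<integral>\<^sup>+e. g e \<partial>arc_measure) =
    (\<integral>\<^sup>+\<sigma>. ennreal (1 / (1 + \<sigma>\<^sup>2)) * (\<Sum>\<epsilon>\<in>{1,-1}. g (\<epsilon> *\<^sub>R polar_dir \<sigma>)) \<partial>lborel)"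
proof -
  interpret C: sigma_finite_measure "count_space {1, -1::real}"
    by (rule sigma_finite_measure_count_space_finite) simp
  have "(\<integral>\<^sup>+e. g e \<partial>arc_measure) = (\<integral>\<^sup>+p. g (case p of (\<sigma>, \<epsilon>) \<Rightarrow> \<epsilon> *\<^sub>R polar_dir \<sigma>)
    \<partial>(density lborel (\<lambda>\<sigma>. ennreal (1 / (1 + \<sigma>\<^sup>2))) \<Otimes>\<^sub>M count_space {1, -1}))"
    unfolding arc_measure_def by (rule nn_integral_distr) simp_all
  also have "\<dots> = (\<integral>\<^sup>+\<sigma>. \<integral>\<^sup>+\<epsilon>. g (\<epsilon> *\<^sub>R polar_dir \<sigma>) \<partial>count_space {1,-1} \<partial>density lborel (\<lambda>\<sigma>. ennreal (1 / (1 + \<sigma>\<^sup>2))))"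
    by (subst C.nn_integral_fst[symmetric]) auto
  also have "\<dots> = (\<integral>\<^sup>+\<sigma>. (\<Sum>\<epsilon>\<in>{1,-1}. g (\<epsilon> *\<^sub>R polar_dir \<sigma>)) \<partial>density lborel (\<lambda>\<sigma>. ennreal (1 / (1 + \<sigma>\<^sup>2))))"
    by (simp add: nn_integral_count_space_finite)
  also have "\<dots> = (\<integral>\<^sup>+\<sigma>. ennreal (1 / (1 + \<sigma>\<^sup>2)) * (\<Sum>\<epsilon>\<in>{1,-1}. g (\<epsilon> *\<^sub>R polar_dir \<sigma>)) \<partial>lborel)"
    by (rule nn_integral_density) measurable
  finally show ?thesis .
qed

lemma nn_integral_polar:
  assumes [measurable]: "f \<in> borel_measurable borel"
  shows "(\<integral>\<^sup>+x. f x \<partial>lborel) =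
    (\<integral>\<^sup>+e. \<integral>\<^sup>+l. ennreal l * indicator {0<..} l * f (l *\<^sub>R e) \<partial>lborel \<partial>arc_measure)"
  by (subst nn_integral_arc_measure) (simp_all only: nn_integral_polar_dir[OF assms], measurable)

lemma AE_arc_measure_norm: "AE e in arc_measure. norm e = 1"
proof -
  have "AE p in (density lborel (\<lambda>\<sigma>. ennreal (1 / (1 + \<sigma>\<^sup>2))) \<Otimes>\<^sub>M count_space {1, -1}).
     norm (case p of (\<sigma>, \<epsilon>) \<Rightarrow> \<epsilon> *\<^sub>R polar_dir \<sigma>) = 1"
    by (rule AE_I2) (auto simp: space_pair_measure)
  thus ?thesis unfolding arc_measure_def
    by (subst AE_distr_iff) auto
qed

lemma nn_integral_id_Ioc:
  assumes "0 \<le> r"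
  shows "(\<integral>\<^sup>+l. ennreal l * indicator {0<..r} l \<partial>lborel) = ennreal (r\<^sup>2 / 2)"
proof -
  have "(\<integral>\<^sup>+l. ennreal l * indicator {0<..r} l \<partial>lborel) = (\<integral>\<^sup>+l. ennreal l * indicator {0..r} l \<partial>lborel)"
    by (rule nn_integral_cong_AE) (use AE_lborel_singleton[of "0::real"] in \<open>auto simp: indicator_def\<close>)
  also have "\<dots> = ennreal (r\<^sup>2 / 2 - 0\<^sup>2 / 2)"
    by (rule nn_integral_FTC_Icc) (use assms in \<open>auto intro!: derivative_eq_intros\<close>)
  finally show ?thesis by simp
qed

text \<open>The sector of the unit disc over \<open>E\<close> has half the measure of
  \<open>E\<close> as area, because l integrates to 1/2 over (0, 1]. Finiteness, null points and
  lower bounds for arcs are thereby read off from planar Lebesgue measure.\<close>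

lemma emeasure_arc_measure:
  assumes [measurable]: "E \<in> sets borel"
  shows "emeasure arc_measure E = 2 * emeasure lborel {x. 0 < norm x \<and> norm x \<le> 1 \<and> x /\<^sub>R norm x \<in> E}"
proof -
  let ?X = "{x :: real^2. 0 < norm x \<and> norm x \<le> 1 \<and> x /\<^sub>R norm x \<in> E}"
  have [measurable]: "?X \<in> sets borel" by measurable
  have "emeasure lborel ?X = (\<integral>\<^sup>+x. indicator ?X x \<partial>lborel)" by simp
  also have "\<dots> = (\<integral>\<^sup>+e. \<integral>\<^sup>+l. ennreal l * indicator {0<..} l * indicator ?X (l *\<^sub>R e) \<partial>lborel \<partial>arc_measure)"
    by (rule nn_integral_polar) measurable
  also have "\<dots> = (\<integral>\<^sup>+e. ennreal (1/2) * indicator E e \<partial>arc_measure)"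
  proof (rule nn_integral_cong_AE)
    show "AE e in arc_measure. (\<integral>\<^sup>+l. ennreal l * indicator {0<..} l * indicator ?X (l *\<^sub>R e) \<partial>lborel) = ennreal (1/2) * indicator E e"
      using AE_arc_measure_norm
    proof eventually_elim
      case (elim e)
      have "(\<integral>\<^sup>+l. ennreal l * indicator {0<..} l * indicator ?X (l *\<^sub>R e) \<partial>lborel)
         = (\<integral>\<^sup>+l. ennreal l * indicator {0<..1} l * indicator E e \<partial>lborel)"
        using elim by (intro nn_integral_cong) (auto simp: indicator_def)
      also have "\<dots> = (\<integral>\<^sup>+l. ennreal l * indicator {0<..1} l \<partial>lborel) * indicator E e"
        by (rule nn_integral_multc) measurable
      finally show ?case using nn_integral_id_Ioc[of 1] by simp
    qed
  qed
  also have "\<dots> = ennreal (1/2) * emeasure arc_measure E"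
    by (subst nn_integral_cmult) auto
  finally have "2 * emeasure lborel ?X = (2 * ennreal (1/2)) * emeasure arc_measure E"
    by (simp add: mult.assoc)
  also have "2 * ennreal (1/2) = ennreal 1"
    by (subst ennreal_numeral[symmetric], subst ennreal_mult[symmetric]) auto
  finally show ?thesis by simp
qed

lemma finite_arc_measure: "finite_measure arc_measure"
proof (rule finite_measureI)
  have "emeasure lborel {x::real^2. 0 < norm x \<and> norm x \<le> 1 \<and> x /\<^sub>R norm x \<in> UNIV} \<le> emeasure lborel (cball 0 1 :: (real^2) set)"
    by (intro emeasure_mono) auto
  also have "\<dots> < \<infinity>" by (rule emeasure_lborel_cball_finite)
  finally show "emeasure arc_measure (space arc_measure) \<noteq> \<infinity>"
    by (auto simp: emeasure_arc_measure ennreal_mult_eq_top_iff)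
qed

lemma emeasure_arc_measure_singleton: "emeasure arc_measure {v} = 0"
proof -
  let ?X = "{x::real^2. 0 < norm x \<and> norm x \<le> 1 \<and> x /\<^sub>R norm x \<in> {v}}"
  have "?X \<subseteq> span {v}"
  proof
    fix x assume "x \<in> ?X"
    hence "x = norm x *\<^sub>R v" by (auto simp: field_simps)
    thus "x \<in> span {v}" by (metis span_base span_scale singletonI)
  qed
  moreover have "dim {v} < DIM(real^2)"
    using dim_le_card'[of "{v}"] by simp
  hence "negligible (span {v})" using negligible_lowdim[of "span {v}"] by (simp add: dim_span)
  ultimately have "negligible ?X" by (rule negligible_subset[rotated])
  moreover have "?X \<in> sets borel" by measurable
  ultimately have "emeasure lborel ?X = 0"
    by (simp add: negligible_iff_emeasure0)
  thus ?thesis by (simp add: emeasure_arc_measure)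
qed

lemma countable_null_sets_arc_measure:
  assumes "countable X" shows "X \<in> null_sets arc_measure"
proof -
  have "(\<Union>x\<in>X. {x}) \<in> null_sets arc_measure"
    by (rule null_sets_UN'[OF assms]) (auto simp: null_sets_def emeasure_arc_measure_singleton)
  thus ?thesis by simp
qed

text \<open>The disc of radius \<eta>/4 that touches the unit circle at \<open>e0\<close> from
  inside lies in the sector over the ball, and its area is at least \<eta>^2/16. The true order is
  \<eta>, but a square is good enough: in the asymptotics it only changes the coefficient of
  \<epsilon> in an exponent and a power of t.\<close>

lemma measure_arc_measure_ball:
  assumes e: "norm (e0::real^2) = 1" and \<eta>: "0 < \<eta>" "\<eta> \<le> 1"
  shows "measure arc_measure (ball e0 \<eta>) \<ge> \<eta>\<^sup>2 / 8"
proof -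
  let ?X = "{x::real^2. 0 < norm x \<and> norm x \<le> 1 \<and> x /\<^sub>R norm x \<in> ball e0 \<eta>}"
  have [measurable]: "ball e0 \<eta> \<in> sets borel" by simp
  have X [measurable]: "?X \<in> sets borel" by measurable
  have "ball ((1-\<eta>/4) *\<^sub>R e0) (\<eta>/4) \<subseteq> ?X"
  proof
    fix x assume "x \<in> ball ((1-\<eta>/4) *\<^sub>R e0) (\<eta>/4)"
    hence x: "norm ((1-\<eta>/4) *\<^sub>R e0 - x) < \<eta>/4" by (simp add: dist_norm)
    have n: "norm ((1-\<eta>/4) *\<^sub>R e0) = 1-\<eta>/4" using e \<eta> by simp
    have n1: "norm x \<le> 1" using norm_triangle_ineq2[of x "(1-\<eta>/4) *\<^sub>R e0"] x n by (simp add: norm_minus_commute)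
    have n0: "norm x > 1 - \<eta>/2" using norm_triangle_ineq2[of "(1-\<eta>/4) *\<^sub>R e0" x] x n by simp
    \<comment> \<open>The three pieces are the distance to the centre, \<eta>/4; the distance of x
      from the centre, less than \<eta>/4; and the radial projection of x, less than
      \<eta>/2.\<close>
    have "norm (e0 - x /\<^sub>R norm x) \<le> norm (e0 - (1-\<eta>/4) *\<^sub>R e0) + norm ((1-\<eta>/4) *\<^sub>R e0 - x) + norm (x - x /\<^sub>R norm x)"
      using norm_triangle_ineq[of "e0 - (1-\<eta>/4) *\<^sub>R e0 + ((1-\<eta>/4) *\<^sub>R e0 - x)" "x - x /\<^sub>R norm x"]
        norm_triangle_ineq[of "e0 - (1-\<eta>/4) *\<^sub>R e0" "(1-\<eta>/4) *\<^sub>R e0 - x"] by simp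
    also have "e0 - (1-\<eta>/4) *\<^sub>R e0 = (\<eta>/4) *\<^sub>R e0" by (simp add: algebra_simps)
    also have "norm (x - x /\<^sub>R norm x) = 1 - norm x"
    proof -
      have "x - x /\<^sub>R norm x = (1 - 1 / norm x) *\<^sub>R x" by (simp add: algebra_simps inverse_eq_divide)
      hence "norm (x - x /\<^sub>R norm x) = \<bar>1 - 1 / norm x\<bar> * norm x" by simp
      also have "\<dots> = \<bar>norm x - 1\<bar>" using n0 \<eta> by (auto simp: abs_if field_simps)
      finally show ?thesis using n1 by simp
    qed
    finally have "norm (e0 - x /\<^sub>R norm x) < \<eta>" using x n0 e \<eta> by simp
    moreover have "norm x > 0" using n0 \<eta> by linarith
    ultimately show "x \<in> ?X" using n1 by (simp add: dist_norm)
  qed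
  moreover have "measure lborel (ball ((1-\<eta>/4) *\<^sub>R e0) (\<eta>/4)) \<ge> \<eta>\<^sup>2 / 16"
  proof -
    have "measure lebesgue (ball ((1-\<eta>/4) *\<^sub>R e0) (\<eta>/4)) = pi * (\<eta>/4)\<^sup>2"
      using content_ball[of "\<eta>/4" "(1-\<eta>/4) *\<^sub>R e0"] \<eta> by (simp add: unit_ball_vol_2)
    moreover have "1 * (\<eta>/4)\<^sup>2 \<le> pi * (\<eta>/4)\<^sup>2"
      by (rule mult_right_mono) (use pi_ge_two in auto)
    ultimately show ?thesis by (simp add: measure_completion power_divide)
  qed
  moreover have fin: "emeasure lborel ?X < \<infinity>"
    by (rule le_less_trans[OF emeasure_mono[of _ "cball 0 1"] emeasure_lborel_cball_finite]) auto
  ultimately have "measure lborel ?X \<ge> \<eta>\<^sup>2 / 16"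
    using measure_mono_fmeasurable[of "ball ((1-\<eta>/4) *\<^sub>R e0) (\<eta>/4)" ?X lborel] fmeasurableI[of ?X lborel] X by force
  moreover have "measure arc_measure (ball e0 \<eta>) = 2 * measure lborel ?X"
    by (simp add: measure_def emeasure_arc_measure enn2real_mult)
  ultimately show ?thesis by simp
qed

section \<open>Right derivatives of integrals and of minimum functions\<close>

text \<open>Dominated convergence along sequences tending to 0. \<open>P'\<close> is handed out
  together with its value at every point where the derivative exists, because the inner derivative
  obtained this way has to be differentiated again pointwise.\<close>

lemma has_real_derivative_integral_at_right:
  fixes H :: "real \<Rightarrow> 'a \<Rightarrow> real"
  assumes M: "finite_measure M" and "0 < e"
    and int: "\<And>u. 0 \<le> u \<Longrightarrow> u < e \<Longrightarrow> integrable M (H u)"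
    and der: "AE x in M. \<exists>y. ((\<lambda>u. H u x) has_real_derivative y) (at_right 0)"
    and lip: "\<And>u. 0 < u \<Longrightarrow> u < e \<Longrightarrow> AE x in M. \<bar>H u x - H 0 x\<bar> \<le> C * u"
  obtains P' where "integrable M P'" "\<And>x y. ((\<lambda>u. H u x) has_real_derivative y) (at_right 0) \<Longrightarrow> P' x = y"
    "((\<lambda>u. \<integral>x. H u x \<partial>M) has_real_derivative (\<integral>x. P' x \<partial>M)) (at_right 0)"
proof -
  interpret finite_measure M by fact
  let ?q = "\<lambda>u x. (H u x - H 0 x) / u"
  \<comment> \<open>One fixed sequence in (0, e): the limit along it is measurable and agrees with
    the right derivative wherever that exists. The summand 2 keeps already \<open>w 0\<close>
    strictly below e.\<close>
  define w where "w n = e / (real n + 2)" for n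
  have w: "0 < w n" "w n < e" for n using \<open>0 < e\<close> by (auto simp: w_def field_simps add_pos_nonneg)
  have wlim: "w \<longlonglongrightarrow> 0" unfolding w_def by real_asymp
  define P' where "P' x = lim (\<lambda>n. ?q (w n) x)" for x
  have conv: "(\<lambda>n. ?q (X n) x) \<longlonglongrightarrow> y"
    if "((\<lambda>u. H u x) has_real_derivative y) (at_right 0)" "\<And>i. 0 < X i" "X \<longlonglongrightarrow> 0" for X :: "nat \<Rightarrow> real" and x y
    using that by (auto simp: has_field_derivative_iff tendsto_at_iff_sequentially o_def)
  have P'eq: "P' x = y" if "((\<lambda>u. H u x) has_real_derivative y) (at_right 0)" for x y
    using conv[OF that w(1) wlim] by (simp add: P'_def limI)
  have qm: "?q u \<in> borel_measurable M" if "0 < u" "u < e" for u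
    using int[of u] int[of 0] that by auto
  have P'm [measurable]: "P' \<in> borel_measurable M"
    unfolding P'_def by (rule borel_measurable_lim_metric) (use qm w in auto)
  have qb: "AE x in M. norm (?q u x) \<le> C" if "0 < u" "u < e" for u
    using lip[OF that] by eventually_elim (use that in \<open>auto simp: field_simps\<close>)
  have dct: "integrable M P' \<and> (\<lambda>n. \<integral>x. ?q (X n) x \<partial>M) \<longlonglongrightarrow> (\<integral>x. P' x \<partial>M)"
    if X: "\<And>n. 0 < X n" "\<And>n. X n < e" "X \<longlonglongrightarrow> 0" for X :: "nat \<Rightarrow> real"
  proof
    have a: "AE x in M. (\<lambda>n. ?q (X n) x) \<longlonglongrightarrow> P' x"
      using der by eventually_elim (use conv[OF _ X(1,3)] P'eq in blast)
    show "integrable M P'"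
      by (rule integrable_dominated_convergence[OF P'm qm[OF X(1,2)] _ a qb[OF X(1,2)]]) simp
    show "(\<lambda>n. \<integral>x. ?q (X n) x \<partial>M) \<longlonglongrightarrow> (\<integral>x. P' x \<partial>M)"
      by (rule integral_dominated_convergence[OF P'm qm[OF X(1,2)] _ a qb[OF X(1,2)]]) simp
  qed
  have "((\<lambda>u. \<integral>x. H u x \<partial>M) has_real_derivative (\<integral>x. P' x \<partial>M)) (at_right 0)"
    unfolding has_field_derivative_iff tendsto_at_iff_sequentially
  proof (intro allI impI)
    fix X :: "nat \<Rightarrow> real" assume X: "\<forall>i. X i \<in> {0<..} - {0}" "X \<longlonglongrightarrow> 0"
    then obtain N where N: "\<And>n. n \<ge> N \<Longrightarrow> X n < e"
      using order_tendstoD(2)[of X 0 sequentially e] \<open>0 < e\<close> by (auto simp: eventually_sequentially)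
    let ?D = "\<lambda>y. ((\<integral>x. H y x \<partial>M) - (\<integral>x. H 0 x \<partial>M)) / (y - 0)"
    have "(\<lambda>n. \<integral>x. ?q (X (n + N)) x \<partial>M) \<longlonglongrightarrow> (\<integral>x. P' x \<partial>M)"
      using dct[of "\<lambda>n. X (n + N)"] X N by (auto intro: LIMSEQ_ignore_initial_segment)
    also have "(\<lambda>n. \<integral>x. ?q (X (n + N)) x \<partial>M) = (\<lambda>n. ?D (X (n + N)))"
    proof
      fix n
      have "integrable M (H (X (n + N)))" "integrable M (H 0)"
        using X N[of "n + N"] int \<open>0 < e\<close> by (auto simp: less_imp_le)
      thus "(\<integral>x. ?q (X (n + N)) x \<partial>M) = ?D (X (n + N))" by simp
    qed
    finally have "(\<lambda>n. ?D (X (n + N))) \<longlonglongrightarrow> (\<integral>x. P' x \<partial>M)" .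
    hence "(\<lambda>n. ?D (X n)) \<longlonglongrightarrow> (\<integral>x. P' x \<partial>M)" by (rule LIMSEQ_offset)
    thus "(?D \<circ> X) \<longlonglongrightarrow> (\<integral>x. P' x \<partial>M)" by (simp add: o_def)
  qed
  thus ?thesis using that dct[of w] w wlim P'eq by blast
qed

text \<open>The setting of the envelope theorem: \<open>V s u\<close> is the attained minimum of
  \<open>a + s b + u c\<close> over \<open>X\<close>, and \<open>\<tau>\<^sub>0\<close> minimizes
  \<open>a\<close>. The quantitative data are a bound and a Lipschitz constant for \<open>b\<close>,
  \<open>c\<close> and the quadratic growth of \<open>a\<close>, so estimates in terms of them are
  uniform over a family of such problems.\<close>

locale min_envelope =
  fixes X :: "real set" and a b c :: "real \<Rightarrow> real" and V :: "real \<Rightarrow> real \<Rightarrow> real"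
    and \<Lambda> \<beta> \<kappa> \<tau>\<^sub>0 :: real
  assumes V_le: "\<lbrakk>0 \<le> s; 0 \<le> u; \<tau> \<in> X\<rbrakk> \<Longrightarrow> V s u \<le> a \<tau> + s * b \<tau> + u * c \<tau>"
    and V_attained: "\<lbrakk>0 \<le> s; 0 \<le> u\<rbrakk> \<Longrightarrow> \<exists>\<tau>\<in>X. V s u = a \<tau> + s * b \<tau> + u * c \<tau>"
    and lip_b: "\<lbrakk>\<sigma> \<in> X; \<tau> \<in> X\<rbrakk> \<Longrightarrow> \<bar>b \<sigma> - b \<tau>\<bar> \<le> \<Lambda> * \<bar>\<sigma> - \<tau>\<bar>"
    and lip_c: "\<lbrakk>\<sigma> \<in> X; \<tau> \<in> X\<rbrakk> \<Longrightarrow> \<bar>c \<sigma> - c \<tau>\<bar> \<le> \<Lambda> * \<bar>\<sigma> - \<tau>\<bar>"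
    and bound_b: "\<tau> \<in> X \<Longrightarrow> \<bar>b \<tau>\<bar> \<le> \<beta>"
    and bound_c: "\<tau> \<in> X \<Longrightarrow> \<bar>c \<tau>\<bar> \<le> \<beta>"
    and \<tau>\<^sub>0: "\<tau>\<^sub>0 \<in> X" and \<kappa>: "0 < \<kappa>" and \<Lambda>: "0 \<le> \<Lambda>"
    and growth: "\<tau> \<in> X \<Longrightarrow> a \<tau>\<^sub>0 + \<kappa> * (\<tau> - \<tau>\<^sub>0)\<^sup>2 \<le> a \<tau>"
begin

definition minimizer :: "real \<Rightarrow> real \<Rightarrow> real \<Rightarrow> bool" where
  "minimizer s u \<tau> \<longleftrightarrow> \<tau> \<in> X \<and> V s u = a \<tau> + s * b \<tau> + u * c \<tau>"

lemma minimizer_exists: "0 \<le> s \<Longrightarrow> 0 \<le> u \<Longrightarrow> \<exists>\<tau>. minimizer s u \<tau>"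
  using V_attained unfolding minimizer_def by blast

text \<open>Quadratic growth against a Lipschitz perturbation: comparison with
  \<open>\<tau>\<^sub>0\<close> gives \<kappa> d^2 \<le> (s + u) \<Lambda> d for the displacement
  d.\<close>

lemma minimizer_dist:
  assumes "0 \<le> s" "0 \<le> u" "minimizer s u \<tau>"
  shows "\<bar>\<tau> - \<tau>\<^sub>0\<bar> \<le> (s + u) * \<Lambda> / \<kappa>"
proof -
  let ?d = "\<bar>\<tau> - \<tau>\<^sub>0\<bar>"
  have \<tau>: "\<tau> \<in> X" "V s u = a \<tau> + s * b \<tau> + u * c \<tau>" using assms by (auto simp: minimizer_def)
  have "\<kappa> * ?d\<^sup>2 \<le> a \<tau> - a \<tau>\<^sub>0" using growth[OF \<tau>(1)] by simp
  also have "\<dots> \<le> s * (b \<tau>\<^sub>0 - b \<tau>) + u * (c \<tau>\<^sub>0 - c \<tau>)"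
    using V_le[OF assms(1,2) \<tau>\<^sub>0] \<tau>(2) by (simp add: algebra_simps)
  also have "\<dots> \<le> s * (\<Lambda> * ?d) + u * (\<Lambda> * ?d)"
    using lip_b[OF \<tau>\<^sub>0 \<tau>(1)] lip_c[OF \<tau>\<^sub>0 \<tau>(1)] assms
    by (intro add_mono mult_left_mono) (auto simp: abs_minus_commute)
  finally have "(\<kappa> * ?d) * ?d \<le> ((s + u) * \<Lambda>) * ?d"
    by (simp add: power2_eq_square algebra_simps del: power2_abs)
  hence "\<kappa> * ?d \<le> (s + u) * \<Lambda>" if "?d > 0"
    using that by (rule mult_right_le_imp_le)
  thus ?thesis using \<kappa> \<Lambda> assms(1,2) by (cases "?d > 0") (auto simp: field_simps)
qed

lemma V_zero: "V 0 0 = a \<tau>\<^sub>0"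
  using minimizer_exists[of 0 0] minimizer_dist[of 0 0] by (auto simp: minimizer_def)

text \<open>Each of the two minimizers serves as a competitor in the other problem.\<close>

lemma V_increment:
  assumes "0 \<le> s" "0 \<le> u" "minimizer s 0 \<tau>" "minimizer s u \<sigma>"
  shows "V s u - V s 0 \<le> u * c \<tau>" "u * c \<sigma> \<le> V s u - V s 0"
  using assms V_le[of s u \<tau>] V_le[of s 0 \<sigma>] by (auto simp: minimizer_def)

lemma V_increment_fst:
  assumes "0 \<le> s" "minimizer s 0 \<sigma>"
  shows "V s 0 - V 0 0 \<le> s * b \<tau>\<^sub>0" "s * b \<sigma> \<le> V s 0 - V 0 0"
  using assms V_le[of s 0 \<tau>\<^sub>0] V_le[of 0 0 \<sigma>] \<tau>\<^sub>0 V_zero by (auto simp: minimizer_def)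

lemma V_lip_snd:
  assumes "0 \<le> s" "0 \<le> u" shows "\<bar>V s u - V s 0\<bar> \<le> \<beta> * u"
proof -
  obtain \<tau> \<sigma> where "minimizer s 0 \<tau>" "minimizer s u \<sigma>" using minimizer_exists assms by force
  moreover from this have "u * c \<tau> \<le> u * \<beta>" "- (u * \<beta>) \<le> u * c \<sigma>"
    using bound_c[of \<tau>] bound_c[of \<sigma>] assms mult_left_mono[of "-\<beta>" "c \<sigma>" u]
    by (auto simp: minimizer_def abs_le_iff intro!: mult_left_mono)
  ultimately show ?thesis using V_increment[of s u \<tau> \<sigma>] assms by (auto simp: abs_le_iff mult.commute)
qed

lemma V_lip_fst:
  assumes "0 \<le> s" shows "\<bar>V s 0 - V 0 0\<bar> \<le> \<beta> * s"
proof -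
  obtain \<sigma> where "minimizer s 0 \<sigma>" using minimizer_exists assms by force
  moreover from this have "s * b \<tau>\<^sub>0 \<le> s * \<beta>" "- (s * \<beta>) \<le> s * b \<sigma>"
    using bound_b[of \<tau>\<^sub>0] bound_b[of \<sigma>] \<tau>\<^sub>0 assms mult_left_mono[of "-\<beta>" "b \<sigma>" s]
    by (auto simp: minimizer_def abs_le_iff intro!: mult_left_mono)
  ultimately show ?thesis using V_increment_fst[of s \<sigma>] assms by (auto simp: abs_le_iff mult.commute)
qed

definition V_u :: "real \<Rightarrow> real" where
  "V_u s = Lim (at_right 0) (\<lambda>u. (V s u - V s 0) / u)"

text \<open>As a minimum of affine functions, \<open>V s\<close> is concave, so its difference
  quotients at 0 are nonincreasing in u; the Lipschitz bound keeps them bounded. They are negated to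
  fit a limit theorem for nondecreasing functions.\<close>

lemma V_u_tendsto:
  assumes "0 \<le> s" shows "((\<lambda>u. (V s u - V s 0) / u) \<longlongrightarrow> V_u s) (at_right 0)"
proof -
  let ?q = "\<lambda>u. (V s u - V s 0) / u"
  have "((\<lambda>u. - ?q u) \<longlongrightarrow> (\<Sqinter> ((\<lambda>u. - ?q u) ` ({0<..} \<inter> UNIV)))) (at 0 within ({0<..} \<inter> UNIV))"
  proof (rule Lim_right_bound)
    fix u v :: real assume uv: "0 < u" "u \<le> v"
    obtain \<tau> where \<tau>: "minimizer s u \<tau>" using minimizer_exists[of s u] assms uv by auto
    \<comment> \<open>Concavity: up to the factor v, the value of \<tau> in the problem (s, u) is a
      convex combination of its values in the problems (s, 0) and (s, v).\<close>
    have "v * V s u = (v - u) * (a \<tau> + s * b \<tau>) + u * (a \<tau> + s * b \<tau> + v * c \<tau>)"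
      using \<tau> by (simp add: minimizer_def algebra_simps)
    also have "\<dots> \<ge> (v - u) * V s 0 + u * V s v"
      using V_le[of s 0 \<tau>] V_le[of s v \<tau>] \<tau> uv assms
      by (intro add_mono mult_left_mono) (auto simp: minimizer_def)
    finally show "- ?q u \<le> - ?q v" using uv by (simp add: field_simps)
  next
    fix u :: real assume "0 < u"
    thus "- \<beta> \<le> - ?q u" using V_lip_snd[of s u] assms by (auto simp: field_simps abs_le_iff)
  qed
  hence "((\<lambda>u. - (- ?q u)) \<longlongrightarrow> - (\<Sqinter> ((\<lambda>u. - ?q u) ` ({0<..} \<inter> UNIV)))) (at_right 0)"
    by (intro tendsto_minus) simp
  hence "(?q \<longlongrightarrow> - (\<Sqinter> ((\<lambda>u. - ?q u) ` ({0<..} \<inter> UNIV)))) (at_right 0)" by simp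
  thus ?thesis unfolding V_u_def by (subst tendsto_Lim) auto
qed

lemma has_derivative_V_snd:
  assumes "0 \<le> s" shows "(V s has_real_derivative V_u s) (at_right 0)"
  using V_u_tendsto[OF assms] by (simp add: has_field_derivative_iff)

text \<open>The quotient (V s u - V s 0) / u lies between the values of \<open>c\<close> at a
  minimizer for u and at one for 0. So \<open>V_u s\<close> inherits whatever closeness to y the
  function \<open>c\<close> has at all minimizers for small u; the further estimates of
  \<open>V_u\<close> rest on this.\<close>

lemma V_u_approx:
  assumes "0 \<le> s" "0 < \<eta>"
    and "\<And>u \<tau>. 0 \<le> u \<Longrightarrow> u \<le> \<eta> \<Longrightarrow> minimizer s u \<tau> \<Longrightarrow> \<bar>c \<tau> - y\<bar> \<le> \<epsilon>"
  shows "\<bar>V_u s - y\<bar> \<le> \<epsilon>"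
proof -
  have ev: "\<forall>\<^sub>F u in at_right 0. 0 < u \<and> u < \<eta>"
    using eventually_at_right_real[OF assms(2)] by auto
  have q: "\<bar>(V s u - V s 0) / u - y\<bar> \<le> \<epsilon>" if u: "0 < u" "u < \<eta>" for u
  proof -
    obtain \<tau> \<sigma> where m: "minimizer s 0 \<tau>" "minimizer s u \<sigma>" using minimizer_exists assms(1) u by force
    have "c \<sigma> \<le> (V s u - V s 0) / u" "(V s u - V s 0) / u \<le> c \<tau>"
      using V_increment[OF assms(1) _ m] u by (auto simp: field_simps)
    thus ?thesis using assms(3)[OF _ _ m(1)] assms(3)[OF _ _ m(2)] u assms(2) by (auto simp: abs_le_iff)
  qed
  have l: "((\<lambda>u. \<bar>(V s u - V s 0) / u - y\<bar>) \<longlongrightarrow> \<bar>V_u s - y\<bar>) (at_right 0)"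
    by (intro tendsto_intros V_u_tendsto assms)
  show ?thesis
    by (rule tendsto_upperbound[OF l]) (use ev in \<open>auto elim!: eventually_mono intro: q\<close>)
qed

text \<open>The minimizers lie within (s + u) \<Lambda> / \<kappa> of \<open>\<tau>\<^sub>0\<close>
  and \<open>c\<close> is Lipschitz with constant \<Lambda>; the contribution of u is pushed below
  \<epsilon> by restricting u to [0, \<eta>].\<close>

lemma V_u_lip:
  assumes "0 \<le> s" shows "\<bar>V_u s - c \<tau>\<^sub>0\<bar> \<le> \<Lambda>\<^sup>2 / \<kappa> * s"
proof (rule field_le_epsilon)
  fix \<epsilon> :: real assume \<epsilon>: "0 < \<epsilon>"
  define \<eta> where "\<eta> = \<epsilon> / (\<Lambda>\<^sup>2 / \<kappa> + 1)"
  have p: "\<Lambda>\<^sup>2 / \<kappa> \<ge> 0" using \<kappa> by simp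
  have \<eta>: "\<eta> > 0" "\<Lambda>\<^sup>2 / \<kappa> * \<eta> \<le> \<epsilon>"
  proof -
    show "\<eta> > 0" using \<epsilon> p unfolding \<eta>_def by (intro divide_pos_pos) auto
    have "(\<Lambda>\<^sup>2 / \<kappa> + 1) * \<eta> = \<epsilon>" using p unfolding \<eta>_def by simp
    thus "\<Lambda>\<^sup>2 / \<kappa> * \<eta> \<le> \<epsilon>" using \<open>\<eta> > 0\<close> by (simp add: ring_distribs)
  qed
  show "\<bar>V_u s - c \<tau>\<^sub>0\<bar> \<le> \<Lambda>\<^sup>2 / \<kappa> * s + \<epsilon>"
  proof (rule V_u_approx[OF assms \<eta>(1)])
    fix u \<tau> assume u: "0 \<le> u" "u \<le> \<eta>" and m: "minimizer s u \<tau>"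
    have "\<bar>c \<tau> - c \<tau>\<^sub>0\<bar> \<le> \<Lambda> * \<bar>\<tau> - \<tau>\<^sub>0\<bar>" using m \<tau>\<^sub>0 by (intro lip_c) (auto simp: minimizer_def)
    also have "\<dots> \<le> \<Lambda> * ((s + u) * \<Lambda> / \<kappa>)"
      by (rule mult_left_mono[OF minimizer_dist]) (use u m assms \<Lambda> in auto)
    also have "\<dots> = \<Lambda>\<^sup>2 / \<kappa> * s + \<Lambda>\<^sup>2 / \<kappa> * u" by (simp add: power2_eq_square add_divide_distrib ring_distribs mult_ac)
    also have "\<Lambda>\<^sup>2 / \<kappa> * u \<le> \<Lambda>\<^sup>2 / \<kappa> * \<eta>" by (rule mult_left_mono[OF u(2) p])
    finally show "\<bar>c \<tau> - c \<tau>\<^sub>0\<bar> \<le> \<Lambda>\<^sup>2 / \<kappa> * s + \<epsilon>" using \<eta>(2) by linarith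
  qed
qed

lemma V_u_bound:
  assumes "0 \<le> s" shows "\<bar>V_u s\<bar> \<le> \<beta>"
  using V_u_approx[OF assms, of 1 0 \<beta>] bound_c by (simp add: minimizer_def)

lemma V_u_zero: "V_u 0 = c \<tau>\<^sub>0"
  using V_u_lip[of 0] by simp

text \<open>Taken from the Lipschitz bound instead of an explicit formula for d, so that it involves
  only \<Lambda> and \<kappa> and no second-order data of the individual problem.\<close>

lemma derivative_V_u_bound:
  assumes "(V_u has_real_derivative d) (at_right 0)" shows "\<bar>d\<bar> \<le> \<Lambda>\<^sup>2 / \<kappa>"
proof (rule tendsto_upperbound)
  show "((\<lambda>s. \<bar>(V_u s - V_u 0) / (s - 0)\<bar>) \<longlongrightarrow> \<bar>d\<bar>) (at_right 0)"
    using assms unfolding has_field_derivative_iff by (rule tendsto_rabs)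
  show "\<forall>\<^sub>F s in at_right 0. \<bar>(V_u s - V_u 0) / (s - 0)\<bar> \<le> \<Lambda>\<^sup>2 / \<kappa>"
    using eventually_at_right_less[of "0::real"]
  proof eventually_elim
    case (elim s)
    thus ?case using V_u_lip[of s] by (simp add: V_u_zero divide_le_eq)
  qed
qed simp

text \<open>The minimizer moves by O(s) and \<open>b\<close> is Lipschitz, so following it changes
  the difference quotient only by O(s).\<close>

lemma has_derivative_V_fst: "((\<lambda>s. V s 0) has_real_derivative b \<tau>\<^sub>0) (at_right 0)"
proof -
  have "((\<lambda>s. (V s 0 - V 0 0) / s) \<longlongrightarrow> b \<tau>\<^sub>0) (at_right 0)"
  proof (rule tendsto_sandwich)
    show "((\<lambda>s. b \<tau>\<^sub>0 - \<Lambda>\<^sup>2 / \<kappa> * s) \<longlongrightarrow> b \<tau>\<^sub>0) (at_right 0)"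
      using \<kappa> by (auto intro!: tendsto_eq_intros)
    have "b \<tau>\<^sub>0 - \<Lambda>\<^sup>2 / \<kappa> * s \<le> (V s 0 - V 0 0) / s \<and> (V s 0 - V 0 0) / s \<le> b \<tau>\<^sub>0" if s: "0 < s" for s
    proof -
      obtain \<sigma> where m: "minimizer s 0 \<sigma>" using minimizer_exists[of s 0] s by auto
      have "\<bar>b \<sigma> - b \<tau>\<^sub>0\<bar> \<le> \<Lambda> * \<bar>\<sigma> - \<tau>\<^sub>0\<bar>" using m \<tau>\<^sub>0 by (intro lip_b) (auto simp: minimizer_def)
      also have "\<dots> \<le> \<Lambda> * ((s + 0) * \<Lambda> / \<kappa>)"
        by (rule mult_left_mono[OF minimizer_dist]) (use s m \<Lambda> in auto)
      finally have "b \<tau>\<^sub>0 - \<Lambda>\<^sup>2 / \<kappa> * s \<le> b \<sigma>" by (simp add: power2_eq_square mult_ac)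
      moreover have "b \<sigma> \<le> (V s 0 - V 0 0) / s" "(V s 0 - V 0 0) / s \<le> b \<tau>\<^sub>0"
        using V_increment_fst[OF _ m] s by (simp_all add: le_divide_eq divide_le_eq mult.commute)
      ultimately show ?thesis by simp
    qed
    thus "\<forall>\<^sub>F s in at_right 0. b \<tau>\<^sub>0 - \<Lambda>\<^sup>2 / \<kappa> * s \<le> (V s 0 - V 0 0) / s"
      "\<forall>\<^sub>F s in at_right 0. (V s 0 - V 0 0) / s \<le> b \<tau>\<^sub>0"
      using eventually_at_right_less[of "0::real"] by (auto elim!: eventually_mono)
  qed auto
  thus ?thesis by (simp add: has_field_derivative_iff)
qed

text \<open>Under the scaling \<open>\<tau> = \<tau>\<^sub>0 + s \<sigma>\<close> the objective converges to the quadratic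
  \<open>a\<^sub>2 \<sigma>\<^sup>2 / 2 + b\<^sub>1 \<sigma>\<close>, so the minimizers move with velocity \<open>- b\<^sub>1 / a\<^sub>2\<close>.\<close>

lemma has_derivative_V_u:
  assumes a2: "0 < a\<^sub>2" "((\<lambda>\<tau>. (a \<tau> - a \<tau>\<^sub>0) / (\<tau> - \<tau>\<^sub>0)\<^sup>2) \<longlongrightarrow> a\<^sub>2 / 2) (at \<tau>\<^sub>0)"
    and b1: "(b has_real_derivative b\<^sub>1) (at \<tau>\<^sub>0)"
    and c1: "(c has_real_derivative c\<^sub>1) (at \<tau>\<^sub>0)"
    and int: "\<tau>\<^sub>0 \<in> interior X"
  shows "(V_u has_real_derivative - b\<^sub>1 * c\<^sub>1 / a\<^sub>2) (at_right 0)"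
proof -
  \<comment> \<open>\<open>M * s\<close> dominates the displacement of a true minimizer, through
    \<open>2 * \<Lambda> / \<kappa>\<close> from \<open>minimizer_dist\<close> with u \<le> s, as
    well as that of the minimizer of the quadratic model, through
    \<open>\<bar>b\<^sub>1\<bar> / a\<^sub>2\<close>.\<close>
  define M where "M = 2 * \<Lambda> / \<kappa> + \<bar>b\<^sub>1\<bar> / a\<^sub>2 + 1"
  have M: "M \<ge> 1" "2 * \<Lambda> / \<kappa> \<le> M" "\<bar>b\<^sub>1\<bar> / a\<^sub>2 \<le> M" using a2 \<kappa> \<Lambda> by (auto simp: M_def)
  have M_pos: "M > 0" using M by linarith
  have main: "\<forall>\<^sub>F s in at_right 0. \<bar>V_u s - (c \<tau>\<^sub>0 - s * (b\<^sub>1 * c\<^sub>1 / a\<^sub>2))\<bar> \<le> \<epsilon> * (M + \<bar>c\<^sub>1\<bar>) * s" if \<epsilon>: "0 < \<epsilon>" for \<epsilon> :: real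
  proof -
    \<comment> \<open>\<open>\<eta> * Q * s\<^sup>2\<close> is the total error of replacing the
      objective by its quadratic model at the two points to be compared; the summands of
      \<open>Q\<close> belong to \<open>a\<close>, to \<open>b\<close> and to the term with u. The
      choice of \<eta> turns it into
      \<open>a\<^sub>2 / 2 * (\<epsilon> * s)\<^sup>2\<close>.\<close>
    define Q where "Q = 2 * M\<^sup>2 + 2 * M + 2 * M * \<Lambda>"
    have Q: "Q > 0" using M_pos \<Lambda> by (auto simp: Q_def intro!: add_pos_nonneg)
    define \<eta> where "\<eta> = a\<^sub>2 * \<epsilon>\<^sup>2 / (2 * Q)"
    have \<eta>: "\<eta> > 0" using a2 \<epsilon> Q by (auto simp: \<eta>_def)
    have "\<forall>\<^sub>F \<tau> in at \<tau>\<^sub>0. dist ((a \<tau> - a \<tau>\<^sub>0) / (\<tau> - \<tau>\<^sub>0)\<^sup>2) (a\<^sub>2 / 2) < \<eta>"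
      using tendstoD[OF a2(2) \<eta>] .
    moreover have "\<forall>\<^sub>F \<tau> in at \<tau>\<^sub>0. dist ((b \<tau> - b \<tau>\<^sub>0) / (\<tau> - \<tau>\<^sub>0)) b\<^sub>1 < \<eta>"
      using tendstoD[OF _ \<eta>] b1 by (auto simp: has_field_derivative_iff)
    moreover have "\<forall>\<^sub>F \<tau> in at \<tau>\<^sub>0. dist ((c \<tau> - c \<tau>\<^sub>0) / (\<tau> - \<tau>\<^sub>0)) c\<^sub>1 < \<epsilon>"
      using tendstoD[OF _ \<epsilon>] c1 by (auto simp: has_field_derivative_iff)
    moreover have "\<forall>\<^sub>F \<tau> in at \<tau>\<^sub>0. \<tau> \<in> X"
      using int by (metis eventually_at_topological interior_subset open_interior subsetD)
    ultimately have "\<forall>\<^sub>F \<tau> in at \<tau>\<^sub>0. \<tau> \<in> X \<and> dist ((a \<tau> - a \<tau>\<^sub>0) / (\<tau> - \<tau>\<^sub>0)\<^sup>2) (a\<^sub>2 / 2) < \<eta> \<and>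
       dist ((b \<tau> - b \<tau>\<^sub>0) / (\<tau> - \<tau>\<^sub>0)) b\<^sub>1 < \<eta> \<and> dist ((c \<tau> - c \<tau>\<^sub>0) / (\<tau> - \<tau>\<^sub>0)) c\<^sub>1 < \<epsilon>"
      by eventually_elim auto
    then obtain \<delta> where \<delta>: "\<delta> > 0" and near: "\<And>\<tau>. \<tau> \<noteq> \<tau>\<^sub>0 \<Longrightarrow> dist \<tau> \<tau>\<^sub>0 < \<delta> \<Longrightarrow> \<tau> \<in> X \<and>
       dist ((a \<tau> - a \<tau>\<^sub>0) / (\<tau> - \<tau>\<^sub>0)\<^sup>2) (a\<^sub>2 / 2) < \<eta> \<and>
       dist ((b \<tau> - b \<tau>\<^sub>0) / (\<tau> - \<tau>\<^sub>0)) b\<^sub>1 < \<eta> \<and> dist ((c \<tau> - c \<tau>\<^sub>0) / (\<tau> - \<tau>\<^sub>0)) c\<^sub>1 < \<epsilon>"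
      unfolding eventually_at by auto
    have exp: "\<tau>\<^sub>0 + d \<in> X \<and> \<bar>a (\<tau>\<^sub>0 + d) - a \<tau>\<^sub>0 - a\<^sub>2 / 2 * d\<^sup>2\<bar> \<le> \<eta> * d\<^sup>2 \<and>
        \<bar>b (\<tau>\<^sub>0 + d) - b \<tau>\<^sub>0 - b\<^sub>1 * d\<bar> \<le> \<eta> * \<bar>d\<bar> \<and> \<bar>c (\<tau>\<^sub>0 + d) - c \<tau>\<^sub>0 - c\<^sub>1 * d\<bar> \<le> \<epsilon> * \<bar>d\<bar>"
      if d: "\<bar>d\<bar> < \<delta>" for d
    proof (cases "d = 0")
      case False
      have r: "\<bar>x - y * z\<bar> \<le> w * \<bar>z\<bar>" if "dist (x / z) y < w" "z \<noteq> 0" for x y z w :: real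
      proof -
        have "x - y * z = (x / z - y) * z" using that by (simp add: field_simps)
        hence "\<bar>x - y * z\<bar> = \<bar>x / z - y\<bar> * \<bar>z\<bar>" by (simp add: abs_mult)
        thus ?thesis using that by (auto simp: dist_real_def intro!: mult_right_mono)
      qed
      note n = near[of "\<tau>\<^sub>0 + d"]
      show ?thesis using n d False r[of "a (\<tau>\<^sub>0 + d) - a \<tau>\<^sub>0" "d\<^sup>2" "a\<^sub>2/2" \<eta>] r[of "b (\<tau>\<^sub>0 + d) - b \<tau>\<^sub>0" d b\<^sub>1 \<eta>]
          r[of "c (\<tau>\<^sub>0 + d) - c \<tau>\<^sub>0" d c\<^sub>1 \<epsilon>]
        by (auto simp: dist_norm)
    qed (use \<tau>\<^sub>0 in auto)
    define s0 where "s0 = min 1 (min \<eta> (\<delta> / M))"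
    have s0: "s0 > 0" using \<eta> \<delta> M_pos by (auto simp: s0_def)
    have ev: "\<forall>\<^sub>F s in at_right 0. 0 < s \<and> s < s0"
      using eventually_at_right_real[OF s0] by auto
    show ?thesis using ev
    proof eventually_elim
      case (elim s)
      hence s: "0 < s" "s < 1" "s < \<eta>" "M * s < \<delta>" using M_pos by (auto simp: s0_def field_simps)
      show ?case
      proof (rule V_u_approx[of _ "s\<^sup>2"])
        \<comment> \<open>With u \<le> s^2 the term u c differs by only O(s^3) between the two
          points, below the scale s^2 of the quadratic model.\<close>
        fix u \<tau> assume u: "0 \<le> u" "u \<le> s\<^sup>2" and m: "minimizer s u \<tau>"
        define d where "d = \<tau> - \<tau>\<^sub>0"
        \<comment> \<open>The minimizer of the model
          \<open>a\<^sub>2 / 2 * d\<^sup>2 + s * b\<^sub>1 * d\<close>.\<close>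
        define d' where "d' = - s * b\<^sub>1 / a\<^sub>2"
        have \<tau>: "\<tau> = \<tau>\<^sub>0 + d" "\<tau> \<in> X" using m by (auto simp: d_def minimizer_def)
        have us: "u \<le> s" using u s by (smt (verit) mult_left_le power2_eq_square)
        have dM: "\<bar>d\<bar> \<le> M * s"
        proof -
          have "\<bar>d\<bar> \<le> (s + u) * \<Lambda> / \<kappa>" using minimizer_dist[OF _ u(1) m] s by (simp add: d_def)
          also have "\<dots> = (s + u) * (\<Lambda> / \<kappa>)" by simp
          also have "\<dots> \<le> (2 * s) * (\<Lambda> / \<kappa>)" using us \<kappa> \<Lambda> by (intro mult_right_mono) auto
          also have "\<dots> = (2 * \<Lambda> / \<kappa>) * s" by simp
          also have "\<dots> \<le> M * s" using M s by (intro mult_right_mono) auto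
          finally show ?thesis .
        qed
        have d'M: "\<bar>d'\<bar> \<le> M * s"
        proof -
          have "\<bar>d'\<bar> = (\<bar>b\<^sub>1\<bar> / a\<^sub>2) * s" using a2 s by (simp add: d'_def abs_mult)
          thus ?thesis using M s mult_right_mono[of "\<bar>b\<^sub>1\<bar> / a\<^sub>2" M s] by simp
        qed
        note ed = exp[of d] and ed' = exp[of d']
        have dl: "\<bar>d\<bar> < \<delta>" "\<bar>d'\<bar> < \<delta>" using dM d'M s by auto
        have Vle: "V s u \<le> a (\<tau>\<^sub>0 + d') + s * b (\<tau>\<^sub>0 + d') + u * c (\<tau>\<^sub>0 + d')"
          by (rule V_le) (use u s ed' dl in auto)
        have Veq: "V s u = a (\<tau>\<^sub>0 + d) + s * b (\<tau>\<^sub>0 + d) + u * c (\<tau>\<^sub>0 + d)"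
          using m \<tau> by (simp add: minimizer_def)
        have sqM: "x\<^sup>2 \<le> M\<^sup>2 * s\<^sup>2" if "\<bar>x\<bar> \<le> M * s" for x
          using power_mono[OF that, of 2] by (simp add: power_mult_distrib)
        have eb: "s * b (\<tau>\<^sub>0 + d) \<ge> s * (b \<tau>\<^sub>0 + b\<^sub>1 * d - \<eta> * (M * s))"
           "s * b (\<tau>\<^sub>0 + d') \<le> s * (b \<tau>\<^sub>0 + b\<^sub>1 * d' + \<eta> * (M * s))"
        proof -
          have "\<eta> * \<bar>d\<bar> \<le> \<eta> * (M * s)" "\<eta> * \<bar>d'\<bar> \<le> \<eta> * (M * s)"
            using dM d'M \<eta> by (auto intro!: mult_left_mono)
          hence "b \<tau>\<^sub>0 + b\<^sub>1 * d - \<eta> * (M * s) \<le> b (\<tau>\<^sub>0 + d)" "b (\<tau>\<^sub>0 + d') \<le> b \<tau>\<^sub>0 + b\<^sub>1 * d' + \<eta> * (M * s)"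
            using ed[OF dl(1)] ed'[OF dl(2)] by linarith+
          thus "s * b (\<tau>\<^sub>0 + d) \<ge> s * (b \<tau>\<^sub>0 + b\<^sub>1 * d - \<eta> * (M * s))"
           "s * b (\<tau>\<^sub>0 + d') \<le> s * (b \<tau>\<^sub>0 + b\<^sub>1 * d' + \<eta> * (M * s))"
            using s by (auto intro!: mult_left_mono)
        qed
        have ea: "a (\<tau>\<^sub>0 + d) \<ge> a \<tau>\<^sub>0 + a\<^sub>2 / 2 * d\<^sup>2 - \<eta> * (M\<^sup>2 * s\<^sup>2)"
            "a (\<tau>\<^sub>0 + d') \<le> a \<tau>\<^sub>0 + a\<^sub>2 / 2 * d'\<^sup>2 + \<eta> * (M\<^sup>2 * s\<^sup>2)"
        proof -
          have "\<eta> * d\<^sup>2 \<le> \<eta> * (M\<^sup>2 * s\<^sup>2)" "\<eta> * d'\<^sup>2 \<le> \<eta> * (M\<^sup>2 * s\<^sup>2)"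
            using sqM[OF dM] sqM[OF d'M] \<eta> by (auto intro!: mult_left_mono)
          thus "a (\<tau>\<^sub>0 + d) \<ge> a \<tau>\<^sub>0 + a\<^sub>2 / 2 * d\<^sup>2 - \<eta> * (M\<^sup>2 * s\<^sup>2)"
            "a (\<tau>\<^sub>0 + d') \<le> a \<tau>\<^sub>0 + a\<^sub>2 / 2 * d'\<^sup>2 + \<eta> * (M\<^sup>2 * s\<^sup>2)"
            using ed[OF dl(1)] ed'[OF dl(2)] by linarith+
        qed
        have ec: "u * c (\<tau>\<^sub>0 + d') \<le> u * c (\<tau>\<^sub>0 + d) + \<eta> * s\<^sup>2 * (2 * M * \<Lambda>)"
        proof -
          have "\<bar>c (\<tau>\<^sub>0 + d') - c (\<tau>\<^sub>0 + d)\<bar> \<le> \<Lambda> * \<bar>d' - d\<bar>" using lip_c[of "\<tau>\<^sub>0 + d'" "\<tau>\<^sub>0 + d"] ed ed' dl by simp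
          also have "\<dots> \<le> \<Lambda> * (2 * M * s)" using dM d'M \<Lambda> by (intro mult_left_mono) auto
          finally have "u * (c (\<tau>\<^sub>0 + d') - c (\<tau>\<^sub>0 + d)) \<le> u * (\<Lambda> * (2 * M * s))"
            using u by (intro mult_left_mono) auto
          also have "\<dots> \<le> s\<^sup>2 * (\<Lambda> * (2 * M * s))"
            using u s M_pos \<Lambda> by (intro mult_right_mono) auto
          also have "\<dots> = (s\<^sup>2 * (2 * M * \<Lambda>)) * s" by (simp add: mult_ac)
          also have "\<dots> \<le> (s\<^sup>2 * (2 * M * \<Lambda>)) * \<eta>" using s M_pos \<Lambda> by (intro mult_left_mono) auto
          finally show ?thesis by (simp add: algebra_simps)
        qed
        \<comment> \<open>Completing the square at \<open>d'\<close>: the left side is the excess of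
          the model at \<open>d\<close> over its minimum, while minimality of \<tau> for the true
          objective bounds this excess by the approximation errors.\<close>
        have "a\<^sub>2 / 2 * (d - d')\<^sup>2 = a\<^sub>2 / 2 * d\<^sup>2 + s * b\<^sub>1 * d - (a\<^sub>2 / 2 * d'\<^sup>2 + s * b\<^sub>1 * d')"
          using a2 by (simp add: d'_def field_simps power2_eq_square)
        also have "\<dots> \<le> 2 * \<eta> * (M\<^sup>2 * s\<^sup>2) + 2 * (s * (\<eta> * (M * s))) + \<eta> * s\<^sup>2 * (2 * M * \<Lambda>)"
          using Vle Veq ea eb ec unfolding ring_distribs by linarith
        also have "\<dots> = \<eta> * Q * s\<^sup>2" by (simp add: Q_def algebra_simps power2_eq_square)
        also have "\<eta> * Q = a\<^sub>2 / 2 * \<epsilon>\<^sup>2" using Q by (simp add: \<eta>_def)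
        finally have "a\<^sub>2 / 2 * (d - d')\<^sup>2 \<le> a\<^sub>2 / 2 * (\<epsilon> * s)\<^sup>2" by (simp add: power_mult_distrib)
        hence "(d - d')\<^sup>2 \<le> (\<epsilon> * s)\<^sup>2" using a2 by simp
        hence dd: "\<bar>d - d'\<bar> \<le> \<epsilon> * s" using \<epsilon> s by (simp add: power2_le_iff_abs_le)
        have "\<bar>c \<tau> - (c \<tau>\<^sub>0 + c\<^sub>1 * d')\<bar> \<le> \<bar>c \<tau> - c \<tau>\<^sub>0 - c\<^sub>1 * d\<bar> + \<bar>c\<^sub>1 * (d - d')\<bar>"
          by (simp add: algebra_simps)
        also have "\<dots> \<le> \<epsilon> * (M * s) + \<bar>c\<^sub>1\<bar> * (\<epsilon> * s)"
        proof (rule add_mono)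
          have "\<bar>c \<tau> - c \<tau>\<^sub>0 - c\<^sub>1 * d\<bar> \<le> \<epsilon> * \<bar>d\<bar>" using ed dl \<tau> by simp
          also have "\<dots> \<le> \<epsilon> * (M * s)" using dM \<epsilon> by (intro mult_left_mono) auto
          finally show "\<bar>c \<tau> - c \<tau>\<^sub>0 - c\<^sub>1 * d\<bar> \<le> \<epsilon> * (M * s)" .
          show "\<bar>c\<^sub>1 * (d - d')\<bar> \<le> \<bar>c\<^sub>1\<bar> * (\<epsilon> * s)" unfolding abs_mult using dd by (intro mult_left_mono) auto
        qed
        also have "c \<tau>\<^sub>0 + c\<^sub>1 * d' = c \<tau>\<^sub>0 - s * (b\<^sub>1 * c\<^sub>1 / a\<^sub>2)" by (simp add: d'_def)
        finally show "\<bar>c \<tau> - (c \<tau>\<^sub>0 - s * (b\<^sub>1 * c\<^sub>1 / a\<^sub>2))\<bar> \<le> \<epsilon> * (M + \<bar>c\<^sub>1\<bar>) * s" by (simp add: algebra_simps)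
      qed (use s in auto)
    qed
  qed
  have "((\<lambda>s. (V_u s - V_u 0) / s) \<longlongrightarrow> - b\<^sub>1 * c\<^sub>1 / a\<^sub>2) (at_right 0)"
  proof (rule tendstoI)
    fix e :: real assume e: "0 < e"
    define \<epsilon> where "\<epsilon> = e / (2 * (M + \<bar>c\<^sub>1\<bar>))"
    have \<epsilon>: "\<epsilon> > 0" "\<epsilon> * (M + \<bar>c\<^sub>1\<bar>) < e" using e M_pos by (auto simp: \<epsilon>_def field_simps add_pos_nonneg)
    show "\<forall>\<^sub>F s in at_right 0. dist ((V_u s - V_u 0) / s) (- b\<^sub>1 * c\<^sub>1 / a\<^sub>2) < e"
      using main[OF \<epsilon>(1)] eventually_at_right_less[of "0::real"]
    proof eventually_elim
      case (elim s)
      have "(V_u s - V_u 0) / s - (- b\<^sub>1 * c\<^sub>1 / a\<^sub>2) = (V_u s - (c \<tau>\<^sub>0 - s * (b\<^sub>1 * c\<^sub>1 / a\<^sub>2))) / s"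
        using elim by (simp add: V_u_zero field_simps)
      hence "\<bar>(V_u s - V_u 0) / s - (- b\<^sub>1 * c\<^sub>1 / a\<^sub>2)\<bar> \<le> \<epsilon> * (M + \<bar>c\<^sub>1\<bar>)"
        using elim by (simp add: field_simps)
      thus ?case using \<epsilon>(2) by (simp add: dist_real_def)
    qed
  qed
  thus ?thesis by (simp add: has_field_derivative_iff)
qed

end

section \<open>Support and radial functions\<close>

definition perp :: "real^2 \<Rightarrow> real^2" where
  "perp v = vector [- v$2, v$1]"

lemma perp_simps [simp]: "perp v $ 1 = - v$2" "perp v $ 2 = v$1"
  by (simp_all add: perp_def)

lemma inner_real2: "v \<bullet> (w :: real^2) = v$1 * w$1 + v$2 * w$2"
  by (simp add: inner_vec_def UNIV_2)

lemma norm_real2: "norm (v :: real^2) = sqrt ((v$1)\<^sup>2 + (v$2)\<^sup>2)"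
  by (simp add: norm_eq_sqrt_inner inner_real2 power2_eq_square)

lemma norm_perp [simp]: "norm (perp v) = norm v"
  by (simp add: norm_real2 add.commute)

lemma inner_perp_self [simp]: "v \<bullet> perp v = 0" "perp v \<bullet> v = 0"
  by (simp_all add: inner_real2)

lemma perp_diff: "perp (v - w) = perp v - perp w"
  by (simp add: vec_eq_iff forall_2)

definition dual_point :: "real^2 \<Rightarrow> real \<Rightarrow> real^2" where
  "dual_point e \<tau> = e + \<tau> *\<^sub>R perp e"

lemma inner_dual_point: "x \<bullet> dual_point e \<tau> = x \<bullet> e + \<tau> * (x \<bullet> perp e)"
  by (simp add: dual_point_def inner_add_right)

lemma unit_inner_dual_point [simp]: "norm e = 1 \<Longrightarrow> e \<bullet> dual_point e \<tau> = 1"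
  by (simp add: inner_dual_point dot_square_norm)

lemma norm_dual_point:
  assumes "norm e = 1" shows "(norm (dual_point e \<tau>))\<^sup>2 = 1 + \<tau>\<^sup>2"
proof -
  have "(norm (dual_point e \<tau>))\<^sup>2 = dual_point e \<tau> \<bullet> dual_point e \<tau>" by (simp add: power2_norm_eq_inner)
  also have "\<dots> = e \<bullet> e + \<tau> * \<tau> * (perp e \<bullet> perp e)"
    by (simp add: dual_point_def inner_add_right inner_add_left)
  finally show ?thesis using assms by (simp add: dot_square_norm power2_eq_square)
qed

lemma abs_le_norm_dual_point: "norm e = 1 \<Longrightarrow> \<bar>\<tau>\<bar> \<le> norm (dual_point e \<tau>)"
  by (rule power2_le_imp_le) (auto simp: norm_dual_point)

lemma one_le_norm_dual_point: "norm e = 1 \<Longrightarrow> 1 \<le> norm (dual_point e \<tau>)"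
  by (rule power2_le_imp_le) (auto simp: norm_dual_point)

lemma dual_point_diff: "dual_point e \<sigma> - dual_point e \<tau> = (\<sigma> - \<tau>) *\<^sub>R perp e"
  by (simp add: dual_point_def algebra_simps)

lemma dist_dual_point: "norm (dual_point e \<tau> - dual_point f \<tau>) \<le> (1 + \<bar>\<tau>\<bar>) * norm (e - f)"
proof -
  have "dual_point e \<tau> - dual_point f \<tau> = (e - f) + \<tau> *\<^sub>R perp (e - f)"
    by (simp add: dual_point_def perp_diff algebra_simps)
  hence "norm (dual_point e \<tau> - dual_point f \<tau>) \<le> norm (e - f) + norm (\<tau> *\<^sub>R perp (e - f))"
    by (metis norm_triangle_ineq)
  thus ?thesis by (simp add: algebra_simps)
qed

lemma orthonormal_decomposition:
  assumes "norm e = 1" shows "v = (v \<bullet> e) *\<^sub>R e + (v \<bullet> perp e) *\<^sub>R perp e"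
proof -
  have "(e$1)\<^sup>2 + (e$2)\<^sup>2 = 1" using assms by (simp add: norm_real2)
  hence sq: "e$1 * e$1 + e$2 * e$2 = 1" by (simp add: power2_eq_square)
  have "(v$1 * e$1 + v$2 * e$2) * e$1 + (v$2 * e$1 - v$1 * e$2) * - (e$2) = v$1 * (e$1 * e$1 + e$2 * e$2)"
    by (simp add: algebra_simps)
  moreover have "(v$1 * e$1 + v$2 * e$2) * e$2 + (v$2 * e$1 - v$1 * e$2) * e$1 = v$2 * (e$1 * e$1 + e$2 * e$2)"
    by (simp add: algebra_simps)
  ultimately show ?thesis unfolding sq vec_eq_iff forall_2 by (simp add: inner_real2)
qed

lemma scaled_dual_point:
  assumes "norm e = 1" "v \<bullet> e > 0"
  shows "v = (v \<bullet> e) *\<^sub>R dual_point e ((v \<bullet> perp e) / (v \<bullet> e))"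
proof -
  have "(v \<bullet> e) *\<^sub>R dual_point e ((v \<bullet> perp e) / (v \<bullet> e)) = (v \<bullet> e) *\<^sub>R e + (v \<bullet> perp e) *\<^sub>R perp e"
    using assms(2) by (simp add: dual_point_def scaleR_add_right)
  also have "\<dots> = v" by (rule orthonormal_decomposition[OF assms(1), symmetric])
  finally show ?thesis by (rule sym)
qed

section \<open>Support functions\<close>

definition supp :: "(real^2) set \<Rightarrow> real^2 \<Rightarrow> real" where
  "supp K n = Sup ((\<lambda>x. x \<bullet> n) ` K)"

lemma supp_bdd: "compact K \<Longrightarrow> bdd_above ((\<lambda>x. x \<bullet> n) ` K)"
  by (intro bounded_imp_bdd_above compact_imp_bounded compact_continuous_image continuous_intros)

lemma supp_ge: "compact K \<Longrightarrow> x \<in> K \<Longrightarrow> x \<bullet> n \<le> supp K n"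
  unfolding supp_def by (rule cSUP_upper[OF _ supp_bdd])

lemma supp_le: "K \<noteq> {} \<Longrightarrow> (\<And>x. x \<in> K \<Longrightarrow> x \<bullet> n \<le> c) \<Longrightarrow> supp K n \<le> c"
  unfolding supp_def by (rule cSUP_least)

lemma supp_attained:
  assumes "compact K" "K \<noteq> {}" shows "\<exists>x\<in>K. x \<bullet> n = supp K n"
proof -
  have "\<exists>x\<in>K. \<forall>y\<in>K. y \<bullet> n \<le> x \<bullet> n"
    by (rule continuous_attains_sup) (use assms in \<open>auto intro!: continuous_intros\<close>)
  then obtain x where "x \<in> K" "\<And>y. y \<in> K \<Longrightarrow> y \<bullet> n \<le> x \<bullet> n" by blast
  thus ?thesis using supp_ge[OF assms(1), of x n] supp_le[OF assms(2), of n "x \<bullet> n"]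
    by (intro bexI[of _ x]) auto
qed

lemma supp_eqI:
  assumes "compact K" "x \<in> K" "\<And>y. y \<in> K \<Longrightarrow> y \<bullet> n \<le> x \<bullet> n"
  shows "supp K n = x \<bullet> n"
  using supp_ge[OF assms(1,2), of n] supp_le[of K n "x \<bullet> n"] assms by force

lemma compact_set_plus:
  fixes A B :: "(real^2) set"
  assumes "compact A" "compact B" shows "compact (A + B)"
proof -
  have "A + B = {x + y | x y. x \<in> A \<and> y \<in> B}" by (auto simp: set_plus_def)
  thus ?thesis using compact_sums[OF assms] by simp
qed

lemma supp_set_plus:
  assumes A: "compact A" "A \<noteq> {}" and B: "compact B" "B \<noteq> {}"
  shows "supp (A + B) n = supp A n + supp B n"
proof -
  obtain x y where xy: "x \<in> A" "y \<in> B" "x \<bullet> n = supp A n" "y \<bullet> n = supp B n"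
    using supp_attained[OF A, of n] supp_attained[OF B, of n] by blast
  have "supp (A + B) n = (x + y) \<bullet> n"
    by (rule supp_eqI[OF compact_set_plus[OF A(1) B(1)]])
       (use xy supp_ge[OF A(1)] supp_ge[OF B(1)] in \<open>auto simp: set_plus_def inner_add_left intro!: add_mono\<close>)
  thus ?thesis using xy by (simp add: inner_add_left)
qed

lemma supp_scale_set:
  assumes A: "compact A" "A \<noteq> {}" and "0 \<le> t"
  shows "supp ((*\<^sub>R) t ` A) n = t * supp A n"
proof -
  obtain x where x: "x \<in> A" "x \<bullet> n = supp A n" using supp_attained[OF A, of n] by blast
  have "supp ((*\<^sub>R) t ` A) n = (t *\<^sub>R x) \<bullet> n"
    by (rule supp_eqI[OF compact_scaling[OF A(1)]])
       (use x supp_ge[OF A(1)] \<open>0 \<le> t\<close> in \<open>auto intro!: mult_left_mono\<close>)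
  thus ?thesis using x by simp
qed

lemma supp_scale_arg:
  assumes A: "compact A" "A \<noteq> {}" and "0 \<le> t"
  shows "supp A (t *\<^sub>R n) = t * supp A n"
proof -
  obtain x where x: "x \<in> A" "x \<bullet> n = supp A n" using supp_attained[OF A, of n] by blast
  have "supp A (t *\<^sub>R n) = x \<bullet> (t *\<^sub>R n)"
    by (rule supp_eqI[OF A(1)]) (use x supp_ge[OF A(1)] \<open>0 \<le> t\<close> in \<open>auto intro!: mult_left_mono\<close>)
  thus ?thesis using x by simp
qed

text \<open>A convex body around the origin together with an inner and an outer radius. One common
  pair for all bodies in play keeps the constants below independent of the direction.\<close>

definition round_body :: "real \<Rightarrow> real \<Rightarrow> (real^2) set \<Rightarrow> bool" where
  "round_body r \<rho> K \<longleftrightarrow> 0 < r \<and> compact K \<and> convex K \<and> cball 0 r \<subseteq> K \<and> K \<subseteq> cball 0 \<rho>"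

lemma round_bodyD:
  assumes "round_body r \<rho> K"
  shows "0 < r" "compact K" "convex K" "cball 0 r \<subseteq> K" "K \<subseteq> cball 0 \<rho>" "K \<noteq> {}" "0 \<in> K" "r \<le> \<rho>"
proof -
  show *: "0 < r" "compact K" "convex K" "cball 0 r \<subseteq> K" "K \<subseteq> cball 0 \<rho>" 
    using assms by (auto simp: round_body_def)
  show "0 \<in> K" using * by (auto simp: subset_iff)
  thus "K \<noteq> {}" by auto
  have "r *\<^sub>R axis 1 1 \<in> cball (0::real^2) r" using *(1) by simp
  hence "r *\<^sub>R axis 1 1 \<in> cball (0::real^2) \<rho>" using *(4,5) by blast
  thus "r \<le> \<rho>" using *(1) by simp
qed

lemma round_body_mono:
  "round_body r \<rho> K \<Longrightarrow> 0 < r' \<Longrightarrow> r' \<le> r \<Longrightarrow> \<rho> \<le> \<rho>' \<Longrightarrow> round_body r' \<rho>' K"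
  unfolding round_body_def by force

lemma convex_body_imp_round_body:
  assumes "convex_body K" "0 \<in> interior K"
  shows "\<exists>r \<rho>. round_body r \<rho> K"
proof -
  have K: "compact K" "convex K" using assms by (auto simp: convex_body_def)
  obtain r where "r > 0" "cball 0 r \<subseteq> K" using assms(2) by (auto simp: mem_interior_cball)
  moreover obtain \<rho> where "\<And>x. x \<in> K \<Longrightarrow> norm x \<le> \<rho>" using compact_imp_bounded[OF K(1)] by (auto simp: bounded_iff)
  ultimately show ?thesis using K unfolding round_body_def by (intro exI[of _ r] exI[of _ \<rho>]) auto
qed

text \<open>Both radii scale with t + s + u, so their quotient is that of the original bodies. This
  is what confines the minimization over \<tau> to one interval for all parameters.\<close>

lemma round_body_combination:
  assumes A: "round_body r \<rho> A" and B: "round_body r \<rho> B" and C: "round_body r \<rho> C"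
    and t: "0 < t" "0 \<le> s" "0 \<le> u"
  shows "round_body (r * (t + s + u)) (\<rho> * (t + s + u)) ((*\<^sub>R) t ` A + (*\<^sub>R) s ` B + (*\<^sub>R) u ` C)" (is "round_body _ _ ?K")
  unfolding round_body_def
proof (intro conjI)
  note a = round_bodyD[OF A] and b = round_bodyD[OF B] and c = round_bodyD[OF C]
  show "0 < r * (t + s + u)" using a t by (auto intro!: mult_pos_pos)
  show "compact ?K" by (intro compact_set_plus compact_scaling a b c)
  show "convex ?K" by (intro convex_set_plus convex_scaling a b c)
  show "cball 0 (r * (t + s + u)) \<subseteq> ?K"
  proof
    fix x :: "real^2" assume x: "x \<in> cball 0 (r * (t + s + u))"
    define y where "y = x /\<^sub>R (t + s + u)"
    have "norm y \<le> r" using x t by (simp add: y_def field_simps)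
    hence "y \<in> A" "y \<in> B" "y \<in> C" using a b c by auto
    moreover have "x = (t + s + u) *\<^sub>R y" using t by (simp add: y_def)
    hence "x = t *\<^sub>R y + s *\<^sub>R y + u *\<^sub>R y" by (simp add: scaleR_add_left)
    ultimately show "x \<in> ?K" by (auto simp: set_plus_def)
  qed
  show "?K \<subseteq> cball 0 (\<rho> * (t + s + u))"
  proof
    fix x assume "x \<in> ?K"
    then obtain p q w where x: "x = t *\<^sub>R p + s *\<^sub>R q + u *\<^sub>R w" "p \<in> A" "q \<in> B" "w \<in> C"
      by (auto simp: set_plus_def)
    hence n: "norm p \<le> \<rho>" "norm q \<le> \<rho>" "norm w \<le> \<rho>" using a b c by auto
    have "norm x \<le> norm (t *\<^sub>R p) + norm (s *\<^sub>R q) + norm (u *\<^sub>R w)"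
      unfolding x by (meson add_right_mono norm_triangle_ineq order_trans)
    also have "\<dots> \<le> t * \<rho> + s * \<rho> + u * \<rho>" using n t by (auto intro!: add_mono mult_left_mono)
    finally show "x \<in> cball 0 (\<rho> * (t + s + u))" by (simp add: algebra_simps)
  qed
qed

lemma supp_combination:
  assumes A: "round_body r \<rho> A" and B: "round_body r \<rho> B" and C: "round_body r \<rho> C"
    and t: "0 \<le> t" "0 \<le> s" "0 \<le> u"
  shows "supp ((*\<^sub>R) t ` A + (*\<^sub>R) s ` B + (*\<^sub>R) u ` C) n = t * supp A n + s * supp B n + u * supp C n"
proof -
  note a = round_bodyD[OF A] and b = round_bodyD[OF B] and c = round_bodyD[OF C]
  have n: "(*\<^sub>R) t ` A \<noteq> {}" "(*\<^sub>R) s ` B \<noteq> {}" "(*\<^sub>R) u ` C \<noteq> {}" using a b c by auto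
  hence n': "(*\<^sub>R) t ` A + (*\<^sub>R) s ` B \<noteq> {}" by (fastforce simp: set_plus_def)
  show ?thesis
    using a b c n n' t by (simp add: supp_set_plus supp_scale_set compact_set_plus compact_scaling)
qed

context
  fixes r \<rho> :: real and K :: "(real^2) set"
  assumes K: "round_body r \<rho> K"
begin

lemma supp_upper: "supp K n \<le> \<rho> * norm n"
proof (rule supp_le)
  fix x assume "x \<in> K"
  hence "norm x \<le> \<rho>" using round_bodyD[OF K] by auto
  thus "x \<bullet> n \<le> \<rho> * norm n"
    using norm_cauchy_schwarz[of x n] by (meson mult_right_mono norm_ge_zero order_trans)
qed (use round_bodyD[OF K] in auto)

lemma supp_lower: "r * norm n \<le> supp K n"
proof (cases "n = 0")
  case False
  have "(r / norm n) *\<^sub>R n \<in> cball 0 r" using round_bodyD(1)[OF K] False by simp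
  hence "(r / norm n) *\<^sub>R n \<in> K" using round_bodyD(4)[OF K] by blast
  from supp_ge[OF round_bodyD(2)[OF K] this, of n] show ?thesis
    using False by (simp add: dot_square_norm power2_eq_square)
next
  case True
  thus ?thesis using supp_ge[OF round_bodyD(2)[OF K] round_bodyD(7)[OF K], of n] by simp
qed

lemma supp_lip: "\<bar>supp K n - supp K m\<bar> \<le> \<rho> * norm (n - m)"
proof -
  have *: "supp K n \<le> supp K m + \<rho> * norm (n - m)" for n m
  proof -
    obtain x where x: "x \<in> K" "x \<bullet> n = supp K n" using supp_attained round_bodyD[OF K] by blast
    have "norm x \<le> \<rho>" using x round_bodyD[OF K] by auto
    hence "x \<bullet> (n - m) \<le> \<rho> * norm (n - m)"
      using norm_cauchy_schwarz[of x "n - m"] by (meson mult_right_mono norm_ge_zero order_trans)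
    thus ?thesis using x supp_ge[OF round_bodyD(2)[OF K] x(1), of m] by (simp add: inner_diff_right)
  qed
  show ?thesis using *[of n m] *[of m n] by (auto simp: abs_le_iff norm_minus_commute)
qed

end

section \<open>Radial functions and their duality with support functions\<close>

definition rad :: "(real^2) set \<Rightarrow> real^2 \<Rightarrow> real" where
  "rad K e = Sup {l. 0 \<le> l \<and> l *\<^sub>R e \<in> K}"

context
  fixes r \<rho> :: real and K :: "(real^2) set" and e :: "real^2"
  assumes K: "round_body r \<rho> K" and e: "norm e = 1"
begin

private lemma ray: "{l. 0 \<le> l \<and> l *\<^sub>R e \<in> K} \<subseteq> {0..\<rho>}" "r \<in> {l. 0 \<le> l \<and> l *\<^sub>R e \<in> K}"
  using round_bodyD[OF K] e by (force simp: subset_iff)+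

lemma rad_bounds: "r \<le> rad K e" "rad K e \<le> \<rho>"
proof -
  show "r \<le> rad K e" unfolding rad_def
    by (rule cSup_upper[OF ray(2)]) (use ray(1) in \<open>auto intro!: bdd_aboveI[of _ \<rho>]\<close>)
  show "rad K e \<le> \<rho>" unfolding rad_def
    by (rule cSup_least) (use ray in auto)
qed

lemma rad_pos: "0 < rad K e" using rad_bounds round_bodyD[OF K] by simp

lemma rad_mem: "rad K e *\<^sub>R e \<in> K"
proof -
  have "closed {l. 0 \<le> l \<and> l *\<^sub>R e \<in> K}"
  proof -
    have "{l. 0 \<le> l \<and> l *\<^sub>R e \<in> K} = {0..} \<inter> (\<lambda>l. l *\<^sub>R e) -` K" by auto
    moreover have "closed ((\<lambda>l. l *\<^sub>R e) -` K)"
      by (intro closed_vimage compact_imp_closed round_bodyD(2)[OF K] continuous_intros)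
    ultimately show ?thesis by (simp add: closed_Int)
  qed
  hence "Sup {l. 0 \<le> l \<and> l *\<^sub>R e \<in> K} \<in> {l. 0 \<le> l \<and> l *\<^sub>R e \<in> K}"
    by (rule closed_contains_Sup[rotated 2]) (use ray in \<open>auto intro!: bdd_aboveI[of _ \<rho>]\<close>)
  thus ?thesis by (simp add: rad_def)
qed

lemma mem_iff_le_rad:
  assumes "0 \<le> l" shows "l *\<^sub>R e \<in> K \<longleftrightarrow> l \<le> rad K e"
proof
  assume "l *\<^sub>R e \<in> K"
  thus "l \<le> rad K e" unfolding rad_def
    by (intro cSup_upper) (use ray(1) assms in \<open>auto intro!: bdd_aboveI[of _ \<rho>]\<close>)
next
  assume le: "l \<le> rad K e"
  have "(l / rad K e) *\<^sub>R (rad K e *\<^sub>R e) + (1 - l / rad K e) *\<^sub>R 0 \<in> K"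
    using le rad_pos assms rad_mem round_bodyD[OF K] by (intro convexD) auto
  thus "l *\<^sub>R e \<in> K" using rad_pos by simp
qed

lemma rad_frontier: "rad K e *\<^sub>R e \<in> frontier K"
proof -
  have "rad K e *\<^sub>R e \<notin> interior K"
  proof
    assume "rad K e *\<^sub>R e \<in> interior K"
    then obtain d where d: "d > 0" "cball (rad K e *\<^sub>R e) d \<subseteq> K" by (auto simp: mem_interior_cball)
    have "(rad K e + d) *\<^sub>R e \<in> cball (rad K e *\<^sub>R e) d"
      using d e by (simp add: dist_norm scaleR_add_left)
    hence "(rad K e + d) *\<^sub>R e \<in> K" using d by blast
    hence "rad K e + d \<le> rad K e" using d mem_iff_le_rad[of "rad K e + d"] rad_pos by auto
    thus False using d by simp
  qed
  thus ?thesis using rad_mem round_bodyD[OF K] by (simp add: frontier_def closure_closed compact_imp_closed)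
qed

lemma rad_le_supp: "rad K e \<le> supp K (dual_point e \<tau>)"
  using supp_ge[OF round_bodyD(2)[OF K] rad_mem, of "dual_point e \<tau>"] e by simp

text \<open>Since the body contains a ball of radius r, a supporting normal at the boundary point
  cannot be nearly orthogonal to the ray: r |\<tau>| \<le> supp = rad \<le> \<rho>.\<close>

lemma abs_le_if_supp_eq_rad:
  assumes eq: "supp K (dual_point e \<tau>) = rad K e"
  shows "\<bar>\<tau>\<bar> \<le> \<rho> / r"
proof -
  have "r * \<bar>\<tau>\<bar> \<le> r * norm (dual_point e \<tau>)"
    using abs_le_norm_dual_point[OF e] round_bodyD[OF K] by (intro mult_left_mono) auto
  also have "\<dots> \<le> \<rho>" using supp_lower[OF K, of "dual_point e \<tau>"] eq rad_bounds by simp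
  finally show ?thesis using round_bodyD[OF K] by (simp add: field_simps)
qed

text \<open>Take a supporting line at the boundary point on the ray. Its outer normal has positive
  product with \<open>e\<close> because the origin is interior, so it can be scaled to some
  \<open>dual_point e \<tau>\<close>. With \<open>rad_le_supp\<close> this exhibits
  \<open>rad\<close> as a minimum of support values.\<close>

lemma rad_eq_supp: "\<exists>\<tau>. \<bar>\<tau>\<bar> \<le> \<rho> / r \<and> rad K e = supp K (dual_point e \<tau>)"
proof -
  define p where "p = rad K e *\<^sub>R e"
  have "p \<notin> interior K" using rad_frontier by (simp add: p_def frontier_def)
  moreover have int: "interior K \<noteq> {}"
    using round_bodyD[OF K] mem_interior_cball[of 0 K] by auto
  hence "rel_interior K = interior K" by (rule rel_interior_nonempty_interior)
  ultimately have "p \<in> closure K" "p \<notin> rel_interior K"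
    using rad_mem closure_subset by (auto simp: p_def)
  then obtain n where n: "\<And>y. y \<in> closure K \<Longrightarrow> n \<bullet> p \<le> n \<bullet> y" "\<And>y. y \<in> rel_interior K \<Longrightarrow> n \<bullet> p < n \<bullet> y"
    using supporting_hyperplane_relative_frontier[OF round_bodyD(3)[OF K], of p] by metis
  define v where "v = - n"
  have "0 \<in> rel_interior K"
    using round_bodyD[OF K] mem_interior_cball[of 0 K] \<open>rel_interior K = interior K\<close> by auto
  from n(2)[OF this] have "v \<bullet> p > 0" by (simp add: v_def)
  hence ve: "v \<bullet> e > 0" using rad_pos by (simp add: p_def zero_less_mult_iff)
  define \<tau> where "\<tau> = (v \<bullet> perp e) / (v \<bullet> e)"
  have v: "v = (v \<bullet> e) *\<^sub>R dual_point e \<tau>" unfolding \<tau>_def by (rule scaled_dual_point[OF e ve])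
  have "y \<bullet> dual_point e \<tau> \<le> p \<bullet> dual_point e \<tau>" if "y \<in> K" for y
  proof -
    have "v \<bullet> y \<le> v \<bullet> p" using n(1)[of y] closure_subset that by (auto simp: v_def)
    hence "(v \<bullet> e) * (y \<bullet> dual_point e \<tau>) \<le> (v \<bullet> e) * (p \<bullet> dual_point e \<tau>)"
      by (subst (asm) (1 2) v) (simp add: inner_commute)
    thus ?thesis using ve by simp
  qed
  hence "supp K (dual_point e \<tau>) = p \<bullet> dual_point e \<tau>"
    using rad_mem by (intro supp_eqI[OF round_bodyD(2)[OF K]]) (auto simp: p_def)
  hence eq: "rad K e = supp K (dual_point e \<tau>)" using e by (simp add: p_def)
  thus ?thesis using abs_le_if_supp_eq_rad by metis
qed

end

text \<open>The optimal \<tau> for one direction is a competitor for the other, and it is bounded by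
  \<rho> / r.\<close>

lemma rad_lip:
  assumes K: "round_body r \<rho> K" and "norm e = 1" "norm f = 1"
  shows "\<bar>rad K e - rad K f\<bar> \<le> \<rho> * (1 + \<rho> / r) * norm (e - f)"
proof -
  have *: "rad K e \<le> rad K f + \<rho> * (1 + \<rho> / r) * norm (e - f)" if ef: "norm e = 1" "norm f = 1" for e f
  proof -
    obtain \<tau> where \<tau>: "\<bar>\<tau>\<bar> \<le> \<rho> / r" "rad K f = supp K (dual_point f \<tau>)"
      using rad_eq_supp[OF K ef(2)] by blast
    have "rad K e \<le> supp K (dual_point e \<tau>)" by (rule rad_le_supp[OF K ef(1)])
    also have "\<dots> \<le> rad K f + \<rho> * norm (dual_point e \<tau> - dual_point f \<tau>)"
      using supp_lip[OF K, of "dual_point e \<tau>" "dual_point f \<tau>"] \<tau>(2) by linarith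
    also have "\<rho> * norm (dual_point e \<tau> - dual_point f \<tau>) \<le> \<rho> * ((1 + \<rho> / r) * norm (e - f))"
    proof (rule mult_left_mono)
      have "(1 + \<bar>\<tau>\<bar>) * norm (e - f) \<le> (1 + \<rho> / r) * norm (e - f)" using \<tau> by (intro mult_right_mono) auto
      thus "norm (dual_point e \<tau> - dual_point f \<tau>) \<le> (1 + \<rho> / r) * norm (e - f)"
        using dist_dual_point[of e \<tau> f] by linarith
      show "0 \<le> \<rho>" using round_bodyD[OF K] by simp
    qed
    finally show ?thesis by (simp add: mult.assoc)
  qed
  show ?thesis using *[of e f] *[of f e] assms by (auto simp: abs_le_iff norm_minus_commute)
qed

section \<open>Gauge and inner ratio through radial functions\<close>

lemma gauge_ray:
  assumes L: "round_body r \<rho> L" and e: "norm e = 1" and l: "0 \<le> l"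
  shows "gauge L (l *\<^sub>R e) = l / rad L e"
proof (cases "l = 0")
  case True
  have "{k. 0 \<le> k \<and> l *\<^sub>R e \<in> (*\<^sub>R) k ` L} = {0..}"
    using True round_bodyD(7)[OF L] by (auto simp: image_iff intro!: bexI[of _ 0])
  thus ?thesis using True by (simp add: gauge_def)
next
  case False
  have rp: "rad L e > 0" by (rule rad_pos[OF L e])
  have "{k. 0 \<le> k \<and> l *\<^sub>R e \<in> (*\<^sub>R) k ` L} = {l / rad L e..}"
  proof (intro equalityI subsetI)
    fix k assume "k \<in> {k. 0 \<le> k \<and> l *\<^sub>R e \<in> (*\<^sub>R) k ` L}"
    then obtain y where y: "0 \<le> k" "y \<in> L" "l *\<^sub>R e = k *\<^sub>R y" by auto
    have "k \<noteq> 0" using y(3) False e by auto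
    hence k: "k > 0" using y by simp
    have "(l / k) *\<^sub>R e = inverse k *\<^sub>R (l *\<^sub>R e)" by (simp add: divide_inverse mult.commute)
    also have "\<dots> = y" using k by (simp add: y(3))
    finally have "(l / k) *\<^sub>R e = y" .
    hence "l / k \<le> rad L e" using mem_iff_le_rad[OF L e, of "l / k"] y k l by simp
    thus "k \<in> {l / rad L e..}" using k rp by (simp add: field_simps)
  next
    fix k assume "k \<in> {l / rad L e..}"
    hence k: "l / rad L e \<le> k" by simp
    have "l / rad L e > 0" using False l rp by simp
    hence kp: "k > 0" using k by linarith
    have "l / k \<le> rad L e" using k kp rp by (simp add: field_simps)
    hence "(l / k) *\<^sub>R e \<in> L" using mem_iff_le_rad[OF L e, of "l / k"] l kp by simp
    moreover have "l *\<^sub>R e = k *\<^sub>R (l / k) *\<^sub>R e" using kp by simp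
    ultimately have "l *\<^sub>R e \<in> (*\<^sub>R) k ` L" by (rule image_eqI[rotated])
    thus "k \<in> {k. 0 \<le> k \<and> l *\<^sub>R e \<in> (*\<^sub>R) k ` L}" using kp by auto
  qed
  thus ?thesis by (simp add: gauge_def)
qed

lemma gauge_nonneg:
  assumes L: "round_body r \<rho> L" shows "0 \<le> gauge L x"
proof (cases "x = 0")
  case True
  thus ?thesis using gauge_ray[OF L, of "axis 1 1" 0] by simp
next
  case False
  have "norm (x /\<^sub>R norm x) = 1" using False by simp
  from gauge_ray[OF L this, of "norm x"] rad_pos[OF L this] show ?thesis using False by simp
qed

text \<open>The sublevel sets are the compact dilates of \<open>L\<close>, which for c = 0 is the
  origin alone, and they are empty for c < 0.\<close>

lemma gauge_measurable:
  assumes L: "round_body r \<rho> L"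
  shows "gauge L \<in> borel_measurable borel"
proof (rule borel_measurable_iff_le[THEN iffD2], rule)
  fix c :: real
  have "{x. gauge L x \<le> c} = (if c < 0 then {} else (*\<^sub>R) c ` L)"
  proof (cases "c < 0")
    case True
    thus ?thesis using gauge_nonneg[OF L] by (auto simp: not_le intro: less_le_trans)
  next
    case False
    have "gauge L x \<le> c \<longleftrightarrow> x \<in> (*\<^sub>R) c ` L" for x
    proof (cases "x = 0")
      case True
      have "gauge L x = 0" using gauge_ray[OF L, of "axis 1 1" 0] True by simp
      moreover have "x \<in> (*\<^sub>R) c ` L" using True round_bodyD(7)[OF L] by force
      ultimately show ?thesis using False by simp
    next
      case x: False
      define e where "e = x /\<^sub>R norm x"
      have e: "norm e = 1" "x = norm x *\<^sub>R e" using x by (auto simp: e_def)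
      have rp: "rad L e > 0" by (rule rad_pos[OF L e(1)])
      have g: "gauge L x = norm x / rad L e" using gauge_ray[OF L e(1), of "norm x"] e(2) by simp
      show ?thesis
      proof (cases "c = 0")
        case True
        thus ?thesis using g rp x by (auto simp: divide_le_0_iff)
      next
        case c: False
        hence c: "c > 0" using False by simp
        have "x \<in> (*\<^sub>R) c ` L \<longleftrightarrow> (norm x / c) *\<^sub>R e \<in> L"
        proof
          assume "x \<in> (*\<^sub>R) c ` L"
          then obtain y where "y \<in> L" "x = c *\<^sub>R y" by auto
          moreover from this have "(norm x / c) *\<^sub>R e = y"
            using c e(2) by (metis divide_inverse_commute scaleR_scaleR left_inverse less_irrefl scaleR_one)
          ultimately show "(norm x / c) *\<^sub>R e \<in> L" by simp
        next
          assume "(norm x / c) *\<^sub>R e \<in> L"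
          moreover have "x = c *\<^sub>R (norm x / c) *\<^sub>R e" using c x by (simp add: e_def)
          ultimately show "x \<in> (*\<^sub>R) c ` L" by blast
        qed
        also have "\<dots> \<longleftrightarrow> norm x / c \<le> rad L e" using mem_iff_le_rad[OF L e(1), of "norm x / c"] c by simp
        also have "\<dots> \<longleftrightarrow> gauge L x \<le> c" unfolding g using c rp by (simp add: field_simps)
        finally show ?thesis by simp
      qed
    qed
    thus ?thesis using False by auto
  qed
  moreover have "(*\<^sub>R) c ` L \<in> sets borel"
    by (intro borel_compact compact_scaling round_bodyD(2)[OF L])
  ultimately show "{x \<in> space borel. gauge L x \<le> c} \<in> sets borel" by auto
qed

text \<open>A dilate of \<open>L\<close> by R lies in \<open>A\<close> iff R \<le> rad A / rad L on
  every ray, so the greatest R is a minimum over the unit circle. Its location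
  \<open>e\<^sub>0\<close> is kept because the lower bound in the asymptotics integrates over
  directions near it.\<close>

lemma inner_ratio_eq:
  assumes A: "round_body r \<rho> A" and L: "round_body r \<rho> L"
  obtains e\<^sub>0 where "norm e\<^sub>0 = 1" "inner_ratio A L = rad A e\<^sub>0 / rad L e\<^sub>0"
    "\<And>e. norm e = 1 \<Longrightarrow> inner_ratio A L \<le> rad A e / rad L e"
proof -
  have cont: "continuous_on (sphere 0 1) (rad K)" if K: "round_body r \<rho> K" for K
  proof (rule lipschitz_on_continuous_on)
    show "(\<rho> * (1 + \<rho> / r))-lipschitz_on (sphere 0 1) (rad K)"
    proof (rule lipschitz_onI)
      show "0 \<le> \<rho> * (1 + \<rho> / r)" using round_bodyD(1,8)[OF K] by simp
      show "dist (rad K e) (rad K f) \<le> \<rho> * (1 + \<rho> / r) * dist e f" if "e \<in> sphere 0 1" "f \<in> sphere 0 1" for e f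
        using rad_lip[OF K, of e f] that by (simp add: dist_norm)
    qed
  qed
  have "compact (sphere (0::real^2) 1)" by (rule compact_sphere)
  moreover have "sphere (0::real^2) 1 \<noteq> {}" by simp
  moreover have "continuous_on (sphere 0 1) (\<lambda>e. rad A e / rad L e)"
  proof (rule continuous_on_divide[OF cont[OF A] cont[OF L]], rule ballI)
    fix e :: "real^2" assume "e \<in> sphere 0 1"
    thus "rad L e \<noteq> 0" using rad_pos[OF L, of e] by simp
  qed
  ultimately obtain e\<^sub>0 where e0: "e\<^sub>0 \<in> sphere 0 1" "\<And>e. e \<in> sphere 0 1 \<Longrightarrow> rad A e\<^sub>0 / rad L e\<^sub>0 \<le> rad A e / rad L e"
    using continuous_attains_inf[of "sphere 0 1" "\<lambda>e. rad A e / rad L e"] by metis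
  have sub: "(*\<^sub>R) R ` L \<subseteq> A \<longleftrightarrow> (\<forall>e. norm e = 1 \<longrightarrow> R \<le> rad A e / rad L e)" if R: "0 < R" for R
  proof
    assume sub: "(*\<^sub>R) R ` L \<subseteq> A"
    show "\<forall>e. norm e = 1 \<longrightarrow> R \<le> rad A e / rad L e"
    proof (intro allI impI)
      fix e :: "real^2" assume e: "norm e = 1"
      have "R *\<^sub>R (rad L e *\<^sub>R e) \<in> A" using sub rad_mem[OF L e] by blast
      hence "(R * rad L e) *\<^sub>R e \<in> A" by simp
      thus "R \<le> rad A e / rad L e" 
        using mem_iff_le_rad[OF A e, of "R * rad L e"] rad_pos[OF L e] R by (simp add: le_divide_eq)
    qed
  next
    assume all: "\<forall>e. norm e = 1 \<longrightarrow> R \<le> rad A e / rad L e"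
    show "(*\<^sub>R) R ` L \<subseteq> A"
    proof safe
      fix x assume x: "x \<in> L"
      show "R *\<^sub>R x \<in> A"
      proof (cases "x = 0")
        case False
        define e where "e = x /\<^sub>R norm x"
        have e: "norm e = 1" "x = norm x *\<^sub>R e" using False by (auto simp: e_def)
        have "norm x \<le> rad L e" using mem_iff_le_rad[OF L e(1), of "norm x"] e(2)[symmetric] x by simp
        hence "R * norm x \<le> R * rad L e" using R by simp
        also have "\<dots> \<le> rad A e" using all[rule_format, OF e(1)] rad_pos[OF L e(1)] by (simp add: le_divide_eq)
        finally have "(R * norm x) *\<^sub>R e \<in> A" using mem_iff_le_rad[OF A e(1), of "R * norm x"] R by simp
        also have "(R * norm x) *\<^sub>R e = R *\<^sub>R x" by (simp only: scaleR_scaleR[symmetric] e(2)[symmetric])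
        finally show ?thesis .
      qed (use round_bodyD(7)[OF A] in auto)
    qed
  qed
  have e0n: "norm e\<^sub>0 = 1" using e0(1) by simp
  have pos: "0 < rad A e\<^sub>0 / rad L e\<^sub>0"
    using rad_pos[OF A e0n] rad_pos[OF L e0n] by (rule divide_pos_pos)
  have min: "rad A e\<^sub>0 / rad L e\<^sub>0 \<le> rad A e / rad L e" if "norm e = 1" for e
    by (rule e0(2)) (simp add: that)
  have eq: "inner_ratio A L = rad A e\<^sub>0 / rad L e\<^sub>0" unfolding inner_ratio_def
  proof (rule Greatest_equality)
    show "0 < rad A e\<^sub>0 / rad L e\<^sub>0 \<and> (*\<^sub>R) (rad A e\<^sub>0 / rad L e\<^sub>0) ` L \<subseteq> A"
      using pos min sub[OF pos] by blast
    show "R \<le> rad A e\<^sub>0 / rad L e\<^sub>0" if "0 < R \<and> (*\<^sub>R) R ` L \<subseteq> A" for R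
      using that sub[of R] e0n by blast
  qed
  show ?thesis by (rule that[OF e0n eq]) (simp only: eq min)
qed

section \<open>Support function of a body of class \<open>C\<^sup>2\<^sub>+\<close>\<close>

text \<open>Two mean value estimates in a row; the factor 1/2 of Taylor's formula is given
  up.\<close>

lemma second_order_bound:
  fixes h h1 h2 :: "real \<Rightarrow> real"
  assumes h: "\<And>x. x \<in> closed_segment a b \<Longrightarrow> (h has_real_derivative h1 x) (at x)"
    and h1: "\<And>x. x \<in> closed_segment a b \<Longrightarrow> (h1 has_real_derivative h2 x) (at x)"
    and K: "\<And>x. x \<in> closed_segment a b \<Longrightarrow> \<bar>h2 x\<bar> \<le> K"
  shows "\<bar>h b - h a - h1 a * (b - a)\<bar> \<le> K * (b - a)\<^sup>2"
proof -
  let ?S = "closed_segment a b"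
  have K0: "K \<ge> 0" using K[of a] by (simp add: order_trans[OF abs_ge_zero])
  have 1: "\<bar>h1 x - h1 a\<bar> \<le> K * \<bar>b - a\<bar>" if x: "x \<in> ?S" for x
  proof -
    have "norm (h1 x - h1 a) \<le> K * norm (x - a)"
      by (rule field_differentiable_bound[of ?S h1 h2])
         (use x K in \<open>auto intro: has_field_derivative_at_within h1\<close>)
    also have "norm (x - a) \<le> norm (b - a)" using segment_bound1[OF x] by (simp add: norm_minus_commute)
    hence "K * norm (x - a) \<le> K * norm (b - a)" using K0 by (rule mult_left_mono)
    finally show ?thesis by simp
  qed
  have "norm ((h b - h1 a * b) - (h a - h1 a * a)) \<le> (K * \<bar>b - a\<bar>) * norm (b - a)"
    by (rule field_differentiable_bound[of ?S "\<lambda>x. h x - h1 a * x" "\<lambda>x. h1 x - h1 a"])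
       (use 1 in \<open>auto intro!: derivative_eq_intros has_field_derivative_at_within[OF h]\<close>)
  also have "\<dots> = K * (b - a)\<^sup>2" by (simp add: power2_eq_square mult.assoc flip: abs_mult)
  finally show ?thesis by (simp add: algebra_simps)
qed

lemma has_real_derivative_inner_left:
  fixes f :: "real \<Rightarrow> 'a :: real_inner"
  assumes "(f has_vector_derivative f') F"
  shows "((\<lambda>x. f x \<bullet> n) has_real_derivative f' \<bullet> n) F"
  using bounded_linear.has_vector_derivative[OF bounded_linear_inner_left assms, of n]
  by (simp add: has_real_derivative_iff_has_vector_derivative)

lemma cross2_perp: "cross2 u v = perp u \<bullet> v" "cross2 u v = - (u \<bullet> perp v)"
  by (simp_all add: cross2_def inner_real2)

lemma C2_plus_chart:
  assumes A: "round_body r \<rho> A" and C: "C2_plus A" and p: "p \<in> frontier A"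
  obtains U \<gamma> \<gamma>' \<gamma>'' \<delta> \<epsilon> s\<^sub>0 where "open U" "p \<in> U" "(0::real) < \<epsilon>" "\<bar>s\<^sub>0\<bar> < \<epsilon>" "\<gamma> s\<^sub>0 = p"
    "homeomorphism {-\<epsilon><..<\<epsilon>} (frontier A \<inter> U) \<gamma> \<delta>"
    "continuous_on {-\<epsilon><..<\<epsilon>} \<gamma>''"
    "\<And>s. \<bar>s\<bar> < \<epsilon> \<Longrightarrow> (\<gamma> has_vector_derivative \<gamma>' s) (at s)"
    "\<And>s. \<bar>s\<bar> < \<epsilon> \<Longrightarrow> (\<gamma>' has_vector_derivative \<gamma>'' s) (at s)"
    "\<And>s. \<bar>s\<bar> < \<epsilon> \<Longrightarrow> \<gamma>' s \<noteq> 0"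
    "\<And>s x. \<bar>s\<bar> < \<epsilon> \<Longrightarrow> x \<in> A \<Longrightarrow> 0 \<le> cross2 (\<gamma>' s) (x - \<gamma> s)"
    "\<And>s. \<bar>s\<bar> < \<epsilon> \<Longrightarrow> 0 < cross2 (\<gamma>' s) (\<gamma>'' s)"
    "\<And>s. \<bar>s\<bar> < \<epsilon> \<Longrightarrow> \<gamma> s \<in> A"
proof -
  have iv: "s \<in> {-\<epsilon><..<\<epsilon>} \<longleftrightarrow> \<bar>s\<bar> < \<epsilon>" for s \<epsilon> :: real by auto
  obtain U \<gamma> \<gamma>' \<gamma>'' \<delta> \<epsilon> where *: "open U" "p \<in> U" "0 < \<epsilon>"
       "homeomorphism {-\<epsilon><..<\<epsilon>} (frontier A \<inter> U) \<gamma> \<delta>"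
       "continuous_on {-\<epsilon><..<\<epsilon>} \<gamma>''"
       "\<And>s. s \<in> {-\<epsilon><..<\<epsilon>} \<Longrightarrow>
          (\<gamma> has_vector_derivative \<gamma>' s) (at s) \<and>
          (\<gamma>' has_vector_derivative \<gamma>'' s) (at s) \<and>
          \<gamma>' s \<noteq> 0 \<and>
          (\<forall>x\<in>A. 0 \<le> cross2 (\<gamma>' s) (x - \<gamma> s)) \<and>
          0 < plane_curvature (\<gamma>' s) (\<gamma>'' s)"
    using C p unfolding C2_plus_def by metis
  have im: "\<gamma> ` {-\<epsilon><..<\<epsilon>} = frontier A \<inter> U" using *(4) by (simp add: homeomorphism_def)
  have fA: "frontier A \<subseteq> A"
    using compact_imp_closed[OF round_bodyD(2)[OF A]] by (rule frontier_subset_closed)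
  have "p \<in> \<gamma> ` {-\<epsilon><..<\<epsilon>}" using im p *(2) by blast
  then obtain s\<^sub>0 where s0: "s\<^sub>0 \<in> {-\<epsilon><..<\<epsilon>}" "\<gamma> s\<^sub>0 = p" by blast
  have mem: "\<gamma> s \<in> A" if "\<bar>s\<bar> < \<epsilon>" for s
    using im fA iv that by (metis (no_types, lifting) IntD1 imageI subsetD)
  have cr: "0 < cross2 (\<gamma>' s) (\<gamma>'' s)" if "\<bar>s\<bar> < \<epsilon>" for s
    using *(6)[of s] that unfolding iv plane_curvature_def by (auto simp: zero_less_divide_iff)
  show ?thesis
    by (rule that[where \<gamma>' = \<gamma>', OF *(1-3) _ s0(2) *(4,5)]) (use *(6)[unfolded iv] s0(1)[unfolded iv] cr mem in auto)
qed

text \<open>Bounded curvature lets a disc of fixed size roll freely inside \<open>A\<close>; dually, the support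
  function grows at least quadratically away from the normal direction.\<close>

lemma supp_growth_local:
  assumes A: "round_body r \<rho> A" and C: "C2_plus A" and p: "p \<in> frontier A"
  shows "\<exists>V \<kappa>. open V \<and> p \<in> V \<and> 0 < \<kappa> \<and> (\<forall>e \<tau>\<^sub>0 \<tau>. norm e = 1 \<longrightarrow> rad A e *\<^sub>R e \<in> V \<longrightarrow>
     \<bar>\<tau>\<^sub>0\<bar> \<le> T \<longrightarrow> \<bar>\<tau>\<bar> \<le> T \<longrightarrow> rad A e = supp A (dual_point e \<tau>\<^sub>0) \<longrightarrow>
     rad A e + \<kappa> * (\<tau> - \<tau>\<^sub>0)\<^sup>2 \<le> supp A (dual_point e \<tau>))"
proof (cases "0 \<le> T")
  case T: True
  obtain U \<gamma> \<gamma>' \<gamma>'' \<delta> \<epsilon> s\<^sub>0 where U: "open U" "p \<in> U" and \<epsilon>: "(0::real) < \<epsilon>" "\<bar>s\<^sub>0\<bar> < \<epsilon>" "\<gamma> s\<^sub>0 = p"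
    and hom: "homeomorphism {-\<epsilon><..<\<epsilon>} (frontier A \<inter> U) \<gamma> \<delta>"
    and cont: "continuous_on {-\<epsilon><..<\<epsilon>} \<gamma>''"
    and d1: "\<And>s. \<bar>s\<bar> < \<epsilon> \<Longrightarrow> (\<gamma> has_vector_derivative \<gamma>' s) (at s)"
    and d2: "\<And>s. \<bar>s\<bar> < \<epsilon> \<Longrightarrow> (\<gamma>' has_vector_derivative \<gamma>'' s) (at s)"
    and nz: "\<And>s. \<bar>s\<bar> < \<epsilon> \<Longrightarrow> \<gamma>' s \<noteq> 0"
    and mem: "\<And>s. \<bar>s\<bar> < \<epsilon> \<Longrightarrow> \<gamma> s \<in> A"
    by (rule C2_plus_chart[OF A C p]) blast
  \<comment> \<open>A quarter of the distance from \<open>s\<^sub>0\<close> to the nearer end of the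
    chart: contact points stay within d of \<open>s\<^sub>0\<close>, test points within another d,
    and \<open>I\<close> is still a compact part of the chart.\<close>
  define d where "d = (\<epsilon> - \<bar>s\<^sub>0\<bar>) / 4"
  have d: "d > 0" using \<epsilon> by (simp add: d_def)
  define I where "I = {s\<^sub>0 - 2 * d..s\<^sub>0 + 2 * d}"
  have I: "\<bar>s\<bar> < \<epsilon>" if "s \<in> I" for s 
  proof -
    have "\<bar>s - s\<^sub>0\<bar> \<le> 2 * d" using that by (auto simp: I_def abs_le_iff)
    moreover have "4 * d = \<epsilon> - \<bar>s\<^sub>0\<bar>" by (simp add: d_def)
    ultimately show ?thesis using d by linarith
  qed
  have Isub: "I \<subseteq> {-\<epsilon><..<\<epsilon>}" using I by fastforce
  have cI: "compact I" "I \<noteq> {}" using d by (auto simp: I_def)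
  have cont1: "continuous_on I \<gamma>'"
    using d2 I by (intro continuous_at_imp_continuous_on ballI has_vector_derivative_continuous) blast
  obtain M1 where M1: "\<And>s. s \<in> I \<Longrightarrow> norm (\<gamma>' s) \<le> M1"
    using compact_imp_bounded[OF compact_continuous_image[OF cont1 cI(1)]] by (auto simp: bounded_iff)
  obtain M2 where M2: "\<And>s. s \<in> I \<Longrightarrow> norm (\<gamma>'' s) \<le> M2"
    using compact_imp_bounded[OF compact_continuous_image[OF continuous_on_subset[OF cont Isub] cI(1)]] by (auto simp: bounded_iff)
  define M where "M = max 1 (max M1 M2)"
  have M: "M \<ge> 1" "\<And>s. s \<in> I \<Longrightarrow> norm (\<gamma>' s) \<le> M" "\<And>s. s \<in> I \<Longrightarrow> norm (\<gamma>'' s) \<le> M"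
    using M1 M2 by (force simp: M_def)+
  obtain s\<^sub>m where sm: "s\<^sub>m \<in> I" "\<And>s. s \<in> I \<Longrightarrow> norm (\<gamma>' s\<^sub>m) \<le> norm (\<gamma>' s)"
    using continuous_attains_inf[OF cI continuous_on_norm[OF cont1]] by blast
  define m where "m = norm (\<gamma>' s\<^sub>m)"
  have m: "m > 0" "\<And>s. s \<in> I \<Longrightarrow> m \<le> norm (\<gamma>' s)" using sm nz I by (auto simp: m_def)
  have d0: "\<delta> p = s\<^sub>0" using hom \<epsilon> by (force simp: homeomorphism_def)
  have "continuous_on (frontier A \<inter> U) \<delta>" using hom by (simp add: homeomorphism_def)
  then obtain \<eta> where \<eta>: "\<eta> > 0" "\<And>q. q \<in> frontier A \<inter> U \<Longrightarrow> dist q p < \<eta> \<Longrightarrow> dist (\<delta> q) s\<^sub>0 < d"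
    using d U(2) p d0 unfolding continuous_on_iff by (metis IntI)
  define N where "N = 1 + T"
  \<comment> \<open>Scale of the step from the contact point to the test point. The first bound
    keeps the test point in the chart, since steps have length at most 2 T M \<zeta>; the second
    keeps the quadratic loss at most half of the linear gain.\<close>
  define \<zeta> where "\<zeta> = min (d / (2 * T * M + 1)) (1 / (2 * M * N))"
  have N: "N \<ge> 1" using T by (simp add: N_def)
  have den: "2 * T * M + 1 > 0" using T M by (intro add_nonneg_pos) auto
  have MN: "0 < 2 * M * N" using M(1) N by (intro mult_pos_pos) auto
  have \<zeta>: "\<zeta> > 0" "\<zeta> * (2 * T * M + 1) \<le> d" "\<zeta> * (2 * M * N) \<le> 1"
  proof -
    show "\<zeta> > 0" using d den MN by (simp add: \<zeta>_def)
    have "\<zeta> \<le> d / (2 * T * M + 1)" "\<zeta> \<le> 1 / (2 * M * N)" by (simp_all add: \<zeta>_def)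
    thus "\<zeta> * (2 * T * M + 1) \<le> d" "\<zeta> * (2 * M * N) \<le> 1" using den MN by (simp_all only: pos_le_divide_eq)
  qed
  define \<kappa> where "\<kappa> = \<zeta> / 2 * (m\<^sup>2 / (1 + T\<^sup>2))"
  have \<kappa>: "\<kappa> > 0" using \<zeta> m by (simp add: \<kappa>_def add_pos_nonneg)
  show ?thesis
  proof (intro exI[of _ "U \<inter> ball p \<eta>"] exI[of _ \<kappa>] conjI allI impI)
    show "open (U \<inter> ball p \<eta>)" "p \<in> U \<inter> ball p \<eta>" "0 < \<kappa>" using U \<eta> \<kappa> by auto
    fix e \<tau>\<^sub>0 \<tau>
    assume e: "norm e = 1" and q: "rad A e *\<^sub>R e \<in> U \<inter> ball p \<eta>"
      and \<tau>0: "\<bar>\<tau>\<^sub>0\<bar> \<le> T" and \<tau>: "\<bar>\<tau>\<bar> \<le> T" and eq: "rad A e = supp A (dual_point e \<tau>\<^sub>0)"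
    define q where "q = rad A e *\<^sub>R e"
    define s1 where "s1 = \<delta> q"
    have qf: "q \<in> frontier A \<inter> U" using q rad_frontier[OF A e] by (simp add: q_def)
    have s1: "\<gamma> s1 = q" using hom qf by (auto simp: homeomorphism_def s1_def)
    have ds1: "\<bar>s1 - s\<^sub>0\<bar> < d" using \<eta>(2)[OF qf] q by (simp add: s1_def q_def dist_commute dist_real_def)
    have near: "s \<in> I" if "\<bar>s - s1\<bar> \<le> d" for s using that ds1 by (auto simp: I_def)
    have s1I: "s1 \<in> I" using near d by simp
    let ?m = "dual_point e \<tau>\<^sub>0" and ?n = "dual_point e \<tau>"
    have qn: "q \<bullet> dual_point e t = rad A e" for t using e by (simp add: q_def)
    define w where "w = \<gamma>' s1 \<bullet> perp e"
    \<comment> \<open>The contact point maximizes the product with its normal along the curve, so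
      the velocity there is orthogonal to that normal.\<close>
    have orth: "\<gamma>' s1 \<bullet> ?m = 0"
    proof (rule DERIV_local_max[of "\<lambda>s. \<gamma> s \<bullet> ?m" _ s1 d])
      show "((\<lambda>s. \<gamma> s \<bullet> ?m) has_real_derivative \<gamma>' s1 \<bullet> ?m) (at s1)"
        by (rule has_real_derivative_inner_left[OF d1[OF I[OF s1I]]])
      show "\<forall>y. \<bar>s1 - y\<bar> < d \<longrightarrow> \<gamma> y \<bullet> ?m \<le> \<gamma> s1 \<bullet> ?m"
      proof (intro allI impI)
        fix y assume "\<bar>s1 - y\<bar> < d"
        hence "\<gamma> y \<in> A" by (intro mem I near) simp
        thus "\<gamma> y \<bullet> ?m \<le> \<gamma> s1 \<bullet> ?m" using supp_ge[OF round_bodyD(2)[OF A]] s1 qn eq by metis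
      qed
    qed (rule d)
    \<comment> \<open>The velocity has norm at least m and is orthogonal to a normal of slope at
      most T, so it cannot be nearly parallel to \<open>e\<close>.\<close>
    have w2: "w\<^sup>2 \<ge> m\<^sup>2 / (1 + T\<^sup>2)"
    proof -
      have a: "\<gamma>' s1 \<bullet> e = - \<tau>\<^sub>0 * w" using orth by (simp add: inner_dual_point w_def)
      have "(norm (\<gamma>' s1))\<^sup>2 = \<gamma>' s1 \<bullet> \<gamma>' s1" by (simp add: power2_norm_eq_inner)
      also have "\<dots> = (\<gamma>' s1 \<bullet> e) * (e \<bullet> \<gamma>' s1) + w * (perp e \<bullet> \<gamma>' s1)"
        using arg_cong[OF orthonormal_decomposition[OF e, of "\<gamma>' s1"], of "\<lambda>v. v \<bullet> \<gamma>' s1"]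
        by (simp add: inner_add_left w_def)
      also have "\<dots> = (\<gamma>' s1 \<bullet> e)\<^sup>2 + w\<^sup>2" by (simp add: power2_eq_square inner_commute w_def)
      also have "\<dots> = (1 + \<tau>\<^sub>0\<^sup>2) * w\<^sup>2" unfolding a by (simp add: power2_eq_square algebra_simps)
      also have "\<dots> \<le> (1 + T\<^sup>2) * w\<^sup>2" using power_mono[OF \<tau>0, of 2] by (intro mult_right_mono) auto
      finally have "m\<^sup>2 \<le> (1 + T\<^sup>2) * w\<^sup>2" 
        using power_mono[OF m(2)[OF s1I] less_imp_le[OF m(1)], of 2] by (rule order_trans[rotated])
      moreover have "1 + T\<^sup>2 > 0" by (simp add: add_pos_nonneg)
      ultimately show ?thesis by (simp add: pos_divide_le_eq mult.commute)
    qed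
    have wM: "\<bar>w\<bar> \<le> M"
      using Cauchy_Schwarz_ineq2[of "\<gamma>' s1" "perp e"] M(2)[OF s1I] e by (simp add: w_def)
    \<comment> \<open>The test point. Along the curve, the product with the tilted normal
      \<open>?n\<close> starts with slope \<open>(\<tau> - \<tau>\<^sub>0) * w\<close>; the step is
      \<zeta> times this slope, as in gradient ascent.\<close>
    define s where "s = s1 + \<zeta> * ((\<tau> - \<tau>\<^sub>0) * w)"
    have sd: "\<bar>s - s1\<bar> \<le> d"
    proof -
      have "\<bar>\<tau> - \<tau>\<^sub>0\<bar> * \<bar>w\<bar> \<le> (2 * T) * M" using \<tau> \<tau>0 wM T by (intro mult_mono) auto
      hence "\<zeta> * (\<bar>\<tau> - \<tau>\<^sub>0\<bar> * \<bar>w\<bar>) \<le> \<zeta> * (2 * T * M + 1)" using \<zeta> by (intro mult_left_mono) auto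
      hence "\<zeta> * (\<bar>\<tau> - \<tau>\<^sub>0\<bar> * \<bar>w\<bar>) \<le> d" using \<zeta>(2) by (rule order_trans)
      thus ?thesis using \<zeta>(1) by (simp add: s_def abs_mult)
    qed
    have seg: "x \<in> I" if "x \<in> closed_segment s1 s" for x
      using segment_bound1[OF that] sd by (intro near) simp
    have nN: "norm ?n \<le> N"
    proof -
      have "norm ?n \<le> norm e + norm (\<tau> *\<^sub>R perp e)" unfolding dual_point_def by (rule norm_triangle_ineq)
      thus ?thesis using e \<tau> by (simp add: N_def)
    qed
    have "\<bar>\<gamma> s \<bullet> ?n - \<gamma> s1 \<bullet> ?n - (\<gamma>' s1 \<bullet> ?n) * (s - s1)\<bar> \<le> (M * N) * (s - s1)\<^sup>2"
    proof (rule second_order_bound[of s1 s "\<lambda>s. \<gamma> s \<bullet> ?n" "\<lambda>s. \<gamma>' s \<bullet> ?n" "\<lambda>s. \<gamma>'' s \<bullet> ?n"])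
      fix x assume x: "x \<in> closed_segment s1 s"
      show "((\<lambda>s. \<gamma> s \<bullet> ?n) has_real_derivative \<gamma>' x \<bullet> ?n) (at x)"
        "((\<lambda>s. \<gamma>' s \<bullet> ?n) has_real_derivative \<gamma>'' x \<bullet> ?n) (at x)"
        by (intro has_real_derivative_inner_left d1 d2 I seg x)+
      have "\<bar>\<gamma>'' x \<bullet> ?n\<bar> \<le> norm (\<gamma>'' x) * norm ?n" by (rule Cauchy_Schwarz_ineq2)
      also have "\<dots> \<le> M * N" using M(3)[OF seg[OF x]] nN M(1) by (intro mult_mono) auto
      finally show "\<bar>\<gamma>'' x \<bullet> ?n\<bar> \<le> M * N" .
    qed
    moreover have "\<gamma>' s1 \<bullet> ?n = (\<tau> - \<tau>\<^sub>0) * w"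
      using orth by (simp add: inner_dual_point w_def algebra_simps)
    hence "(\<gamma>' s1 \<bullet> ?n) * (s - s1) = (\<tau> - \<tau>\<^sub>0) * w * (s - s1)" by (simp only:)
    moreover have "\<gamma> s \<bullet> ?n \<le> supp A ?n"
      by (rule supp_ge[OF round_bodyD(2)[OF A] mem[OF I[OF near[OF sd]]]])
    moreover have "\<gamma> s1 \<bullet> ?n = rad A e" using s1 qn by simp
    ultimately have "supp A ?n - rad A e \<ge> (\<tau> - \<tau>\<^sub>0) * w * (s - s1) - (M * N) * (s - s1)\<^sup>2" by linarith
    also have "(\<tau> - \<tau>\<^sub>0) * w * (s - s1) - (M * N) * (s - s1)\<^sup>2 = \<zeta> * (1 - \<zeta> * (M * N)) * w\<^sup>2 * (\<tau> - \<tau>\<^sub>0)\<^sup>2"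
      by (simp add: s_def power2_eq_square algebra_simps)
    finally have "supp A ?n - rad A e \<ge> \<zeta> * (1 - \<zeta> * (M * N)) * w\<^sup>2 * (\<tau> - \<tau>\<^sub>0)\<^sup>2" .
    moreover have "\<kappa> * (\<tau> - \<tau>\<^sub>0)\<^sup>2 \<le> \<zeta> * (1 - \<zeta> * (M * N)) * w\<^sup>2 * (\<tau> - \<tau>\<^sub>0)\<^sup>2"
      unfolding \<kappa>_def
    proof (intro mult_right_mono mult_mono)
      have "1 / 2 \<le> 1 - \<zeta> * (M * N)" using \<zeta>(3) by (simp add: mult_ac)
      hence "\<zeta> * (1 / 2) \<le> \<zeta> * (1 - \<zeta> * (M * N))" using \<zeta>(1) by (intro mult_left_mono) auto
      thus "\<zeta> / 2 \<le> \<zeta> * (1 - \<zeta> * (M * N))" "0 \<le> \<zeta> * (1 - \<zeta> * (M * N))" using \<zeta>(1) by auto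
    qed (use w2 in auto)
    ultimately show "rad A e + \<kappa> * (\<tau> - \<tau>\<^sub>0)\<^sup>2 \<le> supp A (dual_point e \<tau>)" by linarith
  qed
next
  case False
  thus ?thesis by (intro exI[of _ UNIV] exI[of _ 1]) auto
qed

lemma supp_growth:
  assumes A: "round_body r \<rho> A" and C: "C2_plus A"
  obtains \<kappa> where "0 < \<kappa>" "\<And>e \<tau>\<^sub>0 \<tau>. norm e = 1 \<Longrightarrow>
     \<bar>\<tau>\<^sub>0\<bar> \<le> T \<Longrightarrow> \<bar>\<tau>\<bar> \<le> T \<Longrightarrow> rad A e = supp A (dual_point e \<tau>\<^sub>0) \<Longrightarrow>
     rad A e + \<kappa> * (\<tau> - \<tau>\<^sub>0)\<^sup>2 \<le> supp A (dual_point e \<tau>)"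
proof -
  have "\<forall>p\<in>frontier A. \<exists>V \<kappa>. open V \<and> p \<in> V \<and> 0 < \<kappa> \<and> (\<forall>e \<tau>\<^sub>0 \<tau>. norm e = 1 \<longrightarrow> rad A e *\<^sub>R e \<in> V \<longrightarrow>
     \<bar>\<tau>\<^sub>0\<bar> \<le> T \<longrightarrow> \<bar>\<tau>\<bar> \<le> T \<longrightarrow> rad A e = supp A (dual_point e \<tau>\<^sub>0) \<longrightarrow>
     rad A e + \<kappa> * (\<tau> - \<tau>\<^sub>0)\<^sup>2 \<le> supp A (dual_point e \<tau>))"
    using supp_growth_local[OF A C] by blast
  then obtain V \<kappa> where V: "\<And>p. p \<in> frontier A \<Longrightarrow> open (V p) \<and> p \<in> V p \<and> 0 < \<kappa> p" and
    gr: "\<And>p e \<tau>\<^sub>0 \<tau>. p \<in> frontier A \<Longrightarrow> norm e = 1 \<Longrightarrow> rad A e *\<^sub>R e \<in> V p \<Longrightarrow>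
     \<bar>\<tau>\<^sub>0\<bar> \<le> T \<Longrightarrow> \<bar>\<tau>\<bar> \<le> T \<Longrightarrow> rad A e = supp A (dual_point e \<tau>\<^sub>0) \<Longrightarrow>
     rad A e + \<kappa> p * (\<tau> - \<tau>\<^sub>0)\<^sup>2 \<le> supp A (dual_point e \<tau>)"
    unfolding bchoice_iff by metis
  have "compact (frontier A)" by (rule compact_frontier[OF round_bodyD(2)[OF A]])
  then obtain F where F: "F \<subseteq> frontier A" "finite F" "frontier A \<subseteq> (\<Union>p\<in>F. V p)"
    by (rule compactE_image[of _ "frontier A" V]) (use V in auto)
  define k where "k = Min (insert 1 (\<kappa> ` F))"
  have k: "0 < k" "\<And>p. p \<in> F \<Longrightarrow> k \<le> \<kappa> p"
    using F(1,2) V by (auto simp: k_def subset_iff)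
  show ?thesis
  proof (rule that[OF k(1)])
    fix e \<tau>\<^sub>0 \<tau> assume *: "norm e = 1" "\<bar>\<tau>\<^sub>0\<bar> \<le> T" "\<bar>\<tau>\<bar> \<le> T" "rad A e = supp A (dual_point e \<tau>\<^sub>0)"
    obtain p where p: "p \<in> F" "rad A e *\<^sub>R e \<in> V p" using rad_frontier[OF A *(1)] F(3) by blast
    have "k * (\<tau> - \<tau>\<^sub>0)\<^sup>2 \<le> \<kappa> p * (\<tau> - \<tau>\<^sub>0)\<^sup>2" using k(2)[OF p(1)] by (intro mult_right_mono) auto
    thus "rad A e + k * (\<tau> - \<tau>\<^sub>0)\<^sup>2 \<le> supp A (dual_point e \<tau>)"
      using gr[OF _ *(1) p(2) *(2-4)] p(1) F(1) by force
  qed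
qed

text \<open>The chart also parametrizes the normals. The outer normal \<nu> is orthogonal to
  \<gamma>', so the excess (\<gamma> - p) \<bullet> \<nu> has derivative (\<gamma> - p) \<bullet>
  \<nu>' and is therefore quadratic at the contact point, with coefficient k / 2. The slope of the
  normal moves with velocity \<open>t1\<close>, which is positive because the curvature is. Dividing
  the one by the square of the other yields the expansion in the slope.\<close>

lemma supp_expansion:
  assumes A: "round_body r \<rho> A" and C: "C2_plus A" and e: "norm e = 1"
  obtains \<tau>\<^sub>0 a\<^sub>2 where "0 < a\<^sub>2" "supp A (dual_point e \<tau>\<^sub>0) = rad A e"
    "((\<lambda>\<tau>. (supp A (dual_point e \<tau>) - supp A (dual_point e \<tau>\<^sub>0)) / (\<tau> - \<tau>\<^sub>0)\<^sup>2) \<longlongrightarrow> a\<^sub>2 / 2) (at \<tau>\<^sub>0)"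
proof -
  define p where "p = rad A e *\<^sub>R e"
  obtain U \<gamma> \<gamma>' \<gamma>'' \<delta> \<epsilon> s\<^sub>0 where \<epsilon>: "(0::real) < \<epsilon>" "\<bar>s\<^sub>0\<bar> < \<epsilon>" "\<gamma> s\<^sub>0 = p"
    and cont: "continuous_on {-\<epsilon><..<\<epsilon>} \<gamma>''"
    and d1: "\<And>s. \<bar>s\<bar> < \<epsilon> \<Longrightarrow> (\<gamma> has_vector_derivative \<gamma>' s) (at s)"
    and d2: "\<And>s. \<bar>s\<bar> < \<epsilon> \<Longrightarrow> (\<gamma>' has_vector_derivative \<gamma>'' s) (at s)"
    and nz: "\<And>s. \<bar>s\<bar> < \<epsilon> \<Longrightarrow> \<gamma>' s \<noteq> 0"
    and left: "\<And>s x. \<bar>s\<bar> < \<epsilon> \<Longrightarrow> x \<in> A \<Longrightarrow> 0 \<le> cross2 (\<gamma>' s) (x - \<gamma> s)"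
    and curv: "\<And>s. \<bar>s\<bar> < \<epsilon> \<Longrightarrow> 0 < cross2 (\<gamma>' s) (\<gamma>'' s)"
    and mem: "\<And>s. \<bar>s\<bar> < \<epsilon> \<Longrightarrow> \<gamma> s \<in> A"
    by (rule C2_plus_chart[OF A C rad_frontier[OF A e]]) (unfold p_def, blast)
  define \<nu> where "\<nu> s = - perp (\<gamma>' s)" for s
  define \<nu>' where "\<nu>' s = - perp (\<gamma>'' s)" for s
  have blp: "bounded_linear perp"
    by (rule linear_conv_bounded_linear[THEN iffD1], rule linearI) (simp_all add: vec_eq_iff forall_2)
  have d\<nu>: "(\<nu> has_vector_derivative \<nu>' s) (at s)" if "\<bar>s\<bar> < \<epsilon>" for s
    unfolding \<nu>_def[abs_def] \<nu>'_def
    by (intro has_vector_derivative_minus bounded_linear.has_vector_derivative[OF blp] d2 that)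
  have supp\<nu>: "supp A (\<nu> s) = \<gamma> s \<bullet> \<nu> s" if s: "\<bar>s\<bar> < \<epsilon>" for s
  proof (rule supp_eqI[OF round_bodyD(2)[OF A] mem[OF s]])
    fix x assume "x \<in> A"
    from left[OF s this] show "x \<bullet> \<nu> s \<le> \<gamma> s \<bullet> \<nu> s"
      by (simp add: cross2_perp(1) \<nu>_def inner_diff_right inner_commute)
  qed
  \<comment> \<open>The support value is positive because the origin is interior; hence the normal
    has positive product with \<open>e\<close> and its slope is defined.\<close>
  have "0 < r * norm (\<nu> s\<^sub>0)" using nz[OF \<epsilon>(2)] round_bodyD(1)[OF A] by (simp add: \<nu>_def)
  also have "\<dots> \<le> p \<bullet> \<nu> s\<^sub>0" using supp_lower[OF A, of "\<nu> s\<^sub>0"] supp\<nu>[OF \<epsilon>(2)] \<epsilon>(3) by simp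
  finally have c0: "0 < \<nu> s\<^sub>0 \<bullet> e" using rad_pos[OF A e] by (simp add: p_def zero_less_mult_iff inner_commute)
  have tcont: "isCont (\<lambda>s. \<nu> s \<bullet> e) s" "isCont (\<lambda>s. \<nu> s \<bullet> perp e) s" "isCont \<nu> s" if "\<bar>s\<bar> < \<epsilon>" for s
    using has_vector_derivative_continuous[OF d\<nu>[OF that]] by (auto intro!: continuous_intros)
  have "\<forall>\<^sub>F s in at s\<^sub>0. 0 < \<nu> s \<bullet> e"
    using tcont(1)[OF \<epsilon>(2)] c0 unfolding isCont_def by (rule order_tendstoD(1))
  moreover have "\<forall>\<^sub>F s in at s\<^sub>0. \<bar>s\<bar> < \<epsilon>"
    by (rule order_tendstoD(2)[of _ "\<bar>s\<^sub>0\<bar>"]) (use \<epsilon> in \<open>auto intro!: tendsto_intros\<close>)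
  ultimately have "\<forall>\<^sub>F s in at s\<^sub>0. 0 < \<nu> s \<bullet> e \<and> \<bar>s\<bar> < \<epsilon>" by eventually_elim auto
  then obtain d where d: "d > 0" and near': "\<And>s. s \<noteq> s\<^sub>0 \<Longrightarrow> dist s s\<^sub>0 < d \<Longrightarrow> 0 < \<nu> s \<bullet> e \<and> \<bar>s\<bar> < \<epsilon>"
    unfolding eventually_at by auto
  have near: "0 < \<nu> s \<bullet> e" "\<bar>s\<bar> < \<epsilon>" if "\<bar>s - s\<^sub>0\<bar> < d" for s
    using near'[of s] that c0 \<epsilon> by (cases "s = s\<^sub>0"; simp add: dist_real_def)+
  define \<tau> where "\<tau> s = (\<nu> s \<bullet> perp e) / (\<nu> s \<bullet> e)" for s
  define k where "k = cross2 (\<gamma>' s\<^sub>0) (\<gamma>'' s\<^sub>0)"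
  define t1 where "t1 = k / (\<nu> s\<^sub>0 \<bullet> e)\<^sup>2"
  have k: "k > 0" using curv[OF \<epsilon>(2)] by (simp add: k_def)
  have t1: "t1 > 0" using k c0 by (simp add: t1_def)
  have dual: "\<nu> s = (\<nu> s \<bullet> e) *\<^sub>R dual_point e (\<tau> s)" if "\<bar>s - s\<^sub>0\<bar> < d" for s
    unfolding \<tau>_def by (rule scaled_dual_point[OF e near(1)[OF that]])
  have supp\<tau>: "supp A (dual_point e (\<tau> s)) - rad A e = ((\<gamma> s - p) \<bullet> \<nu> s) / (\<nu> s \<bullet> e)" if s: "\<bar>s - s\<^sub>0\<bar> < d" for s
  proof -
    have pos: "0 < \<nu> s \<bullet> e" by (rule near(1)[OF s])
    have "(\<nu> s \<bullet> e) * supp A (dual_point e (\<tau> s)) = supp A ((\<nu> s \<bullet> e) *\<^sub>R dual_point e (\<tau> s))"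
      using pos supp_scale_arg[OF round_bodyD(2,6)[OF A], of "\<nu> s \<bullet> e" "dual_point e (\<tau> s)"] by simp
    also have "\<dots> = \<gamma> s \<bullet> \<nu> s" using dual[OF s] supp\<nu>[OF near(2)[OF s]] by simp
    finally have "supp A (dual_point e (\<tau> s)) = (\<gamma> s \<bullet> \<nu> s) / (\<nu> s \<bullet> e)" using pos by (simp add: eq_divide_eq mult.commute)
    moreover have "p \<bullet> \<nu> s = rad A e * (\<nu> s \<bullet> e)" by (simp add: p_def inner_commute)
    ultimately show ?thesis using pos by (simp add: inner_diff_left diff_divide_distrib)
  qed
  have cts_\<tau>: "isCont \<tau> s" if "\<bar>s - s\<^sub>0\<bar> < d" for s
    unfolding \<tau>_def[abs_def] using near[OF that] tcont by (auto intro!: continuous_intros)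
  have d\<tau>: "(\<tau> has_real_derivative t1) (at s\<^sub>0)"
  proof -
    have "(\<tau> has_real_derivative ((\<nu>' s\<^sub>0 \<bullet> perp e) * (\<nu> s\<^sub>0 \<bullet> e) - (\<nu> s\<^sub>0 \<bullet> perp e) * (\<nu>' s\<^sub>0 \<bullet> e)) / ((\<nu> s\<^sub>0 \<bullet> e) * (\<nu> s\<^sub>0 \<bullet> e))) (at s\<^sub>0)"
      unfolding \<tau>_def[abs_def]
      by (rule DERIV_divide) (use c0 has_real_derivative_inner_left[OF d\<nu>[OF \<epsilon>(2)]] in auto)
    \<comment> \<open>Lagrange's identity: this is the cross product of \<nu> and \<nu>' times
      |e|^2, and the rotation by \<open>perp\<close> preserves cross products.\<close>
    also have "(\<nu>' s\<^sub>0 \<bullet> perp e) * (\<nu> s\<^sub>0 \<bullet> e) - (\<nu> s\<^sub>0 \<bullet> perp e) * (\<nu>' s\<^sub>0 \<bullet> e)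
      = k * (e \<bullet> e)"
      by (simp add: k_def cross2_def \<nu>_def \<nu>'_def inner_real2 algebra_simps)
    finally show ?thesis using e by (simp add: t1_def power2_eq_square dot_square_norm)
  qed
  have m_lim: "((\<lambda>s. ((\<gamma> s - p) \<bullet> \<nu> s) / (s - s\<^sub>0)\<^sup>2) \<longlongrightarrow> k / 2) (at s\<^sub>0)"
  proof (rule lhopital)
    have cg: "isCont \<gamma> s\<^sub>0" by (rule has_vector_derivative_continuous[OF d1[OF \<epsilon>(2)]])
    have "isCont (\<lambda>s. (\<gamma> s - p) \<bullet> \<nu> s) s\<^sub>0" by (intro continuous_intros cg tcont \<epsilon>)
    thus "((\<lambda>s. (\<gamma> s - p) \<bullet> \<nu> s) \<longlongrightarrow> 0) (at s\<^sub>0)" using \<epsilon>(3) by (simp add: isCont_def)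
    show "((\<lambda>s. (s - s\<^sub>0)\<^sup>2) \<longlongrightarrow> 0) (at s\<^sub>0)" by (auto intro!: tendsto_eq_intros)
    have ne: "\<forall>\<^sub>F s in at s\<^sub>0. s \<noteq> s\<^sub>0" by (rule eventually_neq_at_within)
    have ev: "\<forall>\<^sub>F s in at s\<^sub>0. \<bar>s\<bar> < \<epsilon>"
      by (rule order_tendstoD(2)[of _ "\<bar>s\<^sub>0\<bar>"]) (use \<epsilon> in \<open>auto intro!: tendsto_intros\<close>)
    show "\<forall>\<^sub>F s in at s\<^sub>0. (s - s\<^sub>0)\<^sup>2 \<noteq> 0" "\<forall>\<^sub>F s in at s\<^sub>0. 2 * (s - s\<^sub>0) \<noteq> 0"
      using ne by (auto elim!: eventually_mono)
    show "\<forall>\<^sub>F s in at s\<^sub>0. ((\<lambda>s. (s - s\<^sub>0)\<^sup>2) has_real_derivative 2 * (s - s\<^sub>0)) (at s)"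
      by (auto intro!: always_eventually derivative_eq_intros)
    show "\<forall>\<^sub>F s in at s\<^sub>0. ((\<lambda>s. (\<gamma> s - p) \<bullet> \<nu> s) has_real_derivative (\<gamma> s - p) \<bullet> \<nu>' s) (at s)"
      using ev
    proof eventually_elim
      case (elim s)
      have "((\<lambda>s. (\<gamma> s - p) \<bullet> \<nu> s) has_vector_derivative (\<gamma> s - p) \<bullet> \<nu>' s + (\<gamma>' s - 0) \<bullet> \<nu> s) (at s)"
        by (rule bounded_bilinear.has_vector_derivative[OF bounded_bilinear_inner])
           (intro has_vector_derivative_diff d1 has_vector_derivative_const d\<nu> elim)+
      moreover have "\<gamma>' s \<bullet> \<nu> s = 0" by (simp add: \<nu>_def)
      ultimately show ?case by (simp add: has_real_derivative_iff_has_vector_derivative)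
    qed
    have gl: "((\<lambda>s. (\<gamma> s - p) /\<^sub>R (s - s\<^sub>0)) \<longlongrightarrow> \<gamma>' s\<^sub>0) (at s\<^sub>0)"
    proof -
      have "((\<lambda>s. norm (\<gamma> s - \<gamma> s\<^sub>0 - (s - s\<^sub>0) *\<^sub>R \<gamma>' s\<^sub>0) / norm (s - s\<^sub>0)) \<longlongrightarrow> 0) (at s\<^sub>0)"
        using d1[OF \<epsilon>(2)] unfolding has_vector_derivative_def has_derivative_iff_norm by simp
      moreover have "\<forall>\<^sub>F s in at s\<^sub>0. norm (\<gamma> s - \<gamma> s\<^sub>0 - (s - s\<^sub>0) *\<^sub>R \<gamma>' s\<^sub>0) / norm (s - s\<^sub>0)
          = norm ((\<gamma> s - p) /\<^sub>R (s - s\<^sub>0) - \<gamma>' s\<^sub>0)"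
        using ne
      proof eventually_elim
        case (elim s)
        have "(\<gamma> s - p) /\<^sub>R (s - s\<^sub>0) - \<gamma>' s\<^sub>0 = (\<gamma> s - \<gamma> s\<^sub>0 - (s - s\<^sub>0) *\<^sub>R \<gamma>' s\<^sub>0) /\<^sub>R (s - s\<^sub>0)"
          using elim \<epsilon>(3) by (simp add: scaleR_diff_right)
        thus ?case by (simp add: divide_inverse_commute)
      qed
      ultimately have "((\<lambda>s. norm ((\<gamma> s - p) /\<^sub>R (s - s\<^sub>0) - \<gamma>' s\<^sub>0)) \<longlongrightarrow> 0) (at s\<^sub>0)"
        by (rule Lim_transform_eventually)
      thus ?thesis using Lim_null tendsto_norm_zero_iff by blast
    qed
    have g2: "(\<gamma>'' \<longlongrightarrow> \<gamma>'' s\<^sub>0) (at s\<^sub>0)"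
      using cont \<epsilon>(2) by (simp add: continuous_on_eq_continuous_at isCont_def abs_less_iff)
    have g3: "(\<nu>' \<longlongrightarrow> \<nu>' s\<^sub>0) (at s\<^sub>0)" unfolding \<nu>'_def[abs_def]
      by (intro tendsto_minus bounded_linear.tendsto[OF blp] g2)
    have "((\<lambda>s. (((\<gamma> s - p) /\<^sub>R (s - s\<^sub>0)) \<bullet> \<nu>' s) / 2) \<longlongrightarrow> (\<gamma>' s\<^sub>0 \<bullet> \<nu>' s\<^sub>0) / 2) (at s\<^sub>0)"
      by (intro tendsto_intros gl g3) auto
    also have "\<gamma>' s\<^sub>0 \<bullet> \<nu>' s\<^sub>0 = k" by (simp add: k_def cross2_perp(2) \<nu>'_def)
    also have "(\<lambda>s. (((\<gamma> s - p) /\<^sub>R (s - s\<^sub>0)) \<bullet> \<nu>' s) / 2) = (\<lambda>s. ((\<gamma> s - p) \<bullet> \<nu>' s) / (2 * (s - s\<^sub>0)))"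
      by (auto simp: fun_eq_iff divide_simps)
    finally show "((\<lambda>s. ((\<gamma> s - p) \<bullet> \<nu>' s) / (2 * (s - s\<^sub>0))) \<longlongrightarrow> k / 2) (at s\<^sub>0)" .
  qed
  define l where "l = (k / 2) / (\<nu> s\<^sub>0 \<bullet> e) / t1\<^sup>2"
  have l: "l > 0" using k c0 t1 by (simp add: l_def)
  have eq0: "supp A (dual_point e (\<tau> s\<^sub>0)) = rad A e" using supp\<tau>[of s\<^sub>0] d \<epsilon>(3) by simp
  let ?q = "\<lambda>t. (supp A (dual_point e t) - supp A (dual_point e (\<tau> s\<^sub>0))) / (t - \<tau> s\<^sub>0)\<^sup>2"
  have qlim: "((\<lambda>s. ?q (\<tau> s)) \<longlongrightarrow> l) (at s\<^sub>0)"
  proof (rule Lim_transform_eventually)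
    have "((\<lambda>s. (\<tau> s - \<tau> s\<^sub>0) / (s - s\<^sub>0)) \<longlongrightarrow> t1) (at s\<^sub>0)" using d\<tau> by (simp add: has_field_derivative_iff)
    moreover have "((\<lambda>s. \<nu> s \<bullet> e) \<longlongrightarrow> \<nu> s\<^sub>0 \<bullet> e) (at s\<^sub>0)" using tcont(1)[OF \<epsilon>(2)] by (simp add: isCont_def)
    ultimately show "((\<lambda>s. (((\<gamma> s - p) \<bullet> \<nu> s) / (s - s\<^sub>0)\<^sup>2) / (\<nu> s \<bullet> e) / ((\<tau> s - \<tau> s\<^sub>0) / (s - s\<^sub>0))\<^sup>2) \<longlongrightarrow> l) (at s\<^sub>0)"
      unfolding l_def by (intro tendsto_divide[OF tendsto_divide[OF m_lim]] tendsto_power) (use c0 t1 in auto)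
    have "\<forall>\<^sub>F s in at s\<^sub>0. s \<noteq> s\<^sub>0 \<and> dist s s\<^sub>0 < d" using d by (auto simp: eventually_at)
    thus "\<forall>\<^sub>F s in at s\<^sub>0. (((\<gamma> s - p) \<bullet> \<nu> s) / (s - s\<^sub>0)\<^sup>2) / (\<nu> s \<bullet> e) / ((\<tau> s - \<tau> s\<^sub>0) / (s - s\<^sub>0))\<^sup>2 = ?q (\<tau> s)"
    proof eventually_elim
      case (elim s)
      hence "supp A (dual_point e (\<tau> s)) - supp A (dual_point e (\<tau> s\<^sub>0)) = ((\<gamma> s - p) \<bullet> \<nu> s) / (\<nu> s \<bullet> e)"
        unfolding eq0 by (intro supp\<tau>) (simp add: dist_real_def)
      thus ?case using elim by (simp add: power_divide)
    qed
  qed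
  \<comment> \<open>Passage from the parameter to the slope. \<open>\<tau>\<close> is not inverted:
    it is continuous near \<open>s\<^sub>0\<close> and has positive derivative there, so the
    intermediate value theorem provides, for every slope t near \<open>\<tau> s\<^sub>0\<close>,
    some s near \<open>s\<^sub>0\<close> with \<open>\<tau> s = t\<close>.\<close>
  have "(?q \<longlongrightarrow> l) (at (\<tau> s\<^sub>0))"
  proof (rule tendstoI)
    fix \<eta> :: real assume "0 < \<eta>"
    from tendstoD[OF qlim this] obtain d' where d': "d' > 0" "\<And>s. s \<noteq> s\<^sub>0 \<Longrightarrow> dist s s\<^sub>0 < d' \<Longrightarrow> dist (?q (\<tau> s)) l < \<eta>"
      unfolding eventually_at by auto
    obtain dr where dr: "dr > 0" "\<And>h. 0 < h \<Longrightarrow> h < dr \<Longrightarrow> \<tau> s\<^sub>0 < \<tau> (s\<^sub>0 + h)" using DERIV_pos_inc_right[OF d\<tau> t1] by blast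
    obtain dl where dl: "dl > 0" "\<And>h. 0 < h \<Longrightarrow> h < dl \<Longrightarrow> \<tau> (s\<^sub>0 - h) < \<tau> s\<^sub>0" using DERIV_pos_inc_left[OF d\<tau> t1] by blast
    define h where "h = min (min dr dl) (min d d') / 2"
    have h: "0 < h" "h < dr" "h < dl" "h < d" "h < d'" using dr dl d d' by (auto simp: h_def)
    have lr: "\<tau> (s\<^sub>0 - h) < \<tau> s\<^sub>0" "\<tau> s\<^sub>0 < \<tau> (s\<^sub>0 + h)" using dr dl h by auto
    have "\<forall>\<^sub>F t in at (\<tau> s\<^sub>0). t \<in> {\<tau> (s\<^sub>0 - h)<..<\<tau> (s\<^sub>0 + h)}"
      by (rule eventually_at_in_open') (use lr in auto)
    moreover have "\<forall>\<^sub>F t in at (\<tau> s\<^sub>0). t \<noteq> \<tau> s\<^sub>0" by (rule eventually_neq_at_within)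
    ultimately show "\<forall>\<^sub>F t in at (\<tau> s\<^sub>0). dist (?q t) l < \<eta>"
    proof eventually_elim
      case (elim t)
      have "\<exists>s\<ge>s\<^sub>0 - h. s \<le> s\<^sub>0 + h \<and> \<tau> s = t"
        by (rule IVT) (use elim h in \<open>auto intro!: cts_\<tau>\<close>)
      then obtain s where s: "s\<^sub>0 - h \<le> s" "s \<le> s\<^sub>0 + h" "\<tau> s = t" by blast
      have "s \<noteq> s\<^sub>0" using s elim by auto
      thus ?case using d'(2)[of s] s h by (auto simp: dist_real_def)
    qed
  qed
  thus ?thesis using that[of "2 * l" "\<tau> s\<^sub>0"] l eq0 by simp
qed

section \<open>Normals with a unique contact point\<close>

definition regular_normal :: "(real^2) set \<Rightarrow> real^2 \<Rightarrow> bool" where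
  "regular_normal K n \<longleftrightarrow> (\<forall>x\<in>K. \<forall>y\<in>K. x \<bullet> n = supp K n \<longrightarrow> y \<bullet> n = supp K n \<longrightarrow> x = y)"

text \<open>If the contact point x is unique, compactness forces the contact points y of nearby
  normals to be close to x. The difference quotient of the support function lies between
  \<open>x \<bullet> perp e\<close> and \<open>y \<bullet> perp e\<close>.\<close>

lemma supp_has_derivative:
  assumes K: "round_body r \<rho> K" and e: "norm e = 1" and reg: "regular_normal K (dual_point e \<tau>\<^sub>0)"
  shows "\<exists>b\<^sub>1. ((\<lambda>\<tau>. supp K (dual_point e \<tau>)) has_real_derivative b\<^sub>1) (at \<tau>\<^sub>0)"
proof -
  let ?h = "\<lambda>\<tau>. supp K (dual_point e \<tau>)"
  note k = round_bodyD[OF K]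
  obtain x where x: "x \<in> K" "x \<bullet> dual_point e \<tau>\<^sub>0 = ?h \<tau>\<^sub>0" using supp_attained[OF k(2,6)] by blast
  have shift: "z \<bullet> dual_point e \<tau> = z \<bullet> dual_point e \<tau>\<^sub>0 + (\<tau> - \<tau>\<^sub>0) * (z \<bullet> perp e)" for z \<tau>
    by (simp add: inner_dual_point algebra_simps)
  have zb: "\<bar>z \<bullet> perp e\<bar> \<le> \<rho>" if "z \<in> K" for z
    using Cauchy_Schwarz_ineq2[of z "perp e"] that k(5) e by force
  have near: "\<exists>\<delta>>0. \<forall>\<tau> y. \<bar>\<tau> - \<tau>\<^sub>0\<bar> < \<delta> \<longrightarrow> y \<in> K \<longrightarrow> y \<bullet> dual_point e \<tau> = ?h \<tau> \<longrightarrow> dist y x < \<epsilon>" if \<epsilon>: "0 < \<epsilon>" for \<epsilon>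
  proof (cases "K - ball x \<epsilon> = {}")
    case True
    thus ?thesis by (intro exI[of _ 1]) (auto simp: dist_commute)
  next
    case False
    have "compact (K - ball x \<epsilon>)" by (intro compact_diff k open_ball)
    then obtain z where z: "z \<in> K - ball x \<epsilon>" "\<And>y. y \<in> K - ball x \<epsilon> \<Longrightarrow> y \<bullet> dual_point e \<tau>\<^sub>0 \<le> z \<bullet> dual_point e \<tau>\<^sub>0"
      using continuous_attains_sup[of "K - ball x \<epsilon>" "\<lambda>y. y \<bullet> dual_point e \<tau>\<^sub>0", OF _ False]
        continuous_on_inner[OF continuous_on_id continuous_on_const] by blast
    have "z \<noteq> x" using z(1) \<epsilon> by auto
    hence "z \<bullet> dual_point e \<tau>\<^sub>0 \<noteq> ?h \<tau>\<^sub>0" using reg x z(1) by (auto simp: regular_normal_def)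
    hence gap: "?h \<tau>\<^sub>0 - z \<bullet> dual_point e \<tau>\<^sub>0 > 0" using supp_ge[OF k(2), of z "dual_point e \<tau>\<^sub>0"] z(1) by auto
    \<comment> \<open>Changing the slope by less than \<delta> changes the product with any point of
      \<open>K\<close> by less than half the gap, too little for a point outside the ball to
      overtake x.\<close>
    define \<delta> where "\<delta> = (?h \<tau>\<^sub>0 - z \<bullet> dual_point e \<tau>\<^sub>0) / (2 * \<rho>)"
    have \<rho>: "\<rho> > 0" using k by linarith
    show ?thesis
    proof (intro exI[of _ \<delta>] conjI allI impI)
      show "\<delta> > 0" using gap \<rho> by (simp add: \<delta>_def)
      fix \<tau> y assume \<tau>: "\<bar>\<tau> - \<tau>\<^sub>0\<bar> < \<delta>" and y: "y \<in> K" "y \<bullet> dual_point e \<tau> = ?h \<tau>"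
      show "dist y x < \<epsilon>"
      proof (rule ccontr)
        assume "\<not> dist y x < \<epsilon>"
        hence "y \<in> K - ball x \<epsilon>" using y by (auto simp: dist_commute)
        note zy = z(2)[OF this]
        have mb: "\<bar>(\<tau> - \<tau>\<^sub>0) * (v \<bullet> perp e)\<bar> \<le> \<bar>\<tau> - \<tau>\<^sub>0\<bar> * \<rho>" if "v \<in> K" for v
          unfolding abs_mult by (rule mult_left_mono[OF zb[OF that]]) simp
        have "?h \<tau> \<le> z \<bullet> dual_point e \<tau>\<^sub>0 + \<bar>\<tau> - \<tau>\<^sub>0\<bar> * \<rho>"
          using shift[of y \<tau>] y(2) zy mb[OF y(1)] by linarith
        moreover have "?h \<tau> \<ge> ?h \<tau>\<^sub>0 - \<bar>\<tau> - \<tau>\<^sub>0\<bar> * \<rho>"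
          using shift[of x \<tau>] x supp_ge[OF k(2) x(1), of "dual_point e \<tau>"] mb[OF x(1)] by linarith
        moreover have "\<bar>\<tau> - \<tau>\<^sub>0\<bar> * (2 * \<rho>) < ?h \<tau>\<^sub>0 - z \<bullet> dual_point e \<tau>\<^sub>0"
          using \<tau> \<rho> by (simp add: \<delta>_def pos_less_divide_eq)
        ultimately show False by linarith
      qed
    qed
  qed
  have "((\<lambda>\<tau>. (?h \<tau> - ?h \<tau>\<^sub>0) / (\<tau> - \<tau>\<^sub>0)) \<longlongrightarrow> x \<bullet> perp e) (at \<tau>\<^sub>0)"
  proof (rule tendstoI)
    fix \<epsilon> :: real assume "0 < \<epsilon>"
    from near[OF this] obtain \<delta> where \<delta>: "\<delta> > 0"
      "\<And>\<tau> y. \<bar>\<tau> - \<tau>\<^sub>0\<bar> < \<delta> \<Longrightarrow> y \<in> K \<Longrightarrow> y \<bullet> dual_point e \<tau> = ?h \<tau> \<Longrightarrow> dist y x < \<epsilon>" by blast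
    have "dist ((?h \<tau> - ?h \<tau>\<^sub>0) / (\<tau> - \<tau>\<^sub>0)) (x \<bullet> perp e) < \<epsilon>" if \<tau>: "\<tau> \<noteq> \<tau>\<^sub>0" "\<bar>\<tau> - \<tau>\<^sub>0\<bar> < \<delta>" for \<tau>
    proof -
      obtain y where y: "y \<in> K" "y \<bullet> dual_point e \<tau> = ?h \<tau>" using supp_attained[OF k(2,6)] by blast
      have 1: "(\<tau> - \<tau>\<^sub>0) * (x \<bullet> perp e) \<le> ?h \<tau> - ?h \<tau>\<^sub>0"
        using shift[of x \<tau>] x supp_ge[OF k(2) x(1), of "dual_point e \<tau>"] by linarith
      have 2: "?h \<tau> - ?h \<tau>\<^sub>0 \<le> (\<tau> - \<tau>\<^sub>0) * (y \<bullet> perp e)"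
        using shift[of y \<tau>] y supp_ge[OF k(2) y(1), of "dual_point e \<tau>\<^sub>0"] by linarith
      have "\<bar>(?h \<tau> - ?h \<tau>\<^sub>0) - (\<tau> - \<tau>\<^sub>0) * (x \<bullet> perp e)\<bar> \<le> \<bar>(\<tau> - \<tau>\<^sub>0) * ((y - x) \<bullet> perp e)\<bar>"
        using 1 2 by (simp add: inner_diff_left right_diff_distrib)
      also have "\<dots> \<le> \<bar>\<tau> - \<tau>\<^sub>0\<bar> * dist y x"
        unfolding abs_mult using Cauchy_Schwarz_ineq2[of "y - x" "perp e"] e
        by (intro mult_left_mono) (auto simp: dist_norm)
      finally have "\<bar>(?h \<tau> - ?h \<tau>\<^sub>0) - (\<tau> - \<tau>\<^sub>0) * (x \<bullet> perp e)\<bar> / \<bar>\<tau> - \<tau>\<^sub>0\<bar> \<le> dist y x"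
        using \<tau> by (simp add: divide_le_eq mult.commute)
      also have "\<bar>(?h \<tau> - ?h \<tau>\<^sub>0) - (\<tau> - \<tau>\<^sub>0) * (x \<bullet> perp e)\<bar> / \<bar>\<tau> - \<tau>\<^sub>0\<bar> = \<bar>(?h \<tau> - ?h \<tau>\<^sub>0) / (\<tau> - \<tau>\<^sub>0) - x \<bullet> perp e\<bar>"
        unfolding abs_divide[symmetric] using \<tau> by (simp add: diff_divide_distrib)
      finally show ?thesis using \<delta>(2)[OF \<tau>(2) y] by (simp add: dist_real_def)
    qed
    thus "\<forall>\<^sub>F \<tau> in at \<tau>\<^sub>0. dist ((?h \<tau> - ?h \<tau>\<^sub>0) / (\<tau> - \<tau>\<^sub>0)) (x \<bullet> perp e) < \<epsilon>"
      unfolding eventually_at using \<delta>(1) by (auto simp: dist_real_def)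
  qed
  thus ?thesis by (auto simp: has_field_derivative_iff)
qed

text \<open>The faces with normals \<open>(c, \<sigma>)\<close> project to intervals on the second axis which are ordered
  as the \<open>\<sigma>\<close>, so that distinct edges can be labelled by distinct rationals.\<close>

lemma countable_irregular_slopes:
  assumes K: "round_body r \<rho> K" and c: "c \<noteq> 0"
  shows "countable {\<sigma>. \<not> regular_normal K (vector [c, \<sigma>])}" (is "countable ?D")
proof -
  let ?v = "\<lambda>\<sigma>. vector [c, \<sigma>] :: real^2"
  have inn: "x \<bullet> ?v \<sigma> = c * x$1 + \<sigma> * x$2" for x \<sigma> by (simp add: inner_real2)
  have "\<exists>x y q. x \<in> K \<and> y \<in> K \<and> x \<bullet> ?v \<sigma> = supp K (?v \<sigma>) \<and> y \<bullet> ?v \<sigma> = supp K (?v \<sigma>) \<and> q \<in> \<rat> \<and> x$2 < q \<and> q < y$2"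
    if "\<sigma> \<in> ?D" for \<sigma>
  proof -
    obtain x y where xy: "x \<in> K" "y \<in> K" "x \<bullet> ?v \<sigma> = supp K (?v \<sigma>)" "y \<bullet> ?v \<sigma> = supp K (?v \<sigma>)" "x \<noteq> y"
      using \<open>\<sigma> \<in> ?D\<close> by (auto simp: regular_normal_def)
    have "x$2 \<noteq> y$2"
    proof
      assume eq: "x$2 = y$2"
      hence "c * x$1 = c * y$1" using xy(3,4) unfolding inn eq by linarith
      hence "x$1 = y$1" using c by simp
      thus False using eq xy(5) by (simp add: vec_eq_iff forall_2)
    qed
    then consider "x$2 < y$2" | "y$2 < x$2" by linarith
    thus ?thesis using xy Rats_dense_in_real by cases metis+
  qed
  then obtain x y q where q: "\<And>\<sigma>. \<sigma> \<in> ?D \<Longrightarrow> x \<sigma> \<in> K \<and> y \<sigma> \<in> K \<and> x \<sigma> \<bullet> ?v \<sigma> = supp K (?v \<sigma>) \<and>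
     y \<sigma> \<bullet> ?v \<sigma> = supp K (?v \<sigma>) \<and> q \<sigma> \<in> \<rat> \<and> x \<sigma> $ 2 < q \<sigma> \<and> q \<sigma> < y \<sigma> $ 2" by metis
  have mono: "q \<sigma> < q \<sigma>'" if "\<sigma> \<in> ?D" "\<sigma>' \<in> ?D" "\<sigma> < \<sigma>'" for \<sigma> \<sigma>'
  proof -
    have "x \<sigma>' \<bullet> ?v \<sigma> \<le> y \<sigma> \<bullet> ?v \<sigma>" "y \<sigma> \<bullet> ?v \<sigma>' \<le> x \<sigma>' \<bullet> ?v \<sigma>'"
      using q[OF that(1)] q[OF that(2)] supp_ge[OF round_bodyD(2)[OF K]] by auto
    hence "0 \<le> (\<sigma>' - \<sigma>) * (x \<sigma>' $ 2 - y \<sigma> $ 2)" by (simp add: inn algebra_simps)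
    hence "y \<sigma> $ 2 \<le> x \<sigma>' $ 2" using that(3) by (simp add: zero_le_mult_iff)
    thus ?thesis using q[OF that(1)] q[OF that(2)] by linarith
  qed
  have "inj_on q ?D"
  proof (rule inj_onI)
    fix \<sigma> \<sigma>' assume "\<sigma> \<in> ?D" "\<sigma>' \<in> ?D" "q \<sigma> = q \<sigma>'"
    thus "\<sigma> = \<sigma>'" using mono[of \<sigma> \<sigma>'] mono[of \<sigma>' \<sigma>] by (cases \<sigma> \<sigma>' rule: linorder_cases) auto
  qed
  moreover have "countable (q ` ?D)" by (rule countable_subset[OF _ countable_rat]) (use q in auto)
  ultimately show ?thesis by (rule countable_image_inj_on[rotated])
qed

lemma regular_normal_scale:
  assumes K: "round_body r \<rho> K" and "c > 0" "regular_normal K n"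
  shows "regular_normal K (c *\<^sub>R n)"
  using assms(2,3) supp_scale_arg[OF round_bodyD(2,6)[OF K], of c n]
  by (auto simp: regular_normal_def)

text \<open>One representative of each ray from the origin. Apart from the two vertical ones, these
  have a fixed nonzero first coordinate, so that irregular rays are counted by their slopes.\<close>

definition directions :: "(real^2) set" where
  "directions = range (\<lambda>\<sigma>. vector [1, \<sigma>]) \<union> range (\<lambda>\<sigma>. vector [-1, \<sigma>]) \<union> {vector [0, 1], vector [0, -1]}"

lemma direction_exists:
  assumes "n \<noteq> (0::real^2)" shows "\<exists>c d. c > 0 \<and> d \<in> directions \<and> n = c *\<^sub>R d"
proof -
  have "n$1 \<noteq> 0 \<or> n$2 \<noteq> 0" using assms by (auto simp: vec_eq_iff forall_2)
  then consider "n$1 > 0" | "n$1 < 0" | "n$1 = 0" "n$2 > 0" | "n$1 = 0" "n$2 < 0" by linarith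
  thus ?thesis
  proof cases
    case 1
    thus ?thesis by (intro exI[of _ "n$1"] exI[of _ "vector [1, n$2 / n$1]"])
      (simp add: vec_eq_iff forall_2 directions_def)
  next
    case 2
    thus ?thesis by (intro exI[of _ "- (n$1)"] exI[of _ "vector [-1, n$2 / - (n$1)]"])
      (simp add: vec_eq_iff forall_2 directions_def)
  next
    case 3
    thus ?thesis by (intro exI[of _ "n$2"] exI[of _ "vector [0, 1]"])
      (simp add: vec_eq_iff forall_2 directions_def)
  next
    case 4
    thus ?thesis by (intro exI[of _ "- (n$2)"] exI[of _ "vector [0, -1]"])
      (simp add: vec_eq_iff forall_2 directions_def)
  qed
qed

lemma countable_irregular_directions:
  assumes K: "round_body r \<rho> K"
  shows "countable {d \<in> directions. \<not> regular_normal K d}"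
proof (rule countable_subset)
  show "{d \<in> directions. \<not> regular_normal K d} \<subseteq>
    (\<lambda>\<sigma>. vector [1, \<sigma>]) ` {\<sigma>. \<not> regular_normal K (vector [1, \<sigma>])} \<union>
    (\<lambda>\<sigma>. vector [-1, \<sigma>]) ` {\<sigma>. \<not> regular_normal K (vector [-1, \<sigma>])} \<union> {vector [0, 1], vector [0, -1]}"
    by (auto simp: directions_def)
qed (intro countable_Un countable_image countable_irregular_slopes[OF K], auto)

text \<open>For \<open>A\<close> of class \<open>C\<^sup>2\<^sub>+\<close>, \<open>dual_point e (foot A e)\<close> is the outer normal of \<open>A\<close> at the boundary
  point in direction \<open>e\<close>.\<close>

definition foot :: "(real^2) set \<Rightarrow> real^2 \<Rightarrow> real" where
  "foot A e = (THE \<tau>. supp A (dual_point e \<tau>) = rad A e)"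

context
  fixes A :: "(real^2) set" and r \<rho> :: real
  assumes A: "round_body r \<rho> A" and C2: "C2_plus A"
begin

text \<open>Uniqueness is the quadratic growth: two solutions \<sigma> and \<tau> give \<kappa>
  (\<sigma> - \<tau>)^2 \<le> 0.\<close>

lemma foot_eq_iff:
  assumes e: "norm e = 1" shows "supp A (dual_point e \<tau>) = rad A e \<longleftrightarrow> \<tau> = foot A e"
proof -
  obtain \<kappa> where \<kappa>: "0 < \<kappa>" "\<And>e \<tau>\<^sub>0 \<tau>. norm e = 1 \<Longrightarrow>
     \<bar>\<tau>\<^sub>0\<bar> \<le> \<rho> / r \<Longrightarrow> \<bar>\<tau>\<bar> \<le> \<rho> / r \<Longrightarrow> rad A e = supp A (dual_point e \<tau>\<^sub>0) \<Longrightarrow>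
     rad A e + \<kappa> * (\<tau> - \<tau>\<^sub>0)\<^sup>2 \<le> supp A (dual_point e \<tau>)"
    by (rule supp_growth[OF A C2, of "\<rho> / r"]) blast
  have uniq: "\<sigma> = \<tau>" if "supp A (dual_point e \<sigma>) = rad A e" "supp A (dual_point e \<tau>) = rad A e" for \<sigma> \<tau>
  proof -
    have "rad A e + \<kappa> * (\<sigma> - \<tau>)\<^sup>2 \<le> supp A (dual_point e \<sigma>)"
      by (rule \<kappa>(2)[OF e abs_le_if_supp_eq_rad[OF A e that(2)] abs_le_if_supp_eq_rad[OF A e that(1)] that(2)[symmetric]])
    hence "\<kappa> * (\<sigma> - \<tau>)\<^sup>2 \<le> 0" using that(1) by linarith
    thus ?thesis using \<kappa>(1) by (simp add: mult_le_0_iff)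
  qed
  obtain \<tau>\<^sub>0 where \<tau>0: "supp A (dual_point e \<tau>\<^sub>0) = rad A e" using rad_eq_supp[OF A e] by metis
  have "foot A e = \<tau>\<^sub>0" unfolding foot_def by (rule the_equality, rule \<tau>0, rule uniq[OF _ \<tau>0])
  thus ?thesis using uniq \<tau>0 by blast
qed

lemma supp_expansion_foot:
  assumes e: "norm e = 1"
  shows "\<exists>a\<^sub>2>0. ((\<lambda>\<tau>. (supp A (dual_point e \<tau>) - supp A (dual_point e (foot A e))) / (\<tau> - foot A e)\<^sup>2) \<longlongrightarrow> a\<^sub>2 / 2) (at (foot A e))"
proof -
  obtain \<tau>\<^sub>0 a\<^sub>2 where *: "0 < a\<^sub>2" "supp A (dual_point e \<tau>\<^sub>0) = rad A e"
    "((\<lambda>\<tau>. (supp A (dual_point e \<tau>) - supp A (dual_point e \<tau>\<^sub>0)) / (\<tau> - \<tau>\<^sub>0)\<^sup>2) \<longlongrightarrow> a\<^sub>2 / 2) (at \<tau>\<^sub>0)"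
    by (rule supp_expansion[OF A C2 e])
  have "\<tau>\<^sub>0 = foot A e" using *(2) foot_eq_iff[OF e] by blast
  thus ?thesis using *(1,3) by blast
qed

text \<open>By the second-order expansion the support function has derivative 0 at the foot, while
  the affine function \<open>x \<bullet> dual_point e \<tau>\<close> of \<tau> touches it there from
  below and has slope \<open>x \<bullet> perp e\<close>. So x lies on the ray, and the face of
  \<open>A\<close> with this normal is a single point.\<close>

lemma maximizer_foot:
  assumes e: "norm e = 1" and x: "x \<in> A" "x \<bullet> dual_point e (foot A e) = rad A e"
  shows "x = rad A e *\<^sub>R e"
proof -
  let ?a = "\<lambda>\<tau>. supp A (dual_point e \<tau>)" and ?t = "foot A e"
  define g where "g = x \<bullet> perp e"
  have eq: "?a ?t = rad A e" using foot_eq_iff[OF e] by blast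
  obtain a\<^sub>2 where a2: "((\<lambda>\<tau>. (?a \<tau> - ?a ?t) / (\<tau> - ?t)\<^sup>2) \<longlongrightarrow> a\<^sub>2 / 2) (at ?t)"
    using supp_expansion_foot[OF e] by blast
  have "((\<lambda>\<tau>. (?a \<tau> - ?a ?t) / (\<tau> - ?t)\<^sup>2 * (\<tau> - ?t)) \<longlongrightarrow> a\<^sub>2 / 2 * (?t - ?t)) (at ?t)"
    by (intro tendsto_intros a2)
  moreover have "(\<lambda>\<tau>. (?a \<tau> - ?a ?t) / (\<tau> - ?t)\<^sup>2 * (\<tau> - ?t)) = (\<lambda>\<tau>. (?a \<tau> - ?a ?t) / (\<tau> - ?t))"
    by (auto simp: fun_eq_iff power2_eq_square)
  ultimately have "(?a has_real_derivative 0) (at ?t)" by (simp add: has_field_derivative_iff)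
  hence d: "((\<lambda>\<tau>. ?a \<tau> - \<tau> * g) has_real_derivative - g) (at ?t)"
    by (auto intro!: derivative_eq_intros)
  have "- g = 0"
  proof (rule DERIV_local_min[OF d, of 1])
    show "\<forall>\<tau>. \<bar>?t - \<tau>\<bar> < 1 \<longrightarrow> ?a ?t - ?t * g \<le> ?a \<tau> - \<tau> * g"
    proof (intro allI impI)
      fix \<tau>
      have "x \<bullet> dual_point e \<tau> = rad A e + (\<tau> - ?t) * g"
        using x(2) by (simp add: inner_dual_point g_def algebra_simps)
      thus "?a ?t - ?t * g \<le> ?a \<tau> - \<tau> * g"
        using supp_ge[OF round_bodyD(2)[OF A] x(1), of "dual_point e \<tau>"] eq by (simp add: algebra_simps)
    qed
  qed simp
  hence "x \<bullet> perp e = 0" "x \<bullet> e = rad A e" using x(2) by (simp_all add: g_def inner_dual_point)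
  hence "(x \<bullet> e) *\<^sub>R e + (x \<bullet> perp e) *\<^sub>R perp e = rad A e *\<^sub>R e" by simp
  with orthonormal_decomposition[OF e, of x] show ?thesis by (rule trans)
qed

text \<open>Contact points of \<open>A\<close> are unique, so different directions have their
  normals on different rays. The countably many irregular rays of \<open>K\<close> therefore belong
  to countably many directions, and arc measure has no atoms.\<close>

lemma AE_regular_foot:
  assumes K: "round_body r' \<rho>' K"
  shows "AE e in arc_measure. norm e = 1 \<and> regular_normal K (dual_point e (foot A e))"
proof -
  define S where "S d = {e. norm e = 1 \<and> (\<exists>c>0. dual_point e (foot A e) = c *\<^sub>R d)}" for d
  have S: "e = f" if ef: "e \<in> S d" "f \<in> S d" for e f d
  proof -
    obtain c where c: "norm e = 1" "c > 0" "dual_point e (foot A e) = c *\<^sub>R d" using ef(1) by (auto simp: S_def)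
    obtain c' where c': "norm f = 1" "c' > 0" "dual_point f (foot A f) = c' *\<^sub>R d" using ef(2) by (auto simp: S_def)
    have "c' *\<^sub>R dual_point e (foot A e) = c *\<^sub>R dual_point f (foot A f)" by (simp add: c c')
    \<comment> \<open>The contact point of \<open>A\<close> on the ray of \<open>f\<close>. If the
      normals of \<open>e\<close> and \<open>f\<close> lie on one ray, it is also a contact point
      for the normal of \<open>e\<close>, hence lies on the ray of \<open>e\<close> too.\<close>
    define p where "p = rad A f *\<^sub>R f"
    have sc: "supp A (c *\<^sub>R d) = c * supp A d" "supp A (c' *\<^sub>R d) = c' * supp A d"
      using c c' by (auto intro!: supp_scale_arg round_bodyD[OF A])
    have "p \<bullet> dual_point f (foot A f) = supp A (dual_point f (foot A f))"
      using foot_eq_iff[OF c'(1), of "foot A f"] c'(1) by (simp add: p_def)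
    hence "p \<bullet> d = supp A d" using c' sc by simp
    hence "p \<bullet> dual_point e (foot A e) = rad A e" using c sc foot_eq_iff[OF c(1), of "foot A e"] by simp
    hence pe: "p = rad A e *\<^sub>R e" using rad_mem[OF A c'(1)] by (intro maximizer_foot[OF c(1)]) (auto simp: p_def)
    hence "norm (rad A f *\<^sub>R f) = norm (rad A e *\<^sub>R e)" by (simp add: p_def)
    hence "rad A f = rad A e" using rad_pos[OF A c(1)] rad_pos[OF A c'(1)] c c' by simp
    thus "e = f" using pe rad_pos[OF A c(1)] by (simp add: p_def)
  qed
  define X where "X = (\<Union>d\<in>{d \<in> directions. \<not> regular_normal K d}. S d)"
  have "countable (S d)" for d
  proof (cases "S d = {}")
    case False
    then obtain e where "e \<in> S d" by blast
    hence "S d = {e}" using S by blast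
    thus ?thesis by simp
  qed simp
  hence "countable X" unfolding X_def by (intro countable_UN countable_irregular_directions[OF K])
  hence "AE e in arc_measure. e \<notin> X" by (intro AE_not_in countable_null_sets_arc_measure)
  thus ?thesis using AE_arc_measure_norm
  proof eventually_elim
    case (elim e)
    have "dual_point e (foot A e) \<noteq> 0" using one_le_norm_dual_point[OF elim(2), of "foot A e"] by auto
    then obtain c d where cd: "c > 0" "d \<in> directions" "dual_point e (foot A e) = c *\<^sub>R d"
      using direction_exists by blast
    have "regular_normal K d" using elim cd by (auto simp: X_def S_def)
    thus ?case using regular_normal_scale[OF K cd(1)] cd(3) elim(2) by simp
  qed
qed

end

section \<open>The second variation of the measure\<close>

locale gauge_density =
  fixes \<phi> \<phi>' :: "real \<Rightarrow> real" and L :: "(real^2) set" and r \<rho> :: real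
  assumes L: "round_body r \<rho> L"
    and \<phi>_nonneg: "0 \<le> x \<Longrightarrow> 0 \<le> \<phi> x"
    and \<phi>_mono: "mono_on {0..} \<phi>"
    and \<phi>_deriv: "0 < x \<Longrightarrow> (\<phi> has_real_derivative \<phi>' x) (at x)"
    and \<phi>'_mono: "0 < x \<Longrightarrow> x \<le> y \<Longrightarrow> \<phi>' x \<le> \<phi>' y"
    and \<phi>'_nonneg: "0 < x \<Longrightarrow> 0 \<le> \<phi>' x"
begin

lemma density_measurable [measurable]: "(\<lambda>x. ennreal (exp (- \<phi> (gauge L x)))) \<in> borel_measurable borel"
proof -
  \<comment> \<open>\<phi> is controlled only on the nonnegative half-line; the cut-off at 0 makes
    it monotone on the whole line without changing it at values of the gauge.\<close>
  have "mono (\<lambda>x. \<phi> (max 0 x))"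
    using \<phi>_mono by (auto intro!: monoI simp: mono_on_def)
  hence "(\<lambda>x. \<phi> (max 0 x)) \<in> borel_measurable borel" by (rule borel_measurable_mono)
  from measurable_compose[OF gauge_measurable[OF L] this]
  have "(\<lambda>x. \<phi> (max 0 (gauge L x))) \<in> borel_measurable borel" .
  also have "(\<lambda>x. \<phi> (max 0 (gauge L x))) = (\<lambda>x. \<phi> (gauge L x))"
    using gauge_nonneg[OF L] by (simp add: max_def)
  finally show ?thesis by measurable
qed

section \<open>Mass along a ray\<close>

definition weight :: "real^2 \<Rightarrow> real \<Rightarrow> real" where
  "weight e l = l * exp (- \<phi> (l / rad L e))"

definition primitive :: "real^2 \<Rightarrow> real \<Rightarrow> real" where
  "primitive e R = integral {0..R} (weight e)"

lemma weight_bounds: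
  assumes "norm e = 1" "0 \<le> l" shows "0 \<le> weight e l" "weight e l \<le> l"
proof -
  have "0 \<le> \<phi> (l / rad L e)" using assms rad_pos[OF L assms(1)] by (intro \<phi>_nonneg) auto
  thus "0 \<le> weight e l" "weight e l \<le> l" using assms by (auto simp: weight_def mult_left_le)
qed

lemma weight_deriv:
  assumes e: "norm e = 1" and l: "0 < l"
  shows "(weight e has_real_derivative exp (- \<phi> (l / rad L e)) * (1 - l / rad L e * \<phi>' (l / rad L e))) (at l)"
proof -
  have rp: "rad L e > 0" by (rule rad_pos[OF L e])
  have "((\<lambda>l. \<phi> (l / rad L e)) has_real_derivative \<phi>' (l / rad L e) * (1 / rad L e)) (at l)"
    by (rule DERIV_chain2[OF \<phi>_deriv]) (use l rp in \<open>auto intro!: derivative_eq_intros\<close>)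
  hence "((\<lambda>l. l * exp (- \<phi> (l / rad L e))) has_real_derivative
     1 * exp (- \<phi> (l / rad L e)) + exp (- \<phi> (l / rad L e)) * (- (\<phi>' (l / rad L e) * (1 / rad L e))) * l) (at l)"
    by (intro DERIV_mult DERIV_ident) (auto intro!: derivative_eq_intros)
  thus ?thesis by (simp add: weight_def[abs_def] algebra_simps)
qed

lemma weight_continuous:
  assumes e: "norm e = 1" shows "continuous_on {0..R} (weight e)"
  unfolding continuous_on_def
proof
  fix l assume l: "l \<in> {0..R}"
  show "(weight e \<longlongrightarrow> weight e l) (at l within {0..R})"
  proof (cases "l = 0")
    case True
    \<comment> \<open>At 0 the continuity comes from the factor l, by 0 \<le> weight \<le>
      l.\<close>
    show ?thesis unfolding True
    proof (rule tendsto_sandwich[of "\<lambda>_. 0" _ _ "\<lambda>x. x"])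
      show "\<forall>\<^sub>F x in at 0 within {0..R}. 0 \<le> weight e x" "\<forall>\<^sub>F x in at 0 within {0..R}. weight e x \<le> x"
        using weight_bounds[OF e] by (auto simp: eventually_at_filter intro!: always_eventually)
    qed (auto simp: weight_def)
  next
    case False
    hence "isCont (weight e) l" using l weight_deriv[OF e, of l] by (intro DERIV_isCont) auto
    thus ?thesis using continuous_at_imp_continuous_at_within continuous_within by blast
  qed
qed

lemma primitive_deriv:
  assumes e: "norm e = 1" and R: "0 < R"
  shows "(primitive e has_real_derivative weight e R) (at R)"
proof -
  have "(primitive e has_real_derivative weight e R) (at R within {0..R+1})"
    unfolding primitive_def[abs_def]
    by (rule integral_has_real_derivative[OF weight_continuous[OF e]]) (use R in auto)
  moreover have "at R within {0..R+1} = at R" by (rule at_within_interior) (use R in auto)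
  ultimately show ?thesis by simp
qed

lemma primitive_nonneg: "norm e = 1 \<Longrightarrow> 0 \<le> primitive e R"
  unfolding primitive_def using weight_bounds by (intro integral_nonneg integrable_continuous_interval weight_continuous) auto

lemma primitive_lip:
  assumes e: "norm e = 1" and "0 < x" "0 < y" "x \<le> R" "y \<le> R"
  shows "\<bar>primitive e x - primitive e y\<bar> \<le> R * \<bar>x - y\<bar>"
proof -
  have "norm (primitive e x - primitive e y) \<le> R * norm (x - y)"
  proof (rule field_differentiable_bound[of "{0<..R}" _ "weight e"])
    fix z assume z: "z \<in> {0<..R}"
    show "(primitive e has_real_derivative weight e z) (at z within {0<..R})"
      using primitive_deriv[OF e, of z] z by (auto intro: has_field_derivative_at_within)
    show "norm (weight e z) \<le> R" using weight_bounds[OF e, of z] z by auto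
  qed (use assms in auto)
  thus ?thesis by simp
qed

text \<open>Written with the planar density and the indicator of \<open>K\<close>, so that
  measurability in \<open>e\<close> is that of a parameter integral. On unit vectors, hence almost
  everywhere, it is \<open>primitive e (rad K e)\<close>.\<close>

definition cone_mass :: "(real^2) set \<Rightarrow> real^2 \<Rightarrow> real" where
  "cone_mass K e = enn2real (\<integral>\<^sup>+l. ennreal l * indicator {0<..} l *
     (ennreal (exp (- \<phi> (gauge L (l *\<^sub>R e)))) * indicator K (l *\<^sub>R e)) \<partial>lborel)"

lemma nn_integral_cone:
  assumes K: "round_body r' \<rho>' K" and e: "norm e = 1"
  shows "(\<integral>\<^sup>+l. ennreal l * indicator {0<..} l *
     (ennreal (exp (- \<phi> (gauge L (l *\<^sub>R e)))) * indicator K (l *\<^sub>R e)) \<partial>lborel) = ennreal (primitive e (rad K e))"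
proof -
  have "(\<integral>\<^sup>+l. ennreal l * indicator {0<..} l *
     (ennreal (exp (- \<phi> (gauge L (l *\<^sub>R e)))) * indicator K (l *\<^sub>R e)) \<partial>lborel)
    = (\<integral>\<^sup>+l. ennreal (weight e l) * indicator {0..rad K e} l \<partial>lborel)"
  proof (rule nn_integral_cong)
    fix l :: real
    consider "l < 0" | "l = 0" | "l > 0" by linarith
    thus "ennreal l * indicator {0<..} l * (ennreal (exp (- \<phi> (gauge L (l *\<^sub>R e)))) * indicator K (l *\<^sub>R e))
      = ennreal (weight e l) * indicator {0..rad K e} l"
    proof cases
      case 3
      have "gauge L (l *\<^sub>R e) = l / rad L e" using gauge_ray[OF L e, of l] 3 by simp
      moreover have "l *\<^sub>R e \<in> K \<longleftrightarrow> l \<le> rad K e" using mem_iff_le_rad[OF K e, of l] 3 by simp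
      ultimately show ?thesis using 3 by (auto simp: indicator_def weight_def ennreal_mult')
    qed (auto simp: weight_def indicator_def)
  qed
  also have "\<dots> = ennreal (primitive e (rad K e))"
    unfolding primitive_def
    by (rule nn_integral_has_integral_lebesgue')
       (use weight_bounds[OF e] in \<open>auto intro!: integrable_integral integrable_continuous_interval weight_continuous e\<close>)
  finally show ?thesis .
qed

lemma cone_mass_eq:
  assumes "round_body r' \<rho>' K" "norm e = 1"
  shows "cone_mass K e = primitive e (rad K e)"
  using nn_integral_cone[OF assms] primitive_nonneg[OF assms(2)] by (simp add: cone_mass_def)

lemma cone_mass_measurable:
  assumes "round_body r' \<rho>' K" shows "cone_mass K \<in> borel_measurable arc_measure"
proof -
  have [measurable]: "K \<in> sets borel" using round_bodyD(2)[OF assms] by (rule borel_compact)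
  show ?thesis unfolding cone_mass_def[abs_def] by measurable
qed

lemma measure_gauge_measure:
  assumes K: "round_body r' \<rho>' K"
  shows "integrable arc_measure (cone_mass K)"
    and "measure (gauge_measure \<phi> L) K = (\<integral>e. cone_mass K e \<partial>arc_measure)"
proof -
  note [measurable] = cone_mass_measurable[OF K]
  have Kb [measurable]: "K \<in> sets borel" using round_bodyD(2)[OF K] by (rule borel_compact)
  interpret finite_measure arc_measure by (rule finite_arc_measure)
  have "emeasure (gauge_measure \<phi> L) K = (\<integral>\<^sup>+x. ennreal (exp (- \<phi> (gauge L x))) * indicator K x \<partial>lborel)"
    unfolding gauge_measure_def by (rule emeasure_density) measurable
  also have "\<dots> = (\<integral>\<^sup>+e. \<integral>\<^sup>+l. ennreal l * indicator {0<..} l *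
     (ennreal (exp (- \<phi> (gauge L (l *\<^sub>R e)))) * indicator K (l *\<^sub>R e)) \<partial>lborel \<partial>arc_measure)"
    by (rule nn_integral_polar) measurable
  also have "\<dots> = (\<integral>\<^sup>+e. ennreal (cone_mass K e) \<partial>arc_measure)"
    by (rule nn_integral_cong_AE) (use AE_arc_measure_norm in \<open>auto elim!: eventually_mono simp: nn_integral_cone[OF K] cone_mass_eq[OF K]\<close>)
  finally have eq: "emeasure (gauge_measure \<phi> L) K = (\<integral>\<^sup>+e. ennreal (cone_mass K e) \<partial>arc_measure)" .
  have nn: "0 \<le> cone_mass K e" for e by (simp add: cone_mass_def)
  have "AE e in arc_measure. norm (cone_mass K e) \<le> \<rho>' * \<rho>'"
    using AE_arc_measure_norm
  proof eventually_elim
    case (elim e)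
    have "norm (integral {0..rad K e} (weight e)) \<le> \<rho>' * measure lborel {0..rad K e}"
    proof (rule has_integral_bound_real[of \<rho>' "{}" "weight e"])
      show "(weight e has_integral integral {0..rad K e} (weight e)) {0..rad K e}"
        by (intro integrable_integral integrable_continuous_interval weight_continuous elim)
      show "0 \<le> \<rho>'" using rad_bounds[OF K elim] rad_pos[OF K elim] by linarith
      show "norm (weight e x) \<le> \<rho>'" if "x \<in> {0..rad K e} - {}" for x
        using weight_bounds[OF elim, of x] rad_bounds[OF K elim] that by auto
    qed simp
    hence "primitive e (rad K e) \<le> \<rho>' * rad K e"
      using rad_pos[OF K elim] by (simp add: primitive_def)
    also have "\<dots> \<le> \<rho>' * \<rho>'" using rad_bounds[OF K elim] rad_pos[OF K elim] by (intro mult_left_mono) auto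
    finally show ?case using cone_mass_eq[OF K elim] primitive_nonneg[OF elim] by simp
  qed
  thus int: "integrable arc_measure (cone_mass K)"
    by (rule integrable_const_bound) (rule cone_mass_measurable[OF K])
  have "emeasure (gauge_measure \<phi> L) K = ennreal (\<integral>e. cone_mass K e \<partial>arc_measure)"
    unfolding eq by (rule nn_integral_eq_integral[OF int]) (use nn in auto)
  thus "measure (gauge_measure \<phi> L) K = (\<integral>e. cone_mass K e \<partial>arc_measure)"
    using nn by (simp add: measure_def integral_nonneg_AE)
qed

end

section \<open>The perturbed family of bodies and its envelope\<close>

locale mixed_setting = gauge_density +
  fixes A B C :: "(real^2) set"
  assumes A: "round_body r \<rho> A" and B: "round_body r \<rho> B" and C: "round_body r \<rho> C"
    and C2: "C2_plus A"
begin

text \<open>All minimizers are bounded by \<rho> / r. The additional 1 puts the foot into the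
  interior of [-T, T], as the second-order analysis of the envelope requires.\<close>

definition T :: real where "T = \<rho> / r + 1"

text \<open>A growth constant of \<open>A\<close> alone, fixed once for all directions; the problem
  with factor t has growth t \<kappa>.\<close>

definition \<kappa> :: real where
  "\<kappa> = (SOME \<kappa>. 0 < \<kappa> \<and> (\<forall>e \<tau>. norm e = 1 \<longrightarrow> \<bar>\<tau>\<bar> \<le> T \<longrightarrow>
     rad A e + \<kappa> * (\<tau> - foot A e)\<^sup>2 \<le> supp A (dual_point e \<tau>)))"

lemma supp_foot: "norm e = 1 \<Longrightarrow> supp A (dual_point e (foot A e)) = rad A e"
  using foot_eq_iff[OF A C2] by blast

lemma foot_bound: "norm e = 1 \<Longrightarrow> \<bar>foot A e\<bar> \<le> \<rho> / r"
  by (rule abs_le_if_supp_eq_rad[OF A _ supp_foot])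

lemma \<kappa>: "0 < \<kappa>" "norm e = 1 \<Longrightarrow> \<bar>\<tau>\<bar> \<le> T \<Longrightarrow> rad A e + \<kappa> * (\<tau> - foot A e)\<^sup>2 \<le> supp A (dual_point e \<tau>)"
proof -
  obtain k where k: "0 < k" "\<And>e \<tau>\<^sub>0 \<tau>. norm e = 1 \<Longrightarrow>
     \<bar>\<tau>\<^sub>0\<bar> \<le> T \<Longrightarrow> \<bar>\<tau>\<bar> \<le> T \<Longrightarrow> rad A e = supp A (dual_point e \<tau>\<^sub>0) \<Longrightarrow>
     rad A e + k * (\<tau> - \<tau>\<^sub>0)\<^sup>2 \<le> supp A (dual_point e \<tau>)"
    by (rule supp_growth[OF A C2, of T]) blast
  have "\<exists>\<kappa>. 0 < \<kappa> \<and> (\<forall>(e :: real^2) \<tau>. norm e = 1 \<longrightarrow> \<bar>\<tau>\<bar> \<le> T \<longrightarrow>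
     rad A e + \<kappa> * (\<tau> - foot A e)\<^sup>2 \<le> supp A (dual_point e \<tau>))"
  proof (intro exI[of _ k] conjI allI impI k(1))
    fix e :: "real^2" and \<tau> assume *: "norm e = 1" "\<bar>\<tau>\<bar> \<le> T"
    have "\<bar>foot A e\<bar> \<le> T" using foot_bound[OF *(1)] by (simp add: T_def)
    thus "rad A e + k * (\<tau> - foot A e)\<^sup>2 \<le> supp A (dual_point e \<tau>)"
      by (rule k(2)[OF *(1) _ *(2) supp_foot[OF *(1), symmetric]])
  qed
  from someI_ex[OF this] show "0 < \<kappa>" "norm e = 1 \<Longrightarrow> \<bar>\<tau>\<bar> \<le> T \<Longrightarrow> rad A e + \<kappa> * (\<tau> - foot A e)\<^sup>2 \<le> supp A (dual_point e \<tau>)"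
    unfolding \<kappa>_def[symmetric] by blast+
qed

definition \<beta> :: real where "\<beta> = \<rho> * (1 + T)"

lemma T_pos: "0 < T" using round_bodyD(1,8)[OF A] by (simp add: T_def add_nonneg_pos)

lemma supp_dual_bound:
  assumes K: "round_body r \<rho> K" and e: "norm e = 1" and \<tau>: "\<bar>\<tau>\<bar> \<le> T"
  shows "r \<le> supp K (dual_point e \<tau>)" "supp K (dual_point e \<tau>) \<le> \<beta>"
proof -
  have "r * 1 \<le> r * norm (dual_point e \<tau>)"
    using one_le_norm_dual_point[OF e] round_bodyD(1)[OF A] by (intro mult_left_mono) auto
  thus "r \<le> supp K (dual_point e \<tau>)" using supp_lower[OF K, of "dual_point e \<tau>"] by simp
  have "norm (dual_point e \<tau>) \<le> norm e + norm (\<tau> *\<^sub>R perp e)" unfolding dual_point_def by (rule norm_triangle_ineq)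
  hence "\<rho> * norm (dual_point e \<tau>) \<le> \<rho> * (1 + T)"
    using e \<tau> round_bodyD(1,8)[OF A] by (intro mult_left_mono) auto
  thus "supp K (dual_point e \<tau>) \<le> \<beta>" using supp_upper[OF K, of "dual_point e \<tau>"] by (simp add: \<beta>_def)
qed

abbreviation family :: "real \<Rightarrow> real \<Rightarrow> real \<Rightarrow> (real^2) set" where
  "family t s u \<equiv> (*\<^sub>R) t ` A + (*\<^sub>R) s ` B + (*\<^sub>R) u ` C"

lemma envelope:
  assumes t: "0 < t" and e: "norm e = 1"
  shows "min_envelope {-T..T} (\<lambda>\<tau>. t * supp A (dual_point e \<tau>)) (\<lambda>\<tau>. supp B (dual_point e \<tau>))
    (\<lambda>\<tau>. supp C (dual_point e \<tau>)) (\<lambda>s u. rad (family t s u) e) \<rho> \<beta> (t * \<kappa>) (foot A e)"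
proof
  have lip: "\<bar>supp K (dual_point e \<sigma>) - supp K (dual_point e \<tau>)\<bar> \<le> \<rho> * \<bar>\<sigma> - \<tau>\<bar>" if "round_body r \<rho> K" for K \<sigma> \<tau>
    using supp_lip[OF that, of "dual_point e \<sigma>" "dual_point e \<tau>"] e by (simp add: dual_point_diff)
  show "\<bar>supp B (dual_point e \<sigma>) - supp B (dual_point e \<tau>)\<bar> \<le> \<rho> * \<bar>\<sigma> - \<tau>\<bar>"
    "\<bar>supp C (dual_point e \<sigma>) - supp C (dual_point e \<tau>)\<bar> \<le> \<rho> * \<bar>\<sigma> - \<tau>\<bar>" for \<sigma> \<tau> using lip[OF B] lip[OF C] by auto
  fix \<tau> assume \<tau>: "\<tau> \<in> {-T..T}"
  hence \<tau>': "\<bar>\<tau>\<bar> \<le> T" by auto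
  show "\<bar>supp B (dual_point e \<tau>)\<bar> \<le> \<beta>" "\<bar>supp C (dual_point e \<tau>)\<bar> \<le> \<beta>"
    using supp_dual_bound[OF B e \<tau>'] supp_dual_bound[OF C e \<tau>'] round_bodyD(1)[OF A] by auto
  show "t * supp A (dual_point e (foot A e)) + t * \<kappa> * (\<tau> - foot A e)\<^sup>2 \<le> t * supp A (dual_point e \<tau>)"
    using mult_left_mono[OF \<kappa>(2)[OF e \<tau>'], of t] t unfolding supp_foot[OF e] by (simp add: algebra_simps)
next
  fix s u :: real assume su: "0 \<le> s" "0 \<le> u"
  note F = round_body_combination[OF A B C t su]
  note S = supp_combination[OF A B C less_imp_le[OF t] su]
  show "rad (family t s u) e \<le> t * supp A (dual_point e \<tau>) + s * supp B (dual_point e \<tau>) + u * supp C (dual_point e \<tau>)" for \<tau>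
    using rad_le_supp[OF F e, of \<tau>] unfolding S .
  obtain \<tau> where \<tau>: "\<bar>\<tau>\<bar> \<le> \<rho> * (t + s + u) / (r * (t + s + u))" "rad (family t s u) e = supp (family t s u) (dual_point e \<tau>)"
    using rad_eq_supp[OF F e] by blast
  have "t + s + u > 0" using t su by simp
  hence "\<bar>\<tau>\<bar> \<le> T" using \<tau>(1) by (simp add: T_def)
  thus "\<exists>\<tau>\<in>{-T..T}. rad (family t s u) e = t * supp A (dual_point e \<tau>) + s * supp B (dual_point e \<tau>) + u * supp C (dual_point e \<tau>)"
    using \<tau>(2) unfolding S by (intro bexI[of _ \<tau>]) auto
next
  have "\<bar>foot A e\<bar> \<le> T" using foot_bound[OF e] by (simp add: T_def)
  thus "foot A e \<in> {-T..T}" by auto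
  show "0 < t * \<kappa>" using t \<kappa>(1) by simp
  show "0 \<le> \<rho>" using round_bodyD(1,8)[OF A] by simp
qed

lemma rad_family_zero: "0 < t \<Longrightarrow> norm e = 1 \<Longrightarrow> rad (family t 0 0) e = t * rad A e"
  using min_envelope.V_zero[OF envelope] supp_foot by simp

lemma rad_family_bounds:
  assumes "0 < t" "norm e = 1" "0 \<le> s" "s \<le> 1" "0 \<le> u" "u \<le> 1"
  shows "r * t \<le> rad (family t s u) e" "rad (family t s u) e \<le> \<rho> * (t + 2)"
proof -
  note b = rad_bounds[OF round_body_combination[OF A B C assms(1,3,5)] assms(2)]
  have "r * t \<le> r * (t + s + u)" using assms round_bodyD(1)[OF A] by (intro mult_left_mono) auto
  thus "r * t \<le> rad (family t s u) e" using b(1) by linarith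
  have "\<rho> * (t + s + u) \<le> \<rho> * (t + 2)" using assms round_bodyD(1,8)[OF A] by (intro mult_left_mono) auto
  thus "rad (family t s u) e \<le> \<rho> * (t + 2)" using b(2) by linarith
qed

section \<open>Derivatives of the ray masses in the two parameters\<close>

definition radial_deriv :: "real \<Rightarrow> real^2 \<Rightarrow> real \<Rightarrow> real" where
  "radial_deriv t e = min_envelope.V_u (\<lambda>s u. rad (family t s u) e)"

lemma cone_mass_deriv:
  assumes t: "0 < t" and e: "norm e = 1" and s: "0 \<le> s"
  shows "((\<lambda>u. cone_mass (family t s u) e) has_real_derivative
    weight e (rad (family t s 0) e) * radial_deriv t e s) (at_right 0)"
proof -
  interpret min_envelope "{-T..T}" "\<lambda>\<tau>. t * supp A (dual_point e \<tau>)" "\<lambda>\<tau>. supp B (dual_point e \<tau>)"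
    "\<lambda>\<tau>. supp C (dual_point e \<tau>)" "\<lambda>s u. rad (family t s u) e" \<rho> \<beta> "t * \<kappa>" "foot A e"
    by (rule envelope[OF t e])
  have pos: "0 < rad (family t s 0) e" by (rule rad_pos[OF round_body_combination[OF A B C t s order_refl] e])
  have "((\<lambda>u. primitive e (rad (family t s u) e)) has_real_derivative weight e (rad (family t s 0) e) * V_u s) (at_right 0)"
    by (rule DERIV_chain2[OF primitive_deriv[OF e pos] has_derivative_V_snd[OF s]])
  moreover have eq: "cone_mass (family t s u) e = primitive e (rad (family t s u) e)" if "0 \<le> u" for u
    by (rule cone_mass_eq[OF round_body_combination[OF A B C t s that] e])
  moreover have "\<forall>\<^sub>F u in at_right 0. cone_mass (family t s u) e = primitive e (rad (family t s u) e)"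
    using eventually_at_right_less[of "0::real"] by eventually_elim (rule eq, simp)
  hence "((\<lambda>u. cone_mass (family t s u) e) has_real_derivative y) (at_right 0) \<longleftrightarrow>
      ((\<lambda>u. primitive e (rad (family t s u) e)) has_real_derivative y) (at_right 0)" for y
    by (rule has_field_derivative_cong_eventually) (rule eq[OF order_refl])
  ultimately show ?thesis unfolding radial_deriv_def by (simp only:)
qed

lemma cone_mass_lip:
  assumes t: "0 < t" and e: "norm e = 1" and s: "0 \<le> s" "s \<le> 1" and u: "0 \<le> u" "u \<le> 1"
  shows "\<bar>cone_mass (family t s u) e - cone_mass (family t s 0) e\<bar> \<le> \<rho> * (t + 2) * \<beta> * u"
proof -
  interpret min_envelope "{-T..T}" "\<lambda>\<tau>. t * supp A (dual_point e \<tau>)" "\<lambda>\<tau>. supp B (dual_point e \<tau>)"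
    "\<lambda>\<tau>. supp C (dual_point e \<tau>)" "\<lambda>s u. rad (family t s u) e" \<rho> \<beta> "t * \<kappa>" "foot A e"
    by (rule envelope[OF t e])
  have pos: "0 < rad (family t s u) e" if "0 \<le> u" for u
    by (rule rad_pos[OF round_body_combination[OF A B C t s(1) that] e])
  have eq: "cone_mass (family t s u) e = primitive e (rad (family t s u) e)" if "0 \<le> u" for u
    by (rule cone_mass_eq[OF round_body_combination[OF A B C t s(1) that] e])
  have "\<bar>primitive e (rad (family t s u) e) - primitive e (rad (family t s 0) e)\<bar>
      \<le> \<rho> * (t + 2) * \<bar>rad (family t s u) e - rad (family t s 0) e\<bar>"
    using t s u by (intro primitive_lip[OF e] pos rad_family_bounds e) auto
  also have "\<dots> \<le> \<rho> * (t + 2) * (\<beta> * u)"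
    using V_lip_snd[OF s(1) u(1)] t \<Lambda> by (intro mult_left_mono) auto
  finally show ?thesis unfolding eq[OF u(1)] eq[OF order_refl] by (simp only: mult.assoc)
qed

text \<open>The derivative of the weight is exp(-\<phi> z) (1 - z \<phi>' z) at some z \<le> b / r;
  the exponential is at most 1, and z \<phi>' z is nondecreasing.\<close>

lemma weight_lip:
  assumes e: "norm e = 1" and x: "0 < a" "a \<le> x" "x \<le> b" "a \<le> y" "y \<le> b"
  shows "\<bar>weight e x - weight e y\<bar> \<le> (1 + b / r * \<phi>' (b / r)) * \<bar>x - y\<bar>"
proof -
  let ?d = "\<lambda>l. exp (- \<phi> (l / rad L e)) * (1 - l / rad L e * \<phi>' (l / rad L e))"
  have rp: "rad L e > 0" "r \<le> rad L e" "r > 0" using rad_pos[OF L e] rad_bounds[OF L e] round_bodyD(1)[OF L] by auto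
  have "norm (weight e x - weight e y) \<le> (1 + b / r * \<phi>' (b / r)) * norm (x - y)"
  proof (rule field_differentiable_bound[of "{a..b}" _ ?d])
    fix z assume z: "z \<in> {a..b}"
    show "(weight e has_real_derivative ?d z) (at z within {a..b})"
      using weight_deriv[OF e, of z] z x by (auto intro: has_field_derivative_at_within)
    have zp: "0 < z / rad L e" using z x rp by auto
    have zb: "z / rad L e \<le> b / r" using z x rp by (intro frac_le) auto
    have "0 \<le> z / rad L e * \<phi>' (z / rad L e)" using zp \<phi>'_nonneg by (intro mult_nonneg_nonneg) auto
    moreover have "z / rad L e * \<phi>' (z / rad L e) \<le> b / r * \<phi>' (b / r)"
      using zp zb \<phi>'_nonneg[OF zp] by (intro mult_mono \<phi>'_mono) auto
    ultimately have "\<bar>1 - z / rad L e * \<phi>' (z / rad L e)\<bar> \<le> 1 + b / r * \<phi>' (b / r)" by linarith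
    moreover have "exp (- \<phi> (z / rad L e)) \<le> 1" using \<phi>_nonneg zp by simp
    ultimately have "exp (- \<phi> (z / rad L e)) * \<bar>1 - z / rad L e * \<phi>' (z / rad L e)\<bar> \<le> 1 * (1 + b / r * \<phi>' (b / r))"
      by (intro mult_mono) auto
    thus "norm (?d z) \<le> 1 + b / r * \<phi>' (b / r)" by (simp add: abs_mult)
  qed (use x in auto)
  thus ?thesis by simp
qed

text \<open>Domination for the second differentiation: the constant may depend on t in any way but
  not on the direction. The increment of the product is split into the increments of its two
  factors.\<close>

lemma first_variation_lip:
  assumes t: "0 < t"
  obtains D where "\<And>e s. norm e = 1 \<Longrightarrow> 0 \<le> s \<Longrightarrow> s \<le> 1 \<Longrightarrow>
    \<bar>weight e (rad (family t s 0) e) * radial_deriv t e s - weight e (rad (family t 0 0) e) * radial_deriv t e 0\<bar> \<le> D * s"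
proof -
  define b where "b = \<rho> * (t + 2)"
  define D\<^sub>1 where "D\<^sub>1 = 1 + b / r * \<phi>' (b / r)"
  have rr: "0 < r" "0 < \<rho>" using round_bodyD(1,8)[OF A] by auto
  have b: "0 < b / r" "0 < b" using rr t by (auto simp: b_def)
  have "0 \<le> b / r * \<phi>' (b / r)" using b \<phi>'_nonneg[OF b(1)] by (intro mult_nonneg_nonneg) auto
  hence D1: "D\<^sub>1 \<ge> 0" unfolding D\<^sub>1_def by linarith
  show ?thesis
  proof (rule that[of "D\<^sub>1 * \<beta> * \<beta> + b * (\<rho>\<^sup>2 / (t * \<kappa>))"])
    fix e :: "real^2" and s :: real assume e: "norm e = 1" and s: "0 \<le> s" "s \<le> 1"
    interpret min_envelope "{-T..T}" "\<lambda>\<tau>. t * supp A (dual_point e \<tau>)" "\<lambda>\<tau>. supp B (dual_point e \<tau>)"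
      "\<lambda>\<tau>. supp C (dual_point e \<tau>)" "\<lambda>s u. rad (family t s u) e" \<rho> \<beta> "t * \<kappa>" "foot A e"
      by (rule envelope[OF t e])
    let ?R = "\<lambda>s. rad (family t s 0) e"
    have \<beta>0: "\<beta> \<ge> 0" using rr T_pos by (simp add: \<beta>_def)
    have Rb: "r * t \<le> ?R s" "?R s \<le> b" "r * t \<le> ?R 0" "?R 0 \<le> b"
      using rad_family_bounds[OF t e, of s 0] rad_family_bounds[OF t e, of 0 0] s by (auto simp: b_def)
    have "\<bar>weight e (?R s) - weight e (?R 0)\<bar> \<le> D\<^sub>1 * \<bar>?R s - ?R 0\<bar>"
      unfolding D\<^sub>1_def by (rule weight_lip[OF e _ Rb]) (use rr t in simp)
    also have "\<dots> \<le> D\<^sub>1 * (\<beta> * s)" using V_lip_fst[OF s(1)] D1 by (intro mult_left_mono)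
    finally have 1: "\<bar>weight e (?R s) - weight e (?R 0)\<bar> * \<bar>V_u s\<bar> \<le> D\<^sub>1 * (\<beta> * s) * \<beta>"
      using V_u_bound[OF s(1)] \<beta>0 s D1 by (intro mult_mono) auto
    have "0 < r * t" using rr t by simp
    hence "0 \<le> ?R 0" using Rb(3) by linarith
    hence "\<bar>weight e (?R 0)\<bar> \<le> b" using weight_bounds[OF e, of "?R 0"] Rb(4) by auto
    hence 2: "\<bar>weight e (?R 0)\<bar> * \<bar>V_u s - V_u 0\<bar> \<le> b * (\<rho>\<^sup>2 / (t * \<kappa>) * s)"
      using V_u_lip[OF s(1)] b unfolding V_u_zero by (intro mult_mono) auto
    have "weight e (?R s) * V_u s - weight e (?R 0) * V_u 0 = (weight e (?R s) - weight e (?R 0)) * V_u s + weight e (?R 0) * (V_u s - V_u 0)"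
      by (simp add: algebra_simps)
    hence "\<bar>weight e (?R s) * V_u s - weight e (?R 0) * V_u 0\<bar> \<le> \<bar>weight e (?R s) - weight e (?R 0)\<bar> * \<bar>V_u s\<bar> + \<bar>weight e (?R 0)\<bar> * \<bar>V_u s - V_u 0\<bar>"
      by (simp only: abs_mult[symmetric] abs_triangle_ineq)
    also have "\<dots> \<le> D\<^sub>1 * (\<beta> * s) * \<beta> + b * (\<rho>\<^sup>2 / (t * \<kappa>) * s)" using 1 2 by (rule add_mono)
    finally show "\<bar>weight e (?R s) * radial_deriv t e s - weight e (?R 0) * radial_deriv t e 0\<bar>
       \<le> (D\<^sub>1 * \<beta> * \<beta> + b * (\<rho>\<^sup>2 / (t * \<kappa>))) * s"
      unfolding radial_deriv_def by (simp add: algebra_simps)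
  qed
qed

text \<open>Product rule at s = 0. The summand \<open>k\<close> carries the derivative of
  \<open>radial_deriv\<close>, which is at most \<rho>^2 / (t \<kappa>) in absolute value; against
  the radius t rad A in the weight the factor t cancels. So \<open>k\<close> is bounded
  independently of t, and the term with y \<phi>' y can dominate it.\<close>

lemma second_variation:
  assumes t: "0 < t" and e: "norm e = 1"
    and B': "regular_normal B (dual_point e (foot A e))" and C': "regular_normal C (dual_point e (foot A e))"
  defines "y \<equiv> t * (rad A e / rad L e)"
  shows "\<exists>b c k. r \<le> b \<and> b \<le> \<beta> \<and> r \<le> c \<and> c \<le> \<beta> \<and> \<bar>k\<bar> \<le> \<rho> * \<rho>\<^sup>2 / \<kappa> \<and>
    ((\<lambda>s. weight e (rad (family t s 0) e) * radial_deriv t e s) has_real_derivative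
      exp (- \<phi> y) * ((1 - y * \<phi>' y) * b * c + k)) (at_right 0)"
proof -
  interpret min_envelope "{-T..T}" "\<lambda>\<tau>. t * supp A (dual_point e \<tau>)" "\<lambda>\<tau>. supp B (dual_point e \<tau>)"
    "\<lambda>\<tau>. supp C (dual_point e \<tau>)" "\<lambda>s u. rad (family t s u) e" \<rho> \<beta> "t * \<kappa>" "foot A e"
    by (rule envelope[OF t e])
  let ?b = "supp B (dual_point e (foot A e))" and ?c = "supp C (dual_point e (foot A e))"
  let ?R = "\<lambda>s. rad (family t s 0) e"
  have fT: "\<bar>foot A e\<bar> < T" using foot_bound[OF e] by (simp add: T_def)
  obtain b\<^sub>1 where b1: "((\<lambda>\<tau>. supp B (dual_point e \<tau>)) has_real_derivative b\<^sub>1) (at (foot A e))"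
    using supp_has_derivative[OF B e B'] by blast
  obtain c\<^sub>1 where c1: "((\<lambda>\<tau>. supp C (dual_point e \<tau>)) has_real_derivative c\<^sub>1) (at (foot A e))"
    using supp_has_derivative[OF C e C'] by blast
  obtain a\<^sub>2 where a2: "0 < a\<^sub>2"
    "((\<lambda>\<tau>. (supp A (dual_point e \<tau>) - supp A (dual_point e (foot A e))) / (\<tau> - foot A e)\<^sup>2) \<longlongrightarrow> a\<^sub>2 / 2) (at (foot A e))"
    using supp_expansion_foot[OF A C2 e] by blast
  have "((\<lambda>\<tau>. (t * supp A (dual_point e \<tau>) - t * supp A (dual_point e (foot A e))) / (\<tau> - foot A e)\<^sup>2) \<longlongrightarrow> t * a\<^sub>2 / 2) (at (foot A e))"
    using tendsto_mult_left[OF a2(2), of t] by (simp add: right_diff_distrib)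
  moreover have "foot A e \<in> interior {-T..T}" using fT by auto
  ultimately have "(V_u has_real_derivative - b\<^sub>1 * c\<^sub>1 / (t * a\<^sub>2)) (at_right 0)"
    by (intro has_derivative_V_u b1 c1 mult_pos_pos t a2(1))
  \<comment> \<open>From the explicit value only the existence of the derivative is kept; its size
    comes from the uniform bound.\<close>
  then obtain d where d: "(V_u has_real_derivative d) (at_right 0)" by blast
  have db: "\<bar>d\<bar> \<le> \<rho>\<^sup>2 / (t * \<kappa>)" by (rule derivative_V_u_bound[OF d])
  have R0: "?R 0 = t * rad A e" by (rule rad_family_zero[OF t e])
  have y: "?R 0 / rad L e = y" unfolding R0 y_def by simp
  have Rpos: "0 < ?R 0" using R0 t rad_pos[OF A e] by simp
  have dw: "((\<lambda>s. weight e (?R s)) has_real_derivative exp (- \<phi> y) * (1 - y * \<phi>' y) * ?b) (at_right 0)"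
    using DERIV_chain2[OF weight_deriv[OF e Rpos] has_derivative_V_fst] unfolding y .
  have "((\<lambda>s. weight e (?R s) * V_u s) has_real_derivative
     exp (- \<phi> y) * (1 - y * \<phi>' y) * ?b * V_u 0 + d * weight e (?R 0)) (at_right 0)"
    by (rule DERIV_mult[OF dw d])
  moreover have "exp (- \<phi> y) * (1 - y * \<phi>' y) * ?b * V_u 0 + d * weight e (?R 0)
     = exp (- \<phi> y) * ((1 - y * \<phi>' y) * ?b * ?c + t * rad A e * d)"
  proof -
    have "weight e (?R 0) = ?R 0 * exp (- \<phi> y)" unfolding weight_def y ..
    thus ?thesis unfolding V_u_zero R0 by (simp add: algebra_simps)
  qed
  moreover have "\<bar>t * rad A e * d\<bar> \<le> \<rho> * \<rho>\<^sup>2 / \<kappa>"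
  proof -
    have "\<bar>t * rad A e * d\<bar> = t * rad A e * \<bar>d\<bar>" using t rad_pos[OF A e] by (simp add: abs_mult)
    also have "\<dots> \<le> t * \<rho> * (\<rho>\<^sup>2 / (t * \<kappa>))"
      using t rad_pos[OF A e] rad_bounds[OF A e] db \<Lambda> by (intro mult_mono mult_nonneg_nonneg) auto
    also have "\<dots> = \<rho> * \<rho>\<^sup>2 / \<kappa>" using t by simp
    finally show ?thesis .
  qed
  moreover note supp_dual_bound[OF B e less_imp_le[OF fT]] supp_dual_bound[OF C e less_imp_le[OF fT]]
  ultimately show ?thesis unfolding radial_deriv_def
    by (intro exI[of _ ?b] exI[of _ ?c] exI[of _ "t * rad A e * d"]) simp
qed

text \<open>Differentiation under the integral, in u for each s in [0, 1) and then in s at 0. The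
  first pass yields integrable functions \<open>P s\<close> that are known to agree with the
  explicit formula on the unit circle only; \<open>PQ\<close> transfers their derivatives in
  s.\<close>

lemma has_mixed_measure_family:
  assumes t: "0 < t"
  obtains Q where "integrable arc_measure Q"
    "has_mixed_measure (gauge_measure \<phi> L) ((*\<^sub>R) t ` A) B C (\<integral>e. Q e \<partial>arc_measure)"
    "AE e in arc_measure. norm e = 1 \<and> (\<exists>b c k. r \<le> b \<and> b \<le> \<beta> \<and> r \<le> c \<and> c \<le> \<beta> \<and> \<bar>k\<bar> \<le> \<rho> * \<rho>\<^sup>2 / \<kappa> \<and>
       Q e = exp (- \<phi> (t * (rad A e / rad L e))) *
         ((1 - t * (rad A e / rad L e) * \<phi>' (t * (rad A e / rad L e))) * b * c + k))"
proof -
  let ?P = "\<lambda>s e. weight e (rad (family t s 0) e) * radial_deriv t e s"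
  have "\<exists>P. integrable arc_measure P \<and> (\<forall>e. norm e = 1 \<longrightarrow> P e = ?P s e) \<and>
      ((\<lambda>u. measure (gauge_measure \<phi> L) (family t s u)) has_real_derivative (\<integral>e. P e \<partial>arc_measure)) (at_right 0)"
    if s: "s \<in> {0..<1}" for s
  proof -
    have F: "round_body (r * (t + s + u)) (\<rho> * (t + s + u)) (family t s u)" if "0 \<le> u" for u
      using round_body_combination[OF A B C t _ that, of s] s by simp
    obtain P where P: "integrable arc_measure P"
      "\<And>e y. ((\<lambda>u. cone_mass (family t s u) e) has_real_derivative y) (at_right 0) \<Longrightarrow> P e = y"
      "((\<lambda>u. \<integral>e. cone_mass (family t s u) e \<partial>arc_measure) has_real_derivative (\<integral>e. P e \<partial>arc_measure)) (at_right 0)"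
    proof (rule has_real_derivative_integral_at_right[OF finite_arc_measure zero_less_one])
      show "integrable arc_measure (cone_mass (family t s u))" if "0 \<le> u" for u
        by (rule measure_gauge_measure[OF F[OF that]])
      show "AE e in arc_measure. \<exists>y. ((\<lambda>u. cone_mass (family t s u) e) has_real_derivative y) (at_right 0)"
        using AE_arc_measure_norm by eventually_elim (use cone_mass_deriv[OF t] s in auto)
      show "AE e in arc_measure. \<bar>cone_mass (family t s u) e - cone_mass (family t s 0) e\<bar> \<le> \<rho> * (t + 2) * \<beta> * u"
        if "0 < u" "u < 1" for u
        using AE_arc_measure_norm by eventually_elim (use cone_mass_lip[OF t, of _ s u] s that in auto)
    qed blast
    have "((\<lambda>u. measure (gauge_measure \<phi> L) (family t s u)) has_real_derivative (\<integral>e. P e \<partial>arc_measure)) (at_right 0)"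
    proof -
      have "((\<lambda>u. measure (gauge_measure \<phi> L) (family t s u)) has_real_derivative y) (at_right 0) \<longleftrightarrow>
        ((\<lambda>u. \<integral>e. cone_mass (family t s u) e \<partial>arc_measure) has_real_derivative y) (at_right 0)" for y
      proof (rule has_field_derivative_cong_eventually)
        show "\<forall>\<^sub>F u in at_right 0. measure (gauge_measure \<phi> L) (family t s u) = (\<integral>e. cone_mass (family t s u) e \<partial>arc_measure)"
          using eventually_at_right_less[of "0::real"]
          by eventually_elim (rule measure_gauge_measure(2)[OF F], simp)
      qed (rule measure_gauge_measure(2)[OF F[OF order_refl]])
      thus ?thesis using P(3) by simp
    qed
    thus ?thesis using P(1) P(2)[OF cone_mass_deriv[OF t]] s by (intro exI[of _ P]) auto
  qed
  then obtain P where P: "\<And>s. s \<in> {0..<1} \<Longrightarrow> integrable arc_measure (P s)"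
    "\<And>s e. s \<in> {0..<1} \<Longrightarrow> norm e = 1 \<Longrightarrow> P s e = ?P s e"
    "\<And>s. s \<in> {0..<1} \<Longrightarrow> ((\<lambda>u. measure (gauge_measure \<phi> L) (family t s u)) has_real_derivative (\<integral>e. P s e \<partial>arc_measure)) (at_right 0)"
    by metis
  obtain D where D: "\<And>e s. norm e = 1 \<Longrightarrow> 0 \<le> s \<Longrightarrow> s \<le> 1 \<Longrightarrow> \<bar>?P s e - ?P 0 e\<bar> \<le> D * s"
    by (rule first_variation_lip[OF t]) blast
  have PQ: "((\<lambda>s. P s e) has_real_derivative y) (at_right 0) \<longleftrightarrow> ((\<lambda>s. ?P s e) has_real_derivative y) (at_right 0)"
    if e: "norm e = 1" for e y
  proof (rule has_field_derivative_cong_eventually)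
    show "\<forall>\<^sub>F s in at_right 0. P s e = ?P s e"
      using eventually_at_right_real[of 0 "1::real"] by (auto elim!: eventually_mono simp: P(2)[OF _ e])
    show "P 0 e = ?P 0 e" by (rule P(2)[OF _ e]) simp
  qed
  have good: "AE e in arc_measure. norm e = 1 \<and> regular_normal B (dual_point e (foot A e)) \<and> regular_normal C (dual_point e (foot A e))"
    using AE_regular_foot[OF A C2 B] AE_regular_foot[OF A C2 C] by eventually_elim auto
  obtain Q where Q: "integrable arc_measure Q"
      "\<And>e y. ((\<lambda>s. P s e) has_real_derivative y) (at_right 0) \<Longrightarrow> Q e = y"
      "((\<lambda>s. \<integral>e. P s e \<partial>arc_measure) has_real_derivative (\<integral>e. Q e \<partial>arc_measure)) (at_right 0)"
  proof (rule has_real_derivative_integral_at_right[OF finite_arc_measure zero_less_one])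
    show "integrable arc_measure (P s)" if "0 \<le> s" "s < 1" for s using P(1) that by simp
    show "AE e in arc_measure. \<exists>y. ((\<lambda>s. P s e) has_real_derivative y) (at_right 0)"
      using good
    proof eventually_elim
      case (elim e)
      thus ?case using second_variation[OF t, of e] PQ[of e] by blast
    qed
    show "AE e in arc_measure. \<bar>P s e - P 0 e\<bar> \<le> D * s" if "0 < s" "s < 1" for s
      using AE_arc_measure_norm by eventually_elim (use P(2) D that in auto)
  qed blast
  show ?thesis
  proof (rule that[OF Q(1)])
    show "has_mixed_measure (gauge_measure \<phi> L) ((*\<^sub>R) t ` A) B C (\<integral>e. Q e \<partial>arc_measure)"
      unfolding has_mixed_measure_def
      by (rule exI[of _ "\<lambda>s. \<integral>e. P s e \<partial>arc_measure"], rule exI[of _ 1]) (use P(3) Q(3) in auto)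
    show "AE e in arc_measure. norm e = 1 \<and> (\<exists>b c k. r \<le> b \<and> b \<le> \<beta> \<and> r \<le> c \<and> c \<le> \<beta> \<and> \<bar>k\<bar> \<le> \<rho> * \<rho>\<^sup>2 / \<kappa> \<and>
       Q e = exp (- \<phi> (t * (rad A e / rad L e))) *
         ((1 - t * (rad A e / rad L e) * \<phi>' (t * (rad A e / rad L e))) * b * c + k))"
      using good
    proof eventually_elim
      case (elim e)
      thus ?case using second_variation[OF t, of e] PQ[of e] Q(2)[of e] by blast
    qed
  qed
qed

end

section \<open>Asymptotics\<close>

context mixed_setting
begin

text \<open>The gauge with respect to \<open>L\<close> of the boundary point of \<open>A\<close> in
  direction \<open>e\<close>.\<close>

abbreviation ratio :: "real^2 \<Rightarrow> real" where
  "ratio e \<equiv> rad A e / rad L e"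

lemma ratio_le:
  assumes e: "norm e = 1"
  shows "ratio e \<le> \<rho> / r"
  using rad_bounds[OF A e] rad_bounds[OF L e] rad_pos[OF A e] round_bodyD(1)[OF A] by (intro frac_le) auto

lemma ratio_lip:
  obtains K where "1 \<le> K" "\<And>e f. norm e = 1 \<Longrightarrow> norm f = 1 \<Longrightarrow> ratio e \<le> ratio f + K * norm (e - f)"
proof -
  define D where "D = \<rho> * (1 + \<rho> / r)"
  define K where "K = D / r + \<rho> / r * (D / r) + 1"
  have rr: "0 < r" "0 < \<rho>" using round_bodyD(1,8)[OF A] by auto
  have D: "0 < D" using rr by (simp add: D_def add_pos_pos)
  show ?thesis
  proof (rule that[of K])
    show "1 \<le> K" using rr D by (simp add: K_def)
    fix e f :: "real^2" assume e: "norm e = 1" and f: "norm f = 1"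
    let ?n = "norm (e - f)"
    have a: "\<bar>rad A e - rad A f\<bar> \<le> D * ?n" "\<bar>rad L e - rad L f\<bar> \<le> D * ?n"
      using rad_lip[OF A e f] rad_lip[OF L e f] by (simp_all add: D_def)
    have p: "0 < rad L e" "0 < rad L f" "r \<le> rad L e" using rad_pos[OF L e] rad_pos[OF L f] rad_bounds[OF L e] by auto
    have "ratio e - ratio f = (rad A e - rad A f) / rad L e + ratio f * ((rad L f - rad L e) / rad L e)"
      using p by (simp add: field_simps)
    also have "\<dots> \<le> D * ?n / r + \<rho> / r * (D * ?n / r)"
    proof (intro add_mono)
      have "(rad A e - rad A f) / rad L e \<le> (D * ?n) / rad L e" using a(1) p by (intro divide_right_mono) auto
      also have "\<dots> \<le> D * ?n / r" using p rr D by (intro divide_left_mono) auto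
      finally show "(rad A e - rad A f) / rad L e \<le> D * ?n / r" .
      have "(rad L f - rad L e) / rad L e \<le> (D * ?n) / rad L e" using a(2) p by (intro divide_right_mono) auto
      also have "\<dots> \<le> D * ?n / r" using p rr D by (intro divide_left_mono) auto
      finally have "(rad L f - rad L e) / rad L e \<le> D * ?n / r" .
      moreover have "0 \<le> ratio f" using rad_pos[OF A f] p by simp
      ultimately have "ratio f * ((rad L f - rad L e) / rad L e) \<le> ratio f * (D * ?n / r)" by (intro mult_left_mono)
      also have "\<dots> \<le> \<rho> / r * (D * ?n / r)" using ratio_le[OF f] D rr by (intro mult_right_mono) auto
      finally show "ratio f * ((rad L f - rad L e) / rad L e) \<le> \<rho> / r * (D * ?n / r)" .
    qed
    also have "\<dots> = (K - 1) * ?n" by (simp add: K_def algebra_simps)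
    also have "\<dots> \<le> K * ?n" by (simp add: algebra_simps)
    finally show "ratio e \<le> ratio f + K * ?n" by linarith
  qed
qed

text \<open>The tangent inequality with the nonnegative value at \<open>y\<^sub>0\<close> dropped.
  Where \<phi>' is positive at \<open>y\<^sub>0\<close>, it gives linear growth.\<close>

lemma \<phi>_above_tangent:
  assumes "0 < y\<^sub>0" "y\<^sub>0 \<le> y" shows "\<phi>' y\<^sub>0 * (y - y\<^sub>0) \<le> \<phi> y"
proof (cases "y = y\<^sub>0")
  case True
  thus ?thesis using assms \<phi>_nonneg by simp
next
  case False
  hence lt: "y\<^sub>0 < y" using assms by simp
  have "\<exists>z>y\<^sub>0. z < y \<and> \<phi> y - \<phi> y\<^sub>0 = (y - y\<^sub>0) * \<phi>' z"
    by (rule MVT2[OF lt]) (use assms \<phi>_deriv in auto)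
  then obtain z where z: "y\<^sub>0 < z" "\<phi> y - \<phi> y\<^sub>0 = (y - y\<^sub>0) * \<phi>' z" by blast
  have "(y - y\<^sub>0) * \<phi>' y\<^sub>0 \<le> (y - y\<^sub>0) * \<phi>' z" using z lt assms by (intro mult_left_mono \<phi>'_mono) auto
  thus ?thesis using z(2) \<phi>_nonneg[of y\<^sub>0] assms by (simp add: mult.commute)
qed

lemma \<phi>_le: "0 \<le> x \<Longrightarrow> x \<le> y \<Longrightarrow> \<phi> x \<le> \<phi> y"
  using \<phi>_mono by (auto simp: mono_on_def)

text \<open>Since \<open>\<phi>'\<close> is at most \<open>exp (\<epsilon> \<phi>)\<close>, the function \<open>exp (- \<epsilon> \<phi>)\<close> decreases at rate at most \<open>\<epsilon>\<close>,
  so \<open>\<phi>\<close> stays bounded by \<open>\<phi> x + ln 2 / \<epsilon>\<close> on an interval of length \<open>exp (- \<epsilon> \<phi> x) / (2 \<epsilon>)\<close>.\<close>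

lemma \<phi>_slow_growth:
  assumes \<epsilon>: "0 < \<epsilon>" and x: "0 < x" and sub: "\<And>y. x \<le> y \<Longrightarrow> \<phi>' y \<le> exp (\<epsilon> * \<phi> y)"
  shows "\<phi> (x + exp (- \<epsilon> * \<phi> x) / (2 * \<epsilon>)) \<le> \<phi> x + ln 2 / \<epsilon>"
proof -
  define w where "w = exp (- \<epsilon> * \<phi> x) / (2 * \<epsilon>)"
  have w: "0 < w" using \<epsilon> by (simp add: w_def)
  have "\<exists>z>x. z < x + w \<and> exp (- \<epsilon> * \<phi> (x + w)) - exp (- \<epsilon> * \<phi> x) = (x + w - x) * (exp (- \<epsilon> * \<phi> z) * (- \<epsilon> * \<phi>' z))"
    by (rule MVT2) (use w x in \<open>auto intro!: derivative_eq_intros DERIV_chain2[OF DERIV_exp] \<phi>_deriv\<close>)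
  then obtain z where z: "x < z"
    "exp (- \<epsilon> * \<phi> (x + w)) - exp (- \<epsilon> * \<phi> x) = (x + w - x) * (exp (- \<epsilon> * \<phi> z) * (- \<epsilon> * \<phi>' z))" by blast
  have "exp (- \<epsilon> * \<phi> z) * \<phi>' z \<le> exp (- \<epsilon> * \<phi> z) * exp (\<epsilon> * \<phi> z)"
    using sub[of z] z by (intro mult_left_mono) auto
  hence "exp (- \<epsilon> * \<phi> z) * \<phi>' z \<le> 1" by (simp flip: exp_add)
  hence "(w * \<epsilon>) * (exp (- \<epsilon> * \<phi> z) * \<phi>' z) \<le> (w * \<epsilon>) * 1" using w \<epsilon> by (intro mult_left_mono) auto
  hence "exp (- \<epsilon> * \<phi> (x + w)) \<ge> exp (- \<epsilon> * \<phi> x) - w * \<epsilon>" using z(2) by (simp add: mult_ac)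
  also have "exp (- \<epsilon> * \<phi> x) - w * \<epsilon> = exp (- \<epsilon> * \<phi> x) / 2" using \<epsilon> by (simp add: w_def)
  also have "\<dots> = exp (- \<epsilon> * \<phi> x - ln 2)" by (simp add: exp_diff)
  finally have "- \<epsilon> * \<phi> x - ln 2 \<le> - \<epsilon> * \<phi> (x + w)" by simp
  hence "\<epsilon> * \<phi> (x + w) \<le> \<epsilon> * (\<phi> x + ln 2 / \<epsilon>)" using \<epsilon> by (simp add: algebra_simps)
  thus ?thesis using \<epsilon> by (simp add: w_def)
qed

text \<open>Let \<Phi> be the value of \<phi> at R t, with R the inner ratio. Upper bound: \<phi>'
  exp(-\<phi>) \<le> exp(-(1 - \<epsilon>) \<phi>), and \<phi> is at least \<Phi> in every
  direction. Lower bound: directions within \<eta> of the optimal one, with \<eta> of order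
  exp(-\<epsilon> \<Phi>) / t, raise \<phi> by at most ln 2 / \<epsilon>; their arc measure is of
  order at least \<eta>^2, that is exp(-2 \<epsilon> \<Phi>) / t^2, and the growth of y \<phi>' y
  gives back one power of t.\<close>

lemma mixed_measure_bounds:
  assumes y0: "0 < y\<^sub>0" "0 < \<phi>' y\<^sub>0" and \<epsilon>: "0 < \<epsilon>" "\<epsilon> < 1"
    and sub: "\<forall>\<^sub>F y in at_top. \<phi>' y \<le> exp (\<epsilon> * \<phi> y)"
  obtains c c' where "0 < c" "0 < c'" "\<forall>\<^sub>F t in at_top. \<exists>m. has_mixed_measure (gauge_measure \<phi> L) ((*\<^sub>R) t ` A) B C m \<and>
     c / t * exp (- (1 + 2 * \<epsilon>) * \<phi> (inner_ratio A L * t)) \<le> - m \<and>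
     - m \<le> c' * t * exp (- (1 - \<epsilon>) * \<phi> (inner_ratio A L * t))"
proof -
  let ?R = "inner_ratio A L" and ?S = "arc_measure"
  interpret S: finite_measure arc_measure by (rule finite_arc_measure)
  obtain e\<^sub>0 where e0: "norm e\<^sub>0 = 1" "?R = ratio e\<^sub>0" "\<And>e. norm e = 1 \<Longrightarrow> ?R \<le> ratio e"
    by (rule inner_ratio_eq[OF A L]) blast
  obtain K where K: "1 \<le> K" "\<And>e f. norm e = 1 \<Longrightarrow> norm f = 1 \<Longrightarrow> ratio e \<le> ratio f + K * norm (e - f)"
    by (rule ratio_lip) blast
  have rr: "0 < r" "0 < \<rho>" using round_bodyD(1,8)[OF A] by auto
  have Rp: "0 < ?R" using e0(1,2) rad_pos[OF A e0(1)] rad_pos[OF L e0(1)] by simp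
  define k\<^sub>0 where "k\<^sub>0 = \<rho> * \<rho>\<^sup>2 / \<kappa>"
  have k0: "0 \<le> k\<^sub>0" using rr \<kappa>(1) by (simp add: k\<^sub>0_def)
  define q where "q = \<phi>' y\<^sub>0"
  have q: "0 < q" using y0 by (simp add: q_def)
  obtain Y where Y: "\<And>y. Y \<le> y \<Longrightarrow> \<phi>' y \<le> exp (\<epsilon> * \<phi> y)" using sub by (auto simp: eventually_at_top_linorder)
  \<comment> \<open>The summand 1 makes the constant positive without computing the total arc
    measure.\<close>
  define c\<^sub>1 where "c\<^sub>1 = (\<beta>\<^sup>2 + k\<^sub>0) * (\<rho> / r) * (measure ?S UNIV + 1)"
  define c\<^sub>2 where "c\<^sub>2 = r\<^sup>2 / 2 * (?R * q) * exp (- (ln 2 / \<epsilon>)) * ((1 / (2 * \<epsilon> * K))\<^sup>2 / 8)"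
  \<comment> \<open>From this size of y \<phi>' y on, the main term absorbs the bounded term
    \<open>k\<close>: since \<open>r\<^sup>2 * Z = 2 * r\<^sup>2 + 2 * k\<^sub>0\<close>, half of it
    survives.\<close>
  define Z where "Z = 2 + 2 * k\<^sub>0 / r\<^sup>2"
  have \<beta>r: "r \<le> \<beta>" using supp_dual_bound[OF B e0(1), of 0] T_pos by simp
  have c1: "0 < c\<^sub>1"
  proof -
    have "0 < \<beta>\<^sup>2 + k\<^sub>0" using k0 \<beta>r rr by (intro add_pos_nonneg) auto
    moreover have "0 < measure ?S UNIV + 1" by (simp add: add_nonneg_pos)
    ultimately show ?thesis using rr by (simp add: c\<^sub>1_def)
  qed
  have c2: "0 < c\<^sub>2" using rr Rp q \<epsilon> K by (simp add: c\<^sub>2_def)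
  \<comment> \<open>Beyond positivity of t, the conditions ensure in turn that \<phi>' \<ge> q from
    R t on, that the exponential bound on \<phi>' holds from there on, that the integrand is
    negative, and that \<eta> \<le> 1.\<close>
  have "\<forall>\<^sub>F t in at_top. 0 < t \<and> y\<^sub>0 \<le> ?R * t \<and> Y \<le> ?R * t \<and> Z \<le> ?R * q * t \<and> 1 / (2 * \<epsilon>) \<le> t"
  proof -
    have lin: "\<forall>\<^sub>F t in at_top. a \<le> b * t" if "0 < b" for a b :: real
      using eventually_ge_at_top[of "a / b"] by eventually_elim (use that in \<open>simp add: pos_divide_le_eq mult.commute\<close>)
    show ?thesis
      by (intro eventually_conj lin Rp eventually_gt_at_top eventually_ge_at_top mult_pos_pos q)
  qed
  hence "\<forall>\<^sub>F t in at_top. \<exists>m. has_mixed_measure (gauge_measure \<phi> L) ((*\<^sub>R) t ` A) B C m \<and>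
     c\<^sub>2 / t * exp (- (1 + 2 * \<epsilon>) * \<phi> (?R * t)) \<le> - m \<and>
     - m \<le> c\<^sub>1 * t * exp (- (1 - \<epsilon>) * \<phi> (?R * t))"
  proof eventually_elim
    case (elim t)
    hence t: "0 < t" "y\<^sub>0 \<le> ?R * t" "Y \<le> ?R * t" "Z \<le> ?R * q * t" "1 / (2 * \<epsilon>) \<le> t" by auto
    define \<Phi> where "\<Phi> = \<phi> (?R * t)"
    have Rt: "0 < ?R * t" using Rp t by simp
    have \<Phi>0: "0 \<le> \<Phi>" unfolding \<Phi>_def using Rt by (intro \<phi>_nonneg) simp
    obtain Q where Q: "integrable ?S Q"
      "has_mixed_measure (gauge_measure \<phi> L) ((*\<^sub>R) t ` A) B C (\<integral>e. Q e \<partial>?S)"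
      "AE e in ?S. norm e = 1 \<and> (\<exists>b c k. r \<le> b \<and> b \<le> \<beta> \<and> r \<le> c \<and> c \<le> \<beta> \<and> \<bar>k\<bar> \<le> \<rho> * \<rho>\<^sup>2 / \<kappa> \<and>
       Q e = exp (- \<phi> (t * ratio e)) * ((1 - t * ratio e * \<phi>' (t * ratio e)) * b * c + k))"
      by (rule has_mixed_measure_family[OF t(1)]) blast
    have Qb: "AE e in ?S. norm e = 1 \<and> r\<^sup>2 / 2 * (t * ratio e * \<phi>' (t * ratio e)) * exp (- \<phi> (t * ratio e)) \<le> - Q e \<and>
        - Q e \<le> (\<beta>\<^sup>2 + k\<^sub>0) * (t * ratio e * \<phi>' (t * ratio e)) * exp (- \<phi> (t * ratio e)) \<and>
        ?R * q * t \<le> t * ratio e * \<phi>' (t * ratio e) \<and> ?R * t \<le> t * ratio e"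
      using Q(3)
    proof eventually_elim
      case (elim e)
      then obtain b c k where e: "norm e = 1" and b: "r \<le> b" "b \<le> \<beta>" and c: "r \<le> c" "c \<le> \<beta>" and k: "\<bar>k\<bar> \<le> k\<^sub>0"
        and Qe: "Q e = exp (- \<phi> (t * ratio e)) * ((1 - t * ratio e * \<phi>' (t * ratio e)) * b * c + k)"
        unfolding k\<^sub>0_def by blast
      define y where "y = t * ratio e"
      define z where "z = y * \<phi>' y"
      have y: "?R * t \<le> y" unfolding y_def mult.commute[of _ t] using e0(3)[OF e] t(1) by (intro mult_left_mono) auto
      have "q \<le> \<phi>' y" unfolding q_def using y t y0 by (intro \<phi>'_mono) auto
      hence zR: "?R * q * t \<le> z" unfolding z_def using mult_mono[OF y, of q "\<phi>' y"] q y Rt by (simp add: mult_ac)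
      hence zZ: "Z \<le> z" using t(4) by linarith
      have z1: "1 \<le> z" using zZ k0 rr unfolding Z_def by (smt (verit) divide_nonneg_nonneg zero_le_power2)
      have bc: "r\<^sup>2 \<le> b * c" "b * c \<le> \<beta>\<^sup>2" using b c rr unfolding power2_eq_square by (auto intro!: mult_mono)
      have "r\<^sup>2 * Z = 2 * r\<^sup>2 + 2 * k\<^sub>0" using rr by (simp add: Z_def algebra_simps)
      hence "2 * r\<^sup>2 + 2 * k\<^sub>0 \<le> r\<^sup>2 * z" using mult_left_mono[OF zZ, of "r\<^sup>2"] by simp
      moreover have "(z - 1) * r\<^sup>2 \<le> (z - 1) * (b * c)" using bc(1) z1 by (intro mult_left_mono) auto
      ultimately have lo: "r\<^sup>2 / 2 * z \<le> (z - 1) * (b * c) - k" using k by (simp add: algebra_simps)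
      have "(z - 1) * (b * c) \<le> z * \<beta>\<^sup>2" using bc z1 b c rr by (intro mult_mono mult_nonneg_nonneg) auto
      moreover have "k\<^sub>0 \<le> z * k\<^sub>0" using mult_right_mono[OF z1 k0] by simp
      ultimately have hi: "(z - 1) * (b * c) - k \<le> (\<beta>\<^sup>2 + k\<^sub>0) * z" using k by (simp add: algebra_simps)
      have Qz: "- Q e = ((z - 1) * (b * c) - k) * exp (- \<phi> y)" unfolding Qe z_def y_def by (simp add: algebra_simps)
      have "r\<^sup>2 / 2 * z * exp (- \<phi> y) \<le> - Q e" "- Q e \<le> (\<beta>\<^sup>2 + k\<^sub>0) * z * exp (- \<phi> y)"
        unfolding Qz using lo hi by (auto intro!: mult_right_mono)
      thus ?case using e zR y unfolding z_def y_def by simp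
    qed
    have upper: "- (\<integral>e. Q e \<partial>?S) \<le> c\<^sub>1 * t * exp (- (1 - \<epsilon>) * \<Phi>)"
    proof -
      define M where "M = (\<beta>\<^sup>2 + k\<^sub>0) * (t * (\<rho> / r)) * exp (- (1 - \<epsilon>) * \<Phi>)"
      have M0: "0 \<le> M" using rr t k0 by (auto simp: M_def intro!: mult_nonneg_nonneg)
      have "- (\<integral>e. Q e \<partial>?S) = (\<integral>e. - Q e \<partial>?S)" by simp
      also have "\<dots> \<le> (\<integral>e. M \<partial>?S)"
      proof (rule integral_mono_AE)
        show "AE e in ?S. - Q e \<le> M" using Qb
        proof eventually_elim
          case (elim e)
          let ?y = "t * ratio e"
          have y1: "?R * t \<le> ?y" using elim by blast
          have y3: "?y \<le> t * (\<rho> / r)" using elim t(1) by (intro mult_left_mono ratio_le) auto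
          have y2: "0 < ?y" using y1 Rt by linarith
          have "\<Phi> \<le> \<phi> ?y" unfolding \<Phi>_def using y1 Rt by (intro \<phi>_le) auto
          hence "(1 - \<epsilon>) * \<Phi> \<le> (1 - \<epsilon>) * \<phi> ?y" using \<epsilon> by (intro mult_left_mono) auto
          have "\<phi>' ?y * exp (- \<phi> ?y) \<le> exp (\<epsilon> * \<phi> ?y) * exp (- \<phi> ?y)"
            using Y[of ?y] y1 t(3) by (intro mult_right_mono) auto
          also have "\<dots> = exp (- ((1 - \<epsilon>) * \<phi> ?y))" by (simp add: algebra_simps flip: exp_add)
          also have "\<dots> \<le> exp (- (1 - \<epsilon>) * \<Phi>)" by (simp only: exp_le_cancel_iff mult_minus_left neg_le_iff_le \<open>(1 - \<epsilon>) * \<Phi> \<le> (1 - \<epsilon>) * \<phi> ?y\<close>)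
          finally have d: "\<phi>' ?y * exp (- \<phi> ?y) \<le> exp (- (1 - \<epsilon>) * \<Phi>)" .
          have "0 \<le> \<phi>' ?y * exp (- \<phi> ?y)" using \<phi>'_nonneg[OF y2] by simp
          moreover have "0 \<le> t * (\<rho> / r)" using y2 y3 by linarith
          ultimately have "?y * (\<phi>' ?y * exp (- \<phi> ?y)) \<le> (t * (\<rho> / r)) * exp (- (1 - \<epsilon>) * \<Phi>)"
            by (intro mult_mono[OF y3 d])
          hence "(\<beta>\<^sup>2 + k\<^sub>0) * (?y * (\<phi>' ?y * exp (- \<phi> ?y))) \<le> (\<beta>\<^sup>2 + k\<^sub>0) * ((t * (\<rho> / r)) * exp (- (1 - \<epsilon>) * \<Phi>))"
            using k0 by (intro mult_left_mono) auto
          moreover have "- Q e \<le> (\<beta>\<^sup>2 + k\<^sub>0) * (?y * \<phi>' ?y) * exp (- \<phi> ?y)" using elim by blast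
          ultimately show ?case unfolding M_def by (simp only: mult.assoc)
        qed
      qed (use Q(1) in auto)
      also have "\<dots> = M * measure ?S UNIV" by simp
      also have "\<dots> \<le> M * (measure ?S UNIV + 1)" using M0 by (intro mult_left_mono) auto
      also have "\<dots> = c\<^sub>1 * t * exp (- (1 - \<epsilon>) * \<Phi>)" by (simp add: M_def c\<^sub>1_def mult_ac)
      finally show ?thesis .
    qed
    have lower: "c\<^sub>2 / t * exp (- (1 + 2 * \<epsilon>) * \<Phi>) \<le> - (\<integral>e. Q e \<partial>?S)"
    proof -
      define w where "w = exp (- \<epsilon> * \<Phi>) / (2 * \<epsilon>)"
      \<comment> \<open>On the ball of this radius the ratio exceeds its minimum R by at most K
        \<eta> = w / t, so \<open>t * ratio e\<close> stays in [R t, R t + w], the interval of slow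
        growth.\<close>
      define \<eta> where "\<eta> = w / (t * K)"
      define M where "M = r\<^sup>2 / 2 * (?R * q * t) * exp (- \<Phi> - ln 2 / \<epsilon>)"
      have w: "0 < w" using \<epsilon> by (simp add: w_def)
      have M0: "0 \<le> M" using q Rp t(1) rr by (auto simp: M_def intro!: mult_nonneg_nonneg)
      have tK: "0 < t * K" using t(1) K(1) by simp
      have "exp (- \<epsilon> * \<Phi>) \<le> 1" using \<epsilon> \<Phi>0 by simp
      hence "w \<le> 1 / (2 * \<epsilon>)" unfolding w_def using \<epsilon> by (intro divide_right_mono) auto
      also have "\<dots> \<le> t * 1" using t(5) by simp
      also have "\<dots> \<le> t * K" using K(1) t(1) by (intro mult_left_mono) auto
      finally have \<eta>: "0 < \<eta>" "\<eta> \<le> 1" using w tK by (auto simp: \<eta>_def)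
      have slow: "\<phi> (?R * t + w) \<le> \<Phi> + ln 2 / \<epsilon>"
        unfolding \<Phi>_def w_def using Y t(3) by (intro \<phi>_slow_growth \<epsilon> Rt) auto
      have "M * measure ?S (ball e\<^sub>0 \<eta>) = (\<integral>e. M * indicator (ball e\<^sub>0 \<eta>) e \<partial>?S)" by simp
      also have "\<dots> \<le> (\<integral>e. - Q e \<partial>?S)"
      proof (rule integral_mono_AE)
        show "integrable ?S (\<lambda>e. M * indicator (ball e\<^sub>0 \<eta>) e)"
          by (intro integrable_mult_right integrable_real_indicator) (auto simp: S.emeasure_eq_measure)
        show "AE e in ?S. M * indicator (ball e\<^sub>0 \<eta>) e \<le> - Q e" using Qb
        proof eventually_elim
          case (elim e)
          let ?y = "t * ratio e"
          have z: "?R * q * t \<le> ?y * \<phi>' ?y" "?R * t \<le> ?y"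
            and lo: "r\<^sup>2 / 2 * (?y * \<phi>' ?y) * exp (- \<phi> ?y) \<le> - Q e" using elim by blast+
          have "0 \<le> ?R * q * t" using Rp q t(1) by simp
          hence "0 \<le> ?y * \<phi>' ?y" using z(1) by linarith
          hence z0: "0 \<le> r\<^sup>2 / 2 * (?y * \<phi>' ?y)" by (rule mult_nonneg_nonneg[rotated]) simp
          show ?case
          proof (cases "e \<in> ball e\<^sub>0 \<eta>")
            case True
            hence "norm (e - e\<^sub>0) \<le> \<eta>" by (simp add: dist_norm norm_minus_commute)
            hence "K * norm (e - e\<^sub>0) \<le> K * \<eta>" using K(1) by (intro mult_left_mono) auto
            hence "ratio e \<le> ?R + K * \<eta>" using K(2)[of e e\<^sub>0] elim e0(1,2) by linarith
            hence "?y \<le> t * (?R + K * \<eta>)" using t(1) by (intro mult_left_mono) auto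
            also have "\<dots> = ?R * t + w" using K(1) t(1) by (simp add: \<eta>_def algebra_simps)
            finally have "\<phi> ?y \<le> \<phi> (?R * t + w)" using z(2) Rt by (intro \<phi>_le) auto
            hence "\<phi> ?y \<le> \<Phi> + ln 2 / \<epsilon>" using slow by linarith
            hence m1: "exp (- \<Phi> - ln 2 / \<epsilon>) \<le> exp (- \<phi> ?y)" by simp
            have m2: "r\<^sup>2 / 2 * (?R * q * t) \<le> r\<^sup>2 / 2 * (?y * \<phi>' ?y)"
              by (rule mult_left_mono[OF z(1)]) simp
            have "r\<^sup>2 / 2 * (?R * q * t) * exp (- \<Phi> - ln 2 / \<epsilon>) \<le> r\<^sup>2 / 2 * (?y * \<phi>' ?y) * exp (- \<phi> ?y)"
              by (rule mult_mono[OF m2 m1 z0]) simp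
            hence "M \<le> - Q e" unfolding M_def using lo by (rule order_trans)
            thus ?thesis using True by simp
          next
            case False
            \<comment> \<open>Away from the optimal direction only the sign of \<open>Q\<close> is
              used.\<close>
            have "0 \<le> r\<^sup>2 / 2 * (?y * \<phi>' ?y) * exp (- \<phi> ?y)" using z0 by (rule mult_nonneg_nonneg) simp
            hence "0 \<le> - Q e" using lo by (rule order_trans)
            thus ?thesis using False by simp
          qed
        qed
      qed (use Q(1) in simp)
      also have "\<dots> = - (\<integral>e. Q e \<partial>?S)" by simp
      finally have "M * measure ?S (ball e\<^sub>0 \<eta>) \<le> - (\<integral>e. Q e \<partial>?S)" .
      moreover have "M * (\<eta>\<^sup>2 / 8) \<le> M * measure ?S (ball e\<^sub>0 \<eta>)"
        by (rule mult_left_mono[OF measure_arc_measure_ball[OF e0(1) \<eta>] M0])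
      moreover have "M * (\<eta>\<^sup>2 / 8) = c\<^sub>2 / t * exp (- (1 + 2 * \<epsilon>) * \<Phi>)"
      proof -
        have "exp (- \<Phi> - ln 2 / \<epsilon>) * (exp (- \<epsilon> * \<Phi>))\<^sup>2 = exp (- (ln 2 / \<epsilon>)) * exp (- (1 + 2 * \<epsilon>) * \<Phi>)"
          unfolding power2_eq_square exp_add[symmetric] by (simp add: algebra_simps)
        moreover have "M * (\<eta>\<^sup>2 / 8) = r\<^sup>2 / 2 * (?R * q) * ((1 / (2 * \<epsilon> * K))\<^sup>2 / 8) / t * (exp (- \<Phi> - ln 2 / \<epsilon>) * (exp (- \<epsilon> * \<Phi>))\<^sup>2)"
          using t(1) by (simp add: M_def \<eta>_def w_def power_divide power_mult_distrib power2_eq_square mult_ac)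
        ultimately show ?thesis by (simp add: c\<^sub>2_def)
      qed
      ultimately show ?thesis by linarith
    qed
    show ?case using Q(2) upper lower unfolding \<Phi>_def by blast
  qed
  thus ?thesis by (rule that[OF c2 c1])
qed

end

section \<open>Passage from the two-sided bound to the limit\<close>

theorem theorem5p3:
  fixes A B C L :: "(real^2) set" and \<phi> \<phi>' \<phi>'' :: "real \<Rightarrow> real"
  assumes "convex_body A" "convex_body B" "convex_body C" "convex_body L"
    and "0 \<in> interior A" "0 \<in> interior B" "0 \<in> interior C" "0 \<in> interior L"
    and "C2_plus A" "C2_plus L"
    and "\<And>t. 0 \<le> t \<Longrightarrow> 0 \<le> \<phi> t"
    and "mono_on {0..} \<phi>"
    and "\<not> \<phi> constant_on {0..}"
    and "convex_on {0..} \<phi>"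
    and "\<And>t. 0 < t \<Longrightarrow> (\<phi> has_real_derivative \<phi>' t) (at t)"
    and "\<And>t. 0 < t \<Longrightarrow> (\<phi>' has_real_derivative \<phi>'' t) (at t)"
    and "continuous_on {0<..} \<phi>''"
    and "prob_space (gauge_measure \<phi> L)"
    and "((\<lambda>t. ln (\<phi>' t) / \<phi> t) \<longlongrightarrow> 0) at_top"
  shows "(\<forall>\<^sub>F t in at_top. \<exists>m<0. has_mixed_measure (gauge_measure \<phi> L) ((*\<^sub>R) t ` A) B C m)
    \<and> ((\<lambda>t. ln (- mixed_measure (gauge_measure \<phi> L) ((*\<^sub>R) t ` A) B C)
              / \<phi> (inner_ratio A L * t)) \<longlongrightarrow> -1) at_top"
proof -
  note nonneg = assms(11) and mono = assms(12) and deriv = assms(15)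
  have tangent: "\<phi>' x * (y - x) \<le> \<phi> y - \<phi> x" if "0 < x" "0 \<le> y" for x y
    by (rule convex_on_imp_above_tangent[OF assms(14)])
       (use that deriv in \<open>auto intro: has_field_derivative_at_within simp: interior_real_atLeast\<close>)
  have d_mono: "\<phi>' x \<le> \<phi>' y" if "0 < x" "x \<le> y" for x y
  proof (cases "x = y")
    case False
    hence "0 \<le> (\<phi>' y - \<phi>' x) * (y - x)" using tangent[of x y] tangent[of y x] that by (simp add: algebra_simps)
    thus ?thesis using False that by (simp add: zero_le_mult_iff)
  qed simp
  have d_nonneg: "0 \<le> \<phi>' x" if "0 < x" for x
  proof -
    have "\<phi> (x/2) \<le> \<phi> x" using mono that by (auto simp: mono_on_def)
    hence "\<phi>' x * (x/2 - x) \<le> 0" using tangent[of x "x/2"] that by linarith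
    thus ?thesis using that by (simp add: zero_le_mult_iff)
  qed
  obtain y\<^sub>0 where y0: "0 < y\<^sub>0" "0 < \<phi>' y\<^sub>0"
  proof -
    \<comment> \<open>A nonconstant nondecreasing \<phi> exceeds \<phi> 0 at some b; the tangent at
      b, evaluated at 0, then has to have positive slope.\<close>
    obtain b where b: "0 \<le> b" "\<phi> b \<noteq> \<phi> 0" using assms(13) unfolding constant_on_def by force
    hence "\<phi> 0 < \<phi> b" using mono by (force simp: mono_on_def)
    moreover have b0: "0 < b" using b by (cases "b = 0") auto
    ultimately have "\<phi>' b * (0 - b) < 0" using tangent[of b 0] by linarith
    hence "0 < \<phi>' b" using b0 by (simp add: zero_less_mult_iff)
    thus ?thesis using that b0 by blast
  qed
  obtain r \<rho> where body: "round_body r \<rho> A" "round_body r \<rho> B" "round_body r \<rho> C" "round_body r \<rho> L"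
  proof -
    obtain ra \<rho>a rb \<rho>b rc \<rho>c rl \<rho>l where *: "round_body ra \<rho>a A" "round_body rb \<rho>b B" "round_body rc \<rho>c C" "round_body rl \<rho>l L"
      using convex_body_imp_round_body assms(1-8) by meson
    show ?thesis
      by (rule that[of "min (min ra rb) (min rc rl)" "max (max \<rho>a \<rho>b) (max \<rho>c \<rho>l)"])
         (rule round_body_mono[OF *(1)] round_body_mono[OF *(2)] round_body_mono[OF *(3)] round_body_mono[OF *(4)];
          use *[THEN round_bodyD(1)] in auto)+
  qed
  interpret mixed_setting \<phi> \<phi>' L r \<rho> A B C
    by unfold_locales (use body nonneg mono deriv d_mono d_nonneg assms(9) in auto)
  let ?\<mu> = "gauge_measure \<phi> L" and ?R = "inner_ratio A L"
  have Rp: "0 < ?R"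
    by (rule inner_ratio_eq[OF body(1,4)]) (use rad_pos[OF body(1)] rad_pos[OF body(4)] in force)
  have lin: "\<phi>' y\<^sub>0 * (y - y\<^sub>0) \<le> \<phi> y" if "y\<^sub>0 \<le> y" for y
    using \<phi>_above_tangent[OF y0(1) that] .
  \<comment> \<open>The growth hypothesis in exponentiated form; beyond \<open>y\<^sub>0\<close>
    both \<phi> and \<phi>' are positive, so the division and the logarithm mean what they
    should.\<close>
  have sub: "\<forall>\<^sub>F y in at_top. \<phi>' y \<le> exp (\<epsilon> * \<phi> y)" if "0 < \<epsilon>" for \<epsilon>
    using order_tendstoD(2)[OF assms(19) that] eventually_gt_at_top[of y\<^sub>0]
  proof eventually_elim
    case (elim y)
    have "0 < \<phi>' y\<^sub>0 * (y - y\<^sub>0)" using y0 elim by simp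
    hence "0 < \<phi> y" using lin[of y] elim by linarith
    hence "ln (\<phi>' y) \<le> \<epsilon> * \<phi> y" using elim by (simp add: pos_divide_less_eq)
    moreover have "0 < \<phi>' y" using d_mono[of y\<^sub>0 y] y0 elim by linarith
    ultimately show ?case by (metis exp_le_cancel_iff exp_ln)
  qed
  have main: "\<forall>\<^sub>F t in at_top. \<exists>m<0. has_mixed_measure ?\<mu> ((*\<^sub>R) t ` A) B C m \<and> \<bar>ln (- m) / \<phi> (?R * t) - -1\<bar> < 4 * \<epsilon>"
    if \<epsilon>: "0 < \<epsilon>" "\<epsilon> < 1" for \<epsilon> :: real
  proof -
    obtain c c' where c: "0 < c" "0 < c'" and ev: "\<forall>\<^sub>F t in at_top. \<exists>m. has_mixed_measure ?\<mu> ((*\<^sub>R) t ` A) B C m \<and>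
       c / t * exp (- (1 + 2 * \<epsilon>) * \<phi> (?R * t)) \<le> - m \<and>
       - m \<le> c' * t * exp (- (1 - \<epsilon>) * \<phi> (?R * t))"
      by (rule mixed_measure_bounds[OF y0 \<epsilon> sub[OF \<epsilon>(1)]]) blast
    have coeff: "0 < \<epsilon> * \<phi>' y\<^sub>0 * ?R" using \<epsilon> y0 Rp by simp
    \<comment> \<open>By the tangent at \<open>y\<^sub>0\<close>, the denominator grows at least
      linearly in t, so \<epsilon> times it absorbs ln t and the logarithms of the
      constants.\<close>
    have "\<forall>\<^sub>F t in at_top. ln t + (\<bar>ln c\<bar> + \<bar>ln c'\<bar> + \<epsilon> * \<phi>' y\<^sub>0 * y\<^sub>0) \<le> (\<epsilon> * \<phi>' y\<^sub>0 * ?R) * t"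
      using coeff by real_asymp
    with ev eventually_gt_at_top[of 1] eventually_gt_at_top[of "y\<^sub>0 / ?R"]
    show ?thesis
    proof eventually_elim
      case (elim t)
      define \<Phi> where "\<Phi> = \<phi> (?R * t)"
      obtain m where m: "has_mixed_measure ?\<mu> ((*\<^sub>R) t ` A) B C m"
        "c / t * exp (- (1 + 2 * \<epsilon>) * \<Phi>) \<le> - m" "- m \<le> c' * t * exp (- (1 - \<epsilon>) * \<Phi>)"
        using elim(1) unfolding \<Phi>_def by blast
      have t: "1 < t" "y\<^sub>0 < ?R * t" using elim(2,3) Rp by (auto simp: pos_divide_less_eq mult.commute)
      have "0 < c / t * exp (- (1 + 2 * \<epsilon>) * \<Phi>)" using c t by simp
      hence m0: "0 < - m" using m(2) by linarith
      have l: "\<phi>' y\<^sub>0 * (?R * t - y\<^sub>0) \<le> \<Phi>" unfolding \<Phi>_def using t by (intro lin) simp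
      have "0 < \<phi>' y\<^sub>0 * (?R * t - y\<^sub>0)" using y0 t by simp
      hence \<Phi>: "0 < \<Phi>" using l by linarith
      have "\<epsilon> * (\<phi>' y\<^sub>0 * (?R * t - y\<^sub>0)) \<le> \<epsilon> * \<Phi>" using l \<epsilon> by (intro mult_left_mono) auto
      hence small: "ln t + \<bar>ln c\<bar> + \<bar>ln c'\<bar> \<le> \<epsilon> * \<Phi>" using elim(4) by (simp add: algebra_simps)
      have "ln (c / t * exp (- (1 + 2 * \<epsilon>) * \<Phi>)) \<le> ln (- m)" using m(2) c t by (intro ln_mono) auto
      hence lo: "ln c - ln t - (1 + 2 * \<epsilon>) * \<Phi> \<le> ln (- m)" using c t by (simp add: ln_mult ln_div algebra_simps)
      have "ln (- m) \<le> ln (c' * t * exp (- (1 - \<epsilon>) * \<Phi>))" using m(3) m0 by (intro ln_mono) auto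
      hence hi: "ln (- m) \<le> ln c' + ln t - (1 - \<epsilon>) * \<Phi>" using c t by (simp add: ln_mult algebra_simps)
      \<comment> \<open>Two \<epsilon> come from the exponent of the lower bound and one from the
        logarithms; the fourth, in the next line, makes the inequality strict.\<close>
      have "\<bar>ln (- m) + \<Phi>\<bar> \<le> 3 * \<epsilon> * \<Phi>" using lo hi small ln_ge_zero[of t] t \<epsilon> \<Phi>
        by (auto simp: abs_le_iff algebra_simps)
      also have "\<dots> < 4 * \<epsilon> * \<Phi>" using \<epsilon> \<Phi> by simp
      finally have "\<bar>ln (- m) + \<Phi>\<bar> / \<Phi> < 4 * \<epsilon>" using \<Phi> by (simp add: pos_divide_less_eq)
      moreover have "\<bar>ln (- m) / \<Phi> - -1\<bar> = \<bar>ln (- m) + \<Phi>\<bar> / \<Phi>"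
      proof -
        have "ln (- m) / \<Phi> - -1 = (ln (- m) + \<Phi>) / \<Phi>" using \<Phi> by (simp add: field_simps)
        thus ?thesis using \<Phi> by (simp add: abs_divide)
      qed
      ultimately show ?case using m(1) m0 unfolding \<Phi>_def by (intro exI[of _ m]) auto
    qed
  qed
  show ?thesis
  proof
    show "\<forall>\<^sub>F t in at_top. \<exists>m<0. has_mixed_measure ?\<mu> ((*\<^sub>R) t ` A) B C m"
      using main[of "1/2"] by (auto elim!: eventually_mono)
    show "((\<lambda>t. ln (- mixed_measure ?\<mu> ((*\<^sub>R) t ` A) B C) / \<phi> (?R * t)) \<longlongrightarrow> -1) at_top"
    proof (rule tendstoI)
      fix \<delta> :: real assume \<delta>: "0 < \<delta>"
      define \<epsilon> where "\<epsilon> = min (1/2) (\<delta> / 4)"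
      have \<epsilon>: "0 < \<epsilon>" "\<epsilon> < 1" "4 * \<epsilon> \<le> \<delta>" using \<delta> by (auto simp: \<epsilon>_def)
      show "\<forall>\<^sub>F t in at_top. dist (ln (- mixed_measure ?\<mu> ((*\<^sub>R) t ` A) B C) / \<phi> (?R * t)) (-1) < \<delta>"
        using main[OF \<epsilon>(1,2)]
      proof eventually_elim
        case (elim t)
        then obtain m where m: "has_mixed_measure ?\<mu> ((*\<^sub>R) t ` A) B C m" "\<bar>ln (- m) / \<phi> (?R * t) - -1\<bar> < 4 * \<epsilon>"
          by blast
        thus ?case unfolding mixed_measure_eq[OF m(1)] dist_real_def using \<epsilon>(3) by linarith
      qed
    qed
  qed
qed

end
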